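(* Let $\Omega\subset\mathbb R^N$ be a smooth bounded domain, $\kappa>0$, $T>0$ and $Q_T=\Omega\times(0,T)$. Let $u$ be an $L^2$ subsolution on $Q_T$ of $$u_t+\partial I_{[u_0(x),\infty)}(u)-\Delta u+u^3-\kappa u\ni0$$ with obstacle function $u_0=u(0)$, and let $v$ be an $L^2$ supersolution on $Q_T$ of the same inclusion with the obstacle function $u_0$ replaced by $v_0=v(0)$. Suppose that $u\le v$ a.e. on the parabolic boundary $\partial_pQ_T=(\Omega\times\{0\})\cup(\partial\Omega\times[0,T))$. Then $$u\le v\quad\text{a.e. in }Q_T.$$ In particular, the solution of the obstacle problem $$u_t+\partial I_{[u_0(x),\infty)}(u)-\Delta u+u^3-\kappa u\ni0\ \text{ in }\Omega\times(0,\infty),\quad u=0\ \text{ on }\partial\Omega\times(0,\infty),\quad u(\cdot,0)=u_0\ \text{ in }\Omega$$ is unique.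
   Context: For $a\in\mathbb R$, $\partial I_{[a,\infty)}(s)=\{0\}$ if $s>a$, $(-\infty,0]$ if $s=a$, $\emptyset$ if $s<a$. Let $T\in(0,\infty)$ and $u_0\in L^2(\Omega)$. A function $u\in C([0,T];L^2(\Omega))$ is an $L^2$ subsolution on $Q_T$ of the inclusion with obstacle function $u_0$ if: (i) $u$ belongs to $W^{1,2}(\delta,T;L^2(\Omega))$, $C([\delta,T];H^1_0(\Omega)\cap L^4(\Omega))$, $L^2(\delta,T;H^2(\Omega))$ and $L^6(\delta,T;L^6(\Omega))$ for any $0<\delta<T$; (ii) there exists $\eta\in L^\infty(0,T;L^2(\Omega))$ such that $$u_t+\eta-\Delta u+u^3-\kappa u\le0,\quad \eta\in\partial I_{[u_0(x),\infty)}(u)\quad\text{for a.e. }(x,t)\in\Omega\times(0,T).$$ An $L^2$ supersolution is defined in the same way with the reverse inequality ($\ge0$) in (ii). A solution of the obstacle problem is a $u\in C([0,\infty);L^2(\Omega))$ with the regularity in (i) for all $0<\delta<T<\infty$, with $u(\cdot,0)=u_0$, for which there is $\eta\in L^\infty(0,\infty;L^2(\Omega))$ with $u_t+\eta-\Delta u+u^3-\kappa u=0$ and $\eta\in\partial I_{[u_0(x),\infty)}(u)$ a.e. in $\Omega\times(0,\infty)$. *)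

theory Defs
  imports "HOL-Analysis.Analysis"
begin

section \<open>Smooth functions and smooth bounded domains\<close>

primrec iterated_partial ::
    "'a::euclidean_space list \<Rightarrow> ('a \<Rightarrow> real) \<Rightarrow> 'a \<Rightarrow> real" where
  "iterated_partial [] f = f"
| "iterated_partial (b # bs) f = (\<lambda>x. frechet_derivative (iterated_partial bs f) (at x) b)"

text \<open>Differentiability of every iterated partial derivative makes all of them continuous, so this
  is \<open>C\<^sup>\<infinity>\<close> on the whole space.\<close>

definition smooth :: "('a::euclidean_space \<Rightarrow> real) \<Rightarrow> bool" where
  "smooth f \<longleftrightarrow> (\<forall>bs. set bs \<subseteq> Basis \<longrightarrow> iterated_partial bs f differentiable_on UNIV)"

definition test_function :: "'a::euclidean_space set \<Rightarrow> ('a \<Rightarrow> real) \<Rightarrow> bool" where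
  "test_function \<Omega> \<phi> \<longleftrightarrow>
     smooth \<phi> \<and> compact (closure {x. \<phi> x \<noteq> 0}) \<and> closure {x. \<phi> x \<noteq> 0} \<subseteq> \<Omega>"

text \<open>Near each boundary point, \<open>\<Omega>\<close> is the strict epigraph of a smooth function in some
  orthonormal coordinate system: the unit vector \<open>e\<close> is the last axis, and
  \<open>x - (x \<bullet> e) *\<^sub>R e\<close> are the remaining coordinates (only the values of \<open>\<gamma>\<close> on the
  orthogonal complement of \<open>e\<close> matter).\<close>

definition smooth_boundary :: "'a::euclidean_space set \<Rightarrow> bool" where
  "smooth_boundary \<Omega> \<longleftrightarrow>
     (\<forall>x0 \<in> frontier \<Omega>. \<exists>r > 0. \<exists>e \<gamma>. norm e = 1 \<and> smooth \<gamma> \<and>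
        \<Omega> \<inter> ball x0 r = {x \<in> ball x0 r. x \<bullet> e > \<gamma> (x - (x \<bullet> e) *\<^sub>R e)})"

definition smooth_bounded_domain :: "'a::euclidean_space set \<Rightarrow> bool" where
  "smooth_bounded_domain \<Omega> \<longleftrightarrow>
     open \<Omega> \<and> connected \<Omega> \<and> \<Omega> \<noteq> {} \<and> bounded \<Omega> \<and> smooth_boundary \<Omega>"


section \<open>Lebesgue and Sobolev spaces on a domain\<close>

text \<open>A space of (classes of) functions is given by the set of all representatives of its elements
  together with its norm, viewed as a seminorm on representatives. Two functions represent the same
  element when they agree almost everywhere on \<open>\<Omega>\<close>.\<close>

type_synonym 'a fspace = "('a \<Rightarrow> real) set \<times> (('a \<Rightarrow> real) \<Rightarrow> real)"

abbreviation elts :: "'a fspace \<Rightarrow> ('a \<Rightarrow> real) set" where "elts \<equiv> fst"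
abbreviation nrm :: "'a fspace \<Rightarrow> ('a \<Rightarrow> real) \<Rightarrow> real" where "nrm \<equiv> snd"

definition inter_space :: "'a fspace \<Rightarrow> 'a fspace \<Rightarrow> 'a fspace" where
  "inter_space X Y = (elts X \<inter> elts Y, \<lambda>f. nrm X f + nrm Y f)"

definition Lp :: "nat \<Rightarrow> 'a::euclidean_space set \<Rightarrow> 'a fspace" where
  "Lp p \<Omega> =
     ({f \<in> borel_measurable (lebesgue_on \<Omega>). integrable (lebesgue_on \<Omega>) (\<lambda>x. \<bar>f x\<bar> ^ p)},
      \<lambda>f. root p (LINT x|lebesgue_on \<Omega>. \<bar>f x\<bar> ^ p))"

definition is_weak_deriv ::
    "'a::euclidean_space set \<Rightarrow> 'a list \<Rightarrow> ('a \<Rightarrow> real) \<Rightarrow> ('a \<Rightarrow> real) \<Rightarrow> bool" where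
  "is_weak_deriv \<Omega> bs f g \<longleftrightarrow>
     (\<forall>\<phi>. test_function \<Omega> \<phi> \<longrightarrow>
        (LINT x|lebesgue_on \<Omega>. f x * iterated_partial bs \<phi> x) =
        (-1) ^ length bs * (LINT x|lebesgue_on \<Omega>. g x * \<phi> x))"

text \<open>Weak derivatives are unique up to null sets, so the choice below only fixes a
  representative.\<close>

definition weak_deriv ::
    "'a::euclidean_space set \<Rightarrow> 'a list \<Rightarrow> ('a \<Rightarrow> real) \<Rightarrow> 'a \<Rightarrow> real" where
  "weak_deriv \<Omega> bs f = (SOME g. g \<in> elts (Lp 2 \<Omega>) \<and> is_weak_deriv \<Omega> bs f g)"

text \<open>\<open>H\<^sup>k(\<Omega>)\<close>. A multi-index of order at most \<open>k\<close> is represented by the lists of basis vectors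
  realising it; mixed derivatives therefore enter the norm with their multiplicities, which gives
  an equivalent norm.\<close>

definition multi_indices :: "nat \<Rightarrow> 'a::euclidean_space list set" where
  "multi_indices k = {bs. set bs \<subseteq> Basis \<and> length bs \<le> k}"

definition Hk :: "nat \<Rightarrow> 'a::euclidean_space set \<Rightarrow> 'a fspace" where
  "Hk k \<Omega> =
     ({f \<in> elts (Lp 2 \<Omega>).
         \<forall>bs \<in> multi_indices k. \<exists>g \<in> elts (Lp 2 \<Omega>). is_weak_deriv \<Omega> bs f g},
      \<lambda>f. sqrt (\<Sum>bs\<in>multi_indices k. (nrm (Lp 2 \<Omega>) (weak_deriv \<Omega> bs f))\<^sup>2))"

definition H10 :: "'a::euclidean_space set \<Rightarrow> 'a fspace" where
  "H10 \<Omega> =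
     ({f \<in> elts (Hk 1 \<Omega>). \<exists>\<phi>. (\<forall>n. test_function \<Omega> (\<phi> n)) \<and>
         (\<lambda>n::nat. nrm (Hk 1 \<Omega>) (\<lambda>x. \<phi> n x - f x)) \<longlonglongrightarrow> 0},
      nrm (Hk 1 \<Omega>))"

definition is_laplacian ::
    "'a::euclidean_space set \<Rightarrow> ('a \<Rightarrow> real) \<Rightarrow> ('a \<Rightarrow> real) \<Rightarrow> bool" where
  "is_laplacian \<Omega> f g \<longleftrightarrow> f \<in> elts (Hk 2 \<Omega>) \<and>
     (AE x in lebesgue_on \<Omega>. g x = (\<Sum>b\<in>Basis. weak_deriv \<Omega> [b, b] f x))"


section \<open>Spaces of vector-valued functions of time\<close>

text \<open>A function of time with values in a space on \<open>\<Omega>\<close> is curried, time first: \<open>u t x\<close>.\<close>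

definition C_into :: "real set \<Rightarrow> 'a fspace \<Rightarrow> (real \<Rightarrow> 'a \<Rightarrow> real) set" where
  "C_into S X = {u. \<forall>t\<in>S. u t \<in> elts X \<and>
     ((\<lambda>s. nrm X (\<lambda>x. u s x - u t x)) \<longlongrightarrow> 0) (at t within S)}"

text \<open>A list \<open>[(A\<^sub>1, f\<^sub>1), \<dots>, (A\<^sub>m, f\<^sub>m)]\<close> encodes the simple function
  \<open>t \<mapsto> \<Sum>\<^sub>i indicator A\<^sub>i t *\<^sub>R f\<^sub>i\<close>.\<close>

type_synonym 'a simple = "(real set \<times> ('a \<Rightarrow> real)) list"

definition simple_in :: "real set \<Rightarrow> 'a fspace \<Rightarrow> 'a simple \<Rightarrow> bool" where
  "simple_in I X cs \<longleftrightarrow> (\<forall>(A, f) \<in> set cs. A \<in> lmeasurable \<and> A \<subseteq> I \<and> f \<in> elts X)"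

definition simple_value :: "'a simple \<Rightarrow> real \<Rightarrow> 'a \<Rightarrow> real" where
  "simple_value cs t x = (\<Sum>(A, f)\<leftarrow>cs. indicator A t * f x)"

definition simple_integral :: "'a simple \<Rightarrow> 'a \<Rightarrow> real" where
  "simple_integral cs x = (\<Sum>(A, f)\<leftarrow>cs. measure lebesgue A * f x)"

definition strongly_measurable ::
    "real set \<Rightarrow> 'a fspace \<Rightarrow> (real \<Rightarrow> 'a \<Rightarrow> real) \<Rightarrow> bool" where
  "strongly_measurable I X u \<longleftrightarrow>
     (AE t in lebesgue_on I. u t \<in> elts X) \<and>
     (\<exists>s. (\<forall>n. simple_in I X (s n)) \<and>
       (AE t in lebesgue_on I.
          (\<lambda>n::nat. nrm X (\<lambda>x. u t x - simple_value (s n) t x)) \<longlonglongrightarrow> 0))"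

definition is_bochner_integral ::
    "real set \<Rightarrow> 'a fspace \<Rightarrow> (real \<Rightarrow> 'a \<Rightarrow> real) \<Rightarrow> ('a \<Rightarrow> real) \<Rightarrow> bool" where
  "is_bochner_integral I X u g \<longleftrightarrow>
     strongly_measurable I X u \<and> g \<in> elts X \<and>
     (\<exists>s. (\<forall>n. simple_in I X (s n) \<and>
              integrable (lebesgue_on I) (\<lambda>t. nrm X (\<lambda>x. u t x - simple_value (s n) t x))) \<and>
       (\<lambda>n::nat. LINT t|lebesgue_on I. nrm X (\<lambda>x. u t x - simple_value (s n) t x)) \<longlonglongrightarrow> 0 \<and>
       (\<lambda>n. nrm X (\<lambda>x. simple_integral (s n) x - g x)) \<longlonglongrightarrow> 0)"

definition Lp_into :: "nat \<Rightarrow> real set \<Rightarrow> 'a fspace \<Rightarrow> (real \<Rightarrow> 'a \<Rightarrow> real) set" where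
  "Lp_into p I X = {u. strongly_measurable I X u \<and>
     integrable (lebesgue_on I) (\<lambda>t. (nrm X (u t)) ^ p)}"

definition Linf_into :: "real set \<Rightarrow> 'a fspace \<Rightarrow> (real \<Rightarrow> 'a \<Rightarrow> real) set" where
  "Linf_into I X = {u. strongly_measurable I X u \<and>
     (\<exists>C. AE t in lebesgue_on I. nrm X (u t) \<le> C)}"

text \<open>\<open>w\<close> is the weak derivative \<open>u\<^sub>t\<close> of the \<open>X\<close>-valued function \<open>u\<close> on the open interval \<open>I\<close>:
  \<open>\<integral> \<phi>' u dt = - \<integral> \<phi> w dt\<close> in \<open>X\<close> for all test functions \<open>\<phi>\<close> on \<open>I\<close>.\<close>

definition is_time_deriv ::
    "real set \<Rightarrow> 'a fspace \<Rightarrow> (real \<Rightarrow> 'a \<Rightarrow> real) \<Rightarrow> (real \<Rightarrow> 'a \<Rightarrow> real) \<Rightarrow> bool" where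
  "is_time_deriv I X u w \<longleftrightarrow>
     (\<forall>\<phi>. test_function I \<phi> \<longrightarrow>
        (\<exists>g. is_bochner_integral I X (\<lambda>t x. deriv \<phi> t * u t x) g \<and>
             is_bochner_integral I X (\<lambda>t x. \<phi> t * w t x) (\<lambda>x. - g x)))"

definition W12_into :: "real set \<Rightarrow> 'a fspace \<Rightarrow> (real \<Rightarrow> 'a \<Rightarrow> real) set" where
  "W12_into I X = {u \<in> Lp_into 2 I X. \<exists>w \<in> Lp_into 2 I X. is_time_deriv I X u w}"


section \<open>The obstacle problem\<close>

definition subdiff_obstacle :: "real \<Rightarrow> real \<Rightarrow> real set" where
  "subdiff_obstacle a s = (if s > a then {0} else if s = a then {..0} else {})"

text \<open>Pointwise statements for almost every \<open>(x, t)\<close> are about representatives that are measurable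
  in both variables; every strongly measurable \<open>L\<^sup>2(\<Omega>)\<close>-valued function has one.\<close>

definition jointly_measurable ::
    "'a::euclidean_space set \<Rightarrow> real set \<Rightarrow> (real \<Rightarrow> 'a \<Rightarrow> real) \<Rightarrow> bool" where
  "jointly_measurable \<Omega> I u \<longleftrightarrow> (\<lambda>(x, t). u t x) \<in> borel_measurable (lebesgue_on (\<Omega> \<times> I))"

definition regular_on ::
    "'a::euclidean_space set \<Rightarrow> real \<Rightarrow> real \<Rightarrow> (real \<Rightarrow> 'a \<Rightarrow> real) \<Rightarrow> bool" where
  "regular_on \<Omega> \<delta> T u \<longleftrightarrow>
     u \<in> W12_into {\<delta><..<T} (Lp 2 \<Omega>) \<and>
     u \<in> C_into {\<delta>..T} (inter_space (H10 \<Omega>) (Lp 4 \<Omega>)) \<and>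
     u \<in> Lp_into 2 {\<delta><..<T} (Hk 2 \<Omega>) \<and>
     u \<in> Lp_into 6 {\<delta><..<T} (Lp 6 \<Omega>)"

text \<open>For \<open>R\<close> one of \<open>\<le>\<close>, \<open>\<ge>\<close>, \<open>=\<close>: there is \<open>\<eta> \<in> L\<^sup>\<infinity>(I; L\<^sup>2(\<Omega>))\<close> such that
  \<open>u\<^sub>t + \<eta> - \<Delta>u + u\<^sup>3 - \<kappa> u  R  0\<close> and \<open>\<eta>\<close> lies in the subdifferential at \<open>u\<close>, almost everywhere in
  \<open>\<Omega> \<times> I\<close>. Here \<open>ut\<close> and \<open>lap\<close> are jointly measurable representatives of \<open>u\<^sub>t\<close> and \<open>\<Delta>u\<close>.\<close>

definition obstacle_inclusion ::
    "(real \<Rightarrow> real \<Rightarrow> bool) \<Rightarrow> 'a::euclidean_space set \<Rightarrow> real \<Rightarrow> real set \<Rightarrow>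
     ('a \<Rightarrow> real) \<Rightarrow> (real \<Rightarrow> 'a \<Rightarrow> real) \<Rightarrow> bool" where
  "obstacle_inclusion R \<Omega> \<kappa> I u0 u \<longleftrightarrow>
     (\<exists>\<eta> ut lap.
        jointly_measurable \<Omega> I \<eta> \<and> \<eta> \<in> Linf_into I (Lp 2 \<Omega>) \<and>
        jointly_measurable \<Omega> I ut \<and> is_time_deriv I (Lp 2 \<Omega>) u ut \<and>
        jointly_measurable \<Omega> I lap \<and> (AE t in lebesgue_on I. is_laplacian \<Omega> (u t) (lap t)) \<and>
        (AE (x, t) in lebesgue_on (\<Omega> \<times> I).
           R (ut t x + \<eta> t x - lap t x + (u t x) ^ 3 - \<kappa> * u t x) 0 \<and>
           \<eta> t x \<in> subdiff_obstacle (u0 x) (u t x)))"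

definition L2_subsolution ::
    "'a::euclidean_space set \<Rightarrow> real \<Rightarrow> real \<Rightarrow> ('a \<Rightarrow> real) \<Rightarrow> (real \<Rightarrow> 'a \<Rightarrow> real) \<Rightarrow> bool" where
  "L2_subsolution \<Omega> \<kappa> T u0 u \<longleftrightarrow>
     T > 0 \<and> u0 \<in> elts (Lp 2 \<Omega>) \<and>
     u \<in> C_into {0..T} (Lp 2 \<Omega>) \<and> jointly_measurable \<Omega> {0<..<T} u \<and>
     (\<forall>\<delta>. 0 < \<delta> \<and> \<delta> < T \<longrightarrow> regular_on \<Omega> \<delta> T u) \<and>
     obstacle_inclusion (\<le>) \<Omega> \<kappa> {0<..<T} u0 u"

definition L2_supersolution ::
    "'a::euclidean_space set \<Rightarrow> real \<Rightarrow> real \<Rightarrow> ('a \<Rightarrow> real) \<Rightarrow> (real \<Rightarrow> 'a \<Rightarrow> real) \<Rightarrow> bool" where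
  "L2_supersolution \<Omega> \<kappa> T u0 u \<longleftrightarrow>
     T > 0 \<and> u0 \<in> elts (Lp 2 \<Omega>) \<and>
     u \<in> C_into {0..T} (Lp 2 \<Omega>) \<and> jointly_measurable \<Omega> {0<..<T} u \<and>
     (\<forall>\<delta>. 0 < \<delta> \<and> \<delta> < T \<longrightarrow> regular_on \<Omega> \<delta> T u) \<and>
     obstacle_inclusion (\<ge>) \<Omega> \<kappa> {0<..<T} u0 u"

definition obstacle_solution ::
    "'a::euclidean_space set \<Rightarrow> real \<Rightarrow> ('a \<Rightarrow> real) \<Rightarrow> (real \<Rightarrow> 'a \<Rightarrow> real) \<Rightarrow> bool" where
  "obstacle_solution \<Omega> \<kappa> u0 u \<longleftrightarrow>
     u0 \<in> elts (Lp 2 \<Omega>) \<and>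
     u \<in> C_into {0..} (Lp 2 \<Omega>) \<and> jointly_measurable \<Omega> {0<..} u \<and>
     (\<forall>\<delta> T. 0 < \<delta> \<and> \<delta> < T \<longrightarrow> regular_on \<Omega> \<delta> T u) \<and>
     (AE x in lebesgue_on \<Omega>. u 0 x = u0 x) \<and>
     obstacle_inclusion (=) \<Omega> \<kappa> {0<..} u0 u"

text \<open>Inequalities between Sobolev functions on \<open>\<partial>\<Omega>\<close> have the usual meaning
  \<open>(f - g)\<^sup>+ \<in> H\<^sup>1\<^sub>0(\<Omega>)\<close>, i.e. the trace of \<open>f\<close> is at most the trace of \<open>g\<close>. The edge
  \<open>\<partial>\<Omega> \<times> {0}\<close> is a null subset of the lateral boundary.\<close>

definition le_on_boundary ::
    "'a::euclidean_space set \<Rightarrow> ('a \<Rightarrow> real) \<Rightarrow> ('a \<Rightarrow> real) \<Rightarrow> bool" where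
  "le_on_boundary \<Omega> f g \<longleftrightarrow> (\<lambda>x. max (f x - g x) 0) \<in> elts (H10 \<Omega>)"

definition le_on_parabolic_boundary ::
    "'a::euclidean_space set \<Rightarrow> real \<Rightarrow> (real \<Rightarrow> 'a \<Rightarrow> real) \<Rightarrow> (real \<Rightarrow> 'a \<Rightarrow> real) \<Rightarrow> bool" where
  "le_on_parabolic_boundary \<Omega> T u v \<longleftrightarrow>
     (AE x in lebesgue_on \<Omega>. u 0 x \<le> v 0 x) \<and>
     (AE t in lebesgue_on {0<..<T}. le_on_boundary \<Omega> (u t) (v t))"

end

theory Submission
  imports Defs
begin

text \<open>
  Put \<open>w = u - v\<close>. Where \<open>w > 0\<close> the chain \<open>u > v \<ge> v\<^sub>0 \<ge> u\<^sub>0\<close> shows that \<open>u\<close> is strictly above its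
  obstacle, so the multiplier of \<open>u\<close> vanishes, while that of \<open>v\<close> is at most \<open>0\<close>. Subtracting the two
  differential inequalities and using that the cube is increasing leaves
  \<open>w\<^sub>t \<le> \<Delta>w + \<kappa> w\<close> on the set \<open>{w > 0}\<close> (\<open>obstacle_pointwise\<close>). Multiplying by the positive part
  \<open>w\<^sup>+\<close> and integrating over \<open>\<Omega>\<close> gives \<open>d/dt \<parallel>w\<^sup>+\<parallel>\<^sup>2 \<le> 2 \<kappa> \<parallel>w\<^sup>+\<parallel>\<^sup>2\<close>, because \<open>\<integral> \<Delta>w w\<^sup>+ \<le> 0\<close> for a
  function that vanishes on the boundary. As \<open>w\<^sup>+\<close> vanishes at time \<open>0\<close>, Gronwall's argument gives
  \<open>w\<^sup>+ = 0\<close>. Uniqueness follows by comparing two solutions in both directions.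

  Two of these steps hide a chain rule for weakly differentiable functions, and both are
  replaced by an inequality that is preserved under limits.

  In space (\<open>laplacian_diff_pos_part\<close>), \<open>w\<close> is approximated by test functions \<open>\<zeta>\<close> and the positive
  part by a smooth nondecreasing \<open>g\<close> with \<open>g(0) = 0\<close> and \<open>g' \<le> 1\<close>. Then \<open>g(\<zeta>)\<close> is an admissible test function,
  and if \<open>e\<close> denotes the weak gradient of \<open>\<zeta> - w\<close>, integration by parts turns \<open>\<integral> \<Delta>w g(\<zeta>)\<close> into
  \<open>\<integral> g'(\<zeta>) (e \<bullet> \<nabla>\<zeta> - \<bar>\<nabla>\<zeta>\<bar>\<^sup>2) \<le> \<integral> \<bar>e\<bar>\<^sup>2 / 4\<close>, which tends to \<open>0\<close>. The order zero term of the Sobolev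
  norm is the norm of some weak derivative of order zero; that this is the function itself is the
  fundamental lemma of the calculus of variations.

  In time (\<open>energy_inequality\<close>), convexity of \<open>s \<mapsto> (s\<^sup>+)\<^sup>2\<close> gives
  \<open>\<parallel>w\<^sup>+(d)\<parallel>\<^sup>2 - \<parallel>w\<^sup>+(c)\<parallel>\<^sup>2 \<le> 2 \<langle>w(d) - w(c), w\<^sup>+(d)\<rangle>\<close>. Pairing with the fixed function \<open>w\<^sup>+(d)\<close> reduces
  Bochner integrals to scalar ones, so the right-hand side is \<open>2 \<integral> \<langle>w\<^sub>t(\<tau>), w\<^sup>+(d)\<rangle> d\<tau>\<close> over \<open>[c, d]\<close>. On a
  short interval \<open>w\<^sup>+(d)\<close> may be replaced by \<open>w\<^sup>+(\<tau>)\<close> at the cost of \<open>\<epsilon> \<parallel>w\<^sub>t(\<tau>)\<parallel>\<close>, and bisection extends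
  the resulting inequality to long intervals.

  The inequality for null sets of \<open>\<Omega> \<times> I\<close> is read on almost every time slice, and the result on
  all time slices is put back together, by Fubini's theorem for null sets.
\<close>

section \<open>Square integrable functions\<close>

text \<open>The seminorm \<open>l2_norm\<close> and the pairing \<open>\<integral> f g\<close> live on representatives, over an arbitrary measure, so
  that no quotient space has to be formed.\<close>

definition sq_integrable :: "'b measure \<Rightarrow> ('b \<Rightarrow> real) set" where
  "sq_integrable M = {f \<in> borel_measurable M. integrable M (\<lambda>x. (f x)\<^sup>2)}"

definition l2_norm :: "'b measure \<Rightarrow> ('b \<Rightarrow> real) \<Rightarrow> real" where
  "l2_norm M f = sqrt (LINT x|M. (f x)\<^sup>2)"

lemma elts_Lp2: "elts (Lp 2 \<Omega>) = sq_integrable (lebesgue_on \<Omega>)"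
  by (simp add: Lp_def sq_integrable_def)

lemma nrm_Lp2: "nrm (Lp 2 \<Omega>) f = l2_norm (lebesgue_on \<Omega>) f"
  by (simp add: Lp_def l2_norm_def sqrt_def)

lemma l2_norm_nonneg [simp]: "0 \<le> l2_norm M f"
  by (simp add: l2_norm_def)

lemma l2_norm_sq: "(l2_norm M f)\<^sup>2 = (LINT x|M. (f x)\<^sup>2)"
  by (simp add: l2_norm_def)

lemma sq_integrable_measurable [measurable_dest]:
  "f \<in> sq_integrable M \<Longrightarrow> f \<in> borel_measurable M"
  by (simp add: sq_integrable_def)

lemma sq_integrable_square: "f \<in> sq_integrable M \<Longrightarrow> integrable M (\<lambda>x. (f x)\<^sup>2)"
  by (simp add: sq_integrable_def)

lemma sq_integrable_mult:
  assumes f: "f \<in> sq_integrable M" and g: "g \<in> sq_integrable M"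
  shows "integrable M (\<lambda>x. f x * g x)"
proof (rule Bochner_Integration.integrable_bound)
  show "integrable M (\<lambda>x. (f x)\<^sup>2 + (g x)\<^sup>2)"
    using f g by (simp add: sq_integrable_def)
  show "(\<lambda>x. f x * g x) \<in> borel_measurable M"
    using f g by (auto simp: sq_integrable_def)
  have "\<bar>f x * g x\<bar> \<le> (f x)\<^sup>2 + (g x)\<^sup>2" for x
  proof -
    have "\<bar>f x * g x\<bar> \<le> 2 * \<bar>f x\<bar> * \<bar>g x\<bar>" by (simp add: abs_mult)
    then show ?thesis using sum_squares_bound[of "\<bar>f x\<bar>" "\<bar>g x\<bar>"] by simp
  qed
  then show "AE x in M. norm (f x * g x) \<le> norm ((f x)\<^sup>2 + (g x)\<^sup>2)"
    by auto
qed

lemma sq_integrable_scale: "f \<in> sq_integrable M \<Longrightarrow> (\<lambda>x. c * f x) \<in> sq_integrable M"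
  by (auto simp: sq_integrable_def power_mult_distrib)

lemma sq_integrable_add:
  assumes f: "f \<in> sq_integrable M" and g: "g \<in> sq_integrable M"
  shows "(\<lambda>x. f x + g x) \<in> sq_integrable M"
proof -
  have "integrable M (\<lambda>x. (f x)\<^sup>2 + (g x)\<^sup>2 + 2 * (f x * g x))"
    using f g sq_integrable_mult[OF f g]
    by (intro Bochner_Integration.integrable_add integrable_mult_right) (auto simp: sq_integrable_def)
  moreover have "(\<lambda>x. f x + g x) \<in> borel_measurable M"
    using f g by (auto simp: sq_integrable_def)
  ultimately show ?thesis
    by (simp add: sq_integrable_def power2_sum mult.assoc)
qed

lemma sq_integrable_diff:
  assumes f: "f \<in> sq_integrable M" and g: "g \<in> sq_integrable M"
  shows "(\<lambda>x. f x - g x) \<in> sq_integrable M"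
  using sq_integrable_add[OF f sq_integrable_scale[OF g, of "-1"]] by simp

lemma sq_integrable_bound:
  assumes g: "g \<in> sq_integrable M" and f: "f \<in> borel_measurable M"
    and le: "AE x in M. \<bar>f x\<bar> \<le> \<bar>g x\<bar>"
  shows "f \<in> sq_integrable M" and "l2_norm M f \<le> l2_norm M g"
proof -
  have sq: "AE x in M. (f x)\<^sup>2 \<le> (g x)\<^sup>2"
    using le by eventually_elim (simp add: abs_le_square_iff)
  have i: "integrable M (\<lambda>x. (f x)\<^sup>2)"
    by (rule Bochner_Integration.integrable_bound[OF sq_integrable_square[OF g]])
       (use f sq in auto)
  then show "f \<in> sq_integrable M" using f by (simp add: sq_integrable_def)
  show "l2_norm M f \<le> l2_norm M g"
    unfolding l2_norm_def
    by (intro real_sqrt_le_mono integral_mono_AE i sq_integrable_square[OF g] sq)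
qed

lemma sq_integrable_pos_part:
  "f \<in> sq_integrable M \<Longrightarrow> (\<lambda>x. max (f x) 0) \<in> sq_integrable M"
  by (rule sq_integrable_bound[of f]) (auto simp: sq_integrable_def)

lemma sq_integrable_abs: "f \<in> sq_integrable M \<Longrightarrow> (\<lambda>x. \<bar>f x\<bar>) \<in> sq_integrable M"
  by (rule sq_integrable_bound[of f]) (auto simp: sq_integrable_def)

lemma l2_norm_cong_AE:
  assumes "f \<in> borel_measurable M" "g \<in> borel_measurable M" "AE x in M. f x = g x"
  shows "l2_norm M f = l2_norm M g"
  unfolding l2_norm_def using assms by (subst integral_cong_AE[where g = "\<lambda>x. (g x)\<^sup>2"]) auto

lemma l2_norm_scale: "l2_norm M (\<lambda>x. c * f x) = \<bar>c\<bar> * l2_norm M f"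
  by (simp add: l2_norm_def power_mult_distrib real_sqrt_mult)

lemma l2_norm_abs: "l2_norm M (\<lambda>x. \<bar>f x\<bar>) = l2_norm M f"
  by (simp add: l2_norm_def)

lemma l2_norm_minus_commute: "l2_norm M (\<lambda>x. f x - g x) = l2_norm M (\<lambda>x. g x - f x)"
  by (simp add: l2_norm_def power2_commute)

text \<open>Expanding \<open>\<integral> (\<parallel>g\<parallel> f - \<parallel>f\<parallel> g)\<^sup>2 \<ge> 0\<close>; a factor of seminorm \<open>0\<close> vanishes almost everywhere and is treated
  apart.\<close>

lemma l2_inner_le:
  assumes f: "f \<in> sq_integrable M" and g: "g \<in> sq_integrable M"
  shows "(LINT x|M. f x * g x) \<le> l2_norm M f * l2_norm M g"
proof -
  let ?a = "l2_norm M f" and ?b = "l2_norm M g"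
  have eq0: "(LINT x|M. f x * g x) = 0" if "?a = 0 \<or> ?b = 0"
  proof -
    have "AE x in M. f x * g x = 0"
      using that
    proof
      assume "?a = 0"
      then have "AE x in M. (f x)\<^sup>2 = 0"
        using integral_nonneg_eq_0_iff_AE[OF sq_integrable_square[OF f]] by (simp add: l2_norm_def)
      then show ?thesis by eventually_elim simp
    next
      assume "?b = 0"
      then have "AE x in M. (g x)\<^sup>2 = 0"
        using integral_nonneg_eq_0_iff_AE[OF sq_integrable_square[OF g]] by (simp add: l2_norm_def)
      then show ?thesis by eventually_elim simp
    qed
    then have "(LINT x|M. f x * g x) = (LINT x|M. 0)"
      by (intro integral_cong_AE) (use f g in \<open>auto simp: sq_integrable_def\<close>)
    then show ?thesis by simp
  qed
  show ?thesis
  proof (cases "?a = 0 \<or> ?b = 0")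
    case True then show ?thesis using eq0 by auto
  next
    case False
    then have pos: "?a > 0" "?b > 0" using l2_norm_nonneg[of M f] l2_norm_nonneg[of M g] by linarith+
    have "0 \<le> (LINT x|M. (?b * f x - ?a * g x)\<^sup>2)" by simp
    also have "\<dots> = (LINT x|M. (?b\<^sup>2 * (f x)\<^sup>2 + ?a\<^sup>2 * (g x)\<^sup>2) - 2 * ?a * ?b * (f x * g x))"
      by (simp add: power2_diff power_mult_distrib algebra_simps)
    also have "\<dots> = (?b\<^sup>2 * (LINT x|M. (f x)\<^sup>2) + ?a\<^sup>2 * (LINT x|M. (g x)\<^sup>2))
                     - 2 * ?a * ?b * (LINT x|M. f x * g x)"
      using sq_integrable_square[OF f] sq_integrable_square[OF g] sq_integrable_mult[OF f g]
      by (subst Bochner_Integration.integral_diff Bochner_Integration.integral_add; auto)+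
    also have "\<dots> = 2 * ?a * ?b * (?a * ?b - (LINT x|M. f x * g x))"
      unfolding l2_norm_sq[symmetric] by (simp add: power2_eq_square algebra_simps)
    finally show ?thesis using mult_pos_pos[OF pos] by (auto simp: zero_le_mult_iff)
  qed
qed

lemma l2_Cauchy_Schwarz:
  assumes f: "f \<in> sq_integrable M" and g: "g \<in> sq_integrable M"
  shows "\<bar>LINT x|M. f x * g x\<bar> \<le> l2_norm M f * l2_norm M g"
  using l2_inner_le[OF f g] l2_inner_le[OF sq_integrable_scale[OF f, of "-1"] g]
    l2_norm_scale[of M "-1" f] by (simp add: abs_le_iff)

lemma l2_norm_triangle:
  assumes f: "f \<in> sq_integrable M" and g: "g \<in> sq_integrable M"
  shows "l2_norm M (\<lambda>x. f x + g x) \<le> l2_norm M f + l2_norm M g"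
proof (rule power2_le_imp_le)
  have "(l2_norm M (\<lambda>x. f x + g x))\<^sup>2 = (LINT x|M. (f x)\<^sup>2 + (g x)\<^sup>2 + 2 * (f x * g x))"
    by (simp add: l2_norm_sq power2_sum mult.assoc)
  also have "\<dots> = (l2_norm M f)\<^sup>2 + (l2_norm M g)\<^sup>2 + 2 * (LINT x|M. f x * g x)"
    using sq_integrable_square[OF f] sq_integrable_square[OF g] sq_integrable_mult[OF f g]
    by (simp add: l2_norm_sq)
  also have "\<dots> \<le> (l2_norm M f + l2_norm M g)\<^sup>2"
    using l2_inner_le[OF f g] by (simp add: power2_sum)
  finally show "(l2_norm M (\<lambda>x. f x + g x))\<^sup>2 \<le> (l2_norm M f + l2_norm M g)\<^sup>2" .
qed simp

lemma l2_norm_triangle_diff: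
  assumes f: "f \<in> sq_integrable M" and g: "g \<in> sq_integrable M"
  shows "l2_norm M (\<lambda>x. f x - g x) \<le> l2_norm M f + l2_norm M g"
  using l2_norm_triangle[OF f sq_integrable_scale[OF g, of "-1"]] l2_norm_scale[of M "-1" g] by simp

lemma l2_norm_diff_abs_le:
  assumes f: "f \<in> sq_integrable M" and g: "g \<in> sq_integrable M"
  shows "\<bar>l2_norm M f - l2_norm M g\<bar> \<le> l2_norm M (\<lambda>x. f x - g x)"
  using l2_norm_triangle[OF sq_integrable_diff[OF f g] g] l2_norm_triangle[OF sq_integrable_diff[OF g f] f]
  by (simp add: l2_norm_minus_commute[of M g f] abs_le_iff)

lemma sq_integrable_const: "finite_measure M \<Longrightarrow> (\<lambda>x. c) \<in> sq_integrable M"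
  by (simp add: sq_integrable_def finite_measure.integrable_const)

lemma sq_integrable_imp_integrable:
  assumes "finite_measure M" "f \<in> sq_integrable M" shows "integrable M f"
  using sq_integrable_mult[OF assms(2) sq_integrable_const[OF assms(1), of 1]] by simp

lemma finite_measure_lebesgue_on:
  assumes "open \<Omega>" "bounded \<Omega>" shows "finite_measure (lebesgue_on \<Omega>)"
proof (rule finite_measureI)
  have "\<Omega> \<in> lmeasurable" using assms by (simp add: lmeasurable_open)
  then show "emeasure (lebesgue_on \<Omega>) (space (lebesgue_on \<Omega>)) \<noteq> \<infinity>"
    using assms(1) emeasure_bounded_finite[OF assms(2)]
    by (simp add: emeasure_restrict_space)
qed

section \<open>Closure properties of smooth functions\<close>

abbreviation partial :: "'a::euclidean_space \<Rightarrow> ('a \<Rightarrow> real) \<Rightarrow> 'a \<Rightarrow> real" where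
  "partial b f \<equiv> (\<lambda>x. frechet_derivative f (at x) b)"

lemma iterated_partial_append:
  "iterated_partial (bs @ cs) f = iterated_partial bs (iterated_partial cs f)"
  by (induction bs) auto

text \<open>Smoothness of order \<open>k + 1\<close> amounts to differentiability together with smoothness of order \<open>k\<close> of
  the first partial derivatives, as \<open>k_smooth_Suc\<close> shows; this is what makes the closure properties
  provable by induction on the order.\<close>

definition k_smooth :: "nat \<Rightarrow> ('a::euclidean_space \<Rightarrow> real) \<Rightarrow> bool" where
  "k_smooth k f \<longleftrightarrow>
     (\<forall>bs. set bs \<subseteq> Basis \<and> length bs \<le> k \<longrightarrow> (\<forall>x. iterated_partial bs f differentiable (at x)))"

lemma smooth_iff_k_smooth: "smooth f \<longleftrightarrow> (\<forall>k. k_smooth k f)"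
  by (auto simp: smooth_def k_smooth_def differentiable_on_def)

lemma k_smooth_0: "k_smooth 0 f \<longleftrightarrow> (\<forall>x. f differentiable (at x))"
  by (auto simp: k_smooth_def)

lemma k_smooth_Suc:
  "k_smooth (Suc k) f \<longleftrightarrow> (\<forall>x. f differentiable (at x)) \<and> (\<forall>b\<in>Basis. k_smooth k (partial b f))"
    (is "?L \<longleftrightarrow> ?R")
proof
  assume L: ?L
  have "\<forall>x. f differentiable (at x)"
    using L unfolding k_smooth_def by (metis iterated_partial.simps(1) empty_subsetI list.set(1) list.size(3) zero_le)
  moreover have "k_smooth k (partial b f)" if b: "b \<in> Basis" for b
    unfolding k_smooth_def
  proof (intro allI impI)
    fix bs :: "'a list" and x assume "set bs \<subseteq> Basis \<and> length bs \<le> k"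
    then have "iterated_partial (bs @ [b]) f differentiable (at x)"
      using L b unfolding k_smooth_def by auto
    then show "iterated_partial bs (partial b f) differentiable (at x)"
      by (simp add: iterated_partial_append)
  qed
  ultimately show ?R by blast
next
  assume R: ?R
  show ?L unfolding k_smooth_def
  proof (intro allI impI)
    fix bs :: "'a list" and x assume bs: "set bs \<subseteq> Basis \<and> length bs \<le> Suc k"
    show "iterated_partial bs f differentiable (at x)"
    proof (cases bs rule: rev_cases)
      case Nil then show ?thesis using R by simp
    next
      case (snoc cs b)
      then show ?thesis using R bs by (auto simp: iterated_partial_append k_smooth_def)
    qed
  qed
qed

lemma k_smooth_SucD: "k_smooth (Suc k) f \<Longrightarrow> k_smooth k f"
  by (simp add: k_smooth_def)

lemma k_smooth_differentiable: "k_smooth k f \<Longrightarrow> f differentiable (at x)"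
  by (cases k) (auto simp: k_smooth_0 k_smooth_Suc)

lemma partial_unique: "(f has_derivative F) (at x) \<Longrightarrow> partial b f x = F b"
  by (metis frechet_derivative_at)

lemma differentiable_has_derivative:
  "f differentiable (at x) \<Longrightarrow> (f has_derivative frechet_derivative f (at x)) (at x)"
  by (simp add: frechet_derivative_works)

lemma k_smooth_SucI:
  assumes "\<And>x. (f has_derivative F x) (at x)" and "\<And>b. b \<in> Basis \<Longrightarrow> k_smooth k (\<lambda>x. F x b)"
  shows "k_smooth (Suc k) f"
proof -
  have "partial b f = (\<lambda>x. F x b)" for b using partial_unique[OF assms(1)] by auto
  then show ?thesis using assms by (auto simp: k_smooth_Suc differentiable_def)
qed

lemma k_smooth_const: "k_smooth k (\<lambda>x. c)"
  by (induction k arbitrary: c) (auto simp: k_smooth_0 intro!: k_smooth_SucI has_derivative_const)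

lemma k_smooth_inner: "k_smooth k (\<lambda>x. x \<bullet> a)"
proof (cases k)
  case 0 then show ?thesis
    by (auto simp: k_smooth_0 intro!: bounded_linear_imp_differentiable bounded_linear_inner_left)
next
  case (Suc j)
  have "((\<lambda>x. x \<bullet> a) has_derivative (\<lambda>h. h \<bullet> a)) (at x)" for x
    by (rule bounded_linear.has_derivative[OF bounded_linear_inner_left has_derivative_ident])
  then show ?thesis unfolding Suc by (rule k_smooth_SucI) (rule k_smooth_const)
qed

lemma k_smooth_add: "k_smooth k f \<Longrightarrow> k_smooth k g \<Longrightarrow> k_smooth k (\<lambda>x. f x + g x)"
proof (induction k arbitrary: f g)
  case 0 then show ?case by (auto simp: k_smooth_0 intro: differentiable_add)
next
  case (Suc k)
  show ?case
  proof (rule k_smooth_SucI)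
    fix x show "((\<lambda>x. f x + g x) has_derivative
       (\<lambda>h. frechet_derivative f (at x) h + frechet_derivative g (at x) h)) (at x)"
      by (intro has_derivative_add differentiable_has_derivative
          k_smooth_differentiable[OF Suc.prems(1)] k_smooth_differentiable[OF Suc.prems(2)])
  qed (use Suc in \<open>simp add: k_smooth_Suc\<close>)
qed

lemma k_smooth_mult: "k_smooth k f \<Longrightarrow> k_smooth k g \<Longrightarrow> k_smooth k (\<lambda>x. f x * g x)"
proof (induction k arbitrary: f g)
  case 0 then show ?case by (auto simp: k_smooth_0 intro: differentiable_mult)
next
  case (Suc k)
  show ?case
  proof (rule k_smooth_SucI)
    fix x show "((\<lambda>x. f x * g x) has_derivative
       (\<lambda>h. f x * frechet_derivative g (at x) h + frechet_derivative f (at x) h * g x)) (at x)"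
      by (intro has_derivative_mult differentiable_has_derivative
          k_smooth_differentiable[OF Suc.prems(1)] k_smooth_differentiable[OF Suc.prems(2)])
  next
    fix b :: 'a assume "b \<in> Basis"
    then show "k_smooth k (\<lambda>x. f x * partial b g x + partial b f x * g x)"
      using Suc.prems by (intro k_smooth_add Suc.IH k_smooth_SucD[OF Suc.prems(1)] k_smooth_SucD[OF Suc.prems(2)])
        (auto simp: k_smooth_Suc)
  qed
qed

lemma k_smooth_cmult: "k_smooth k f \<Longrightarrow> k_smooth k (\<lambda>x. c * f x)"
  by (intro k_smooth_mult k_smooth_const)

lemma smooth_const: "smooth (\<lambda>x. c)"
  by (simp add: smooth_iff_k_smooth k_smooth_const)

lemma smooth_inner: "smooth (\<lambda>x. x \<bullet> a)"
  by (simp add: smooth_iff_k_smooth k_smooth_inner)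

lemma smooth_add: "smooth f \<Longrightarrow> smooth g \<Longrightarrow> smooth (\<lambda>x. f x + g x)"
  by (simp add: smooth_iff_k_smooth k_smooth_add)

lemma smooth_mult: "smooth f \<Longrightarrow> smooth g \<Longrightarrow> smooth (\<lambda>x. f x * g x)"
  by (simp add: smooth_iff_k_smooth k_smooth_mult)

lemma smooth_cmult: "smooth f \<Longrightarrow> smooth (\<lambda>x. c * f x)"
  by (simp add: smooth_iff_k_smooth k_smooth_cmult)

lemma smooth_diff: "smooth f \<Longrightarrow> smooth g \<Longrightarrow> smooth (\<lambda>x. f x - g x)"
  using smooth_add[of f "\<lambda>x. -1 * g x"] smooth_cmult[of g "-1"] by simp

lemma smooth_prod: "finite A \<Longrightarrow> (\<And>i. i \<in> A \<Longrightarrow> smooth (f i)) \<Longrightarrow> smooth (\<lambda>x. \<Prod>i\<in>A. f i x)"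
  by (induction A rule: finite_induct) (auto intro: smooth_const smooth_mult)

lemma smooth_partial: "smooth f \<Longrightarrow> b \<in> Basis \<Longrightarrow> smooth (partial b f)"
  unfolding smooth_iff_k_smooth using k_smooth_Suc by blast

lemma smooth_has_derivative:
  "smooth f \<Longrightarrow> (f has_derivative frechet_derivative f (at x)) (at x)"
  using k_smooth_differentiable smooth_iff_k_smooth differentiable_has_derivative by blast

lemma smooth_continuous: "smooth f \<Longrightarrow> continuous_on S f"
  by (meson smooth_has_derivative has_derivative_continuous continuous_at_imp_continuous_on)

text \<open>When the derivative of \<open>f\<close> is an expression in \<open>f\<close> itself and in smooth functions, smoothness of order
  \<open>k\<close> passes from \<open>f\<close> to its derivative, hence rises by one. Reciprocals and square roots are of this
  kind.\<close>

lemma smooth_bootstrap: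
  assumes der: "\<And>x. (f has_derivative F x) (at x)"
    and step: "\<And>k b. b \<in> Basis \<Longrightarrow> k_smooth k f \<Longrightarrow> k_smooth k (\<lambda>x. F x b)"
  shows "smooth f"
proof -
  have "k_smooth k f" for k
  proof (induction k)
    case 0 show ?case using der by (auto simp: k_smooth_0 differentiable_def)
  next
    case (Suc k) show ?case by (rule k_smooth_SucI[OF der step]) (use Suc in auto)
  qed
  then show ?thesis by (simp add: smooth_iff_k_smooth)
qed

lemma smooth_inverse:
  assumes p: "smooth p" and nz: "\<And>x. p x \<noteq> 0"
  shows "smooth (\<lambda>x. inverse (p x))"
proof (rule smooth_bootstrap)
  fix x show "((\<lambda>x. inverse (p x)) has_derivative
      (\<lambda>h. - (inverse (p x) * frechet_derivative p (at x) h * inverse (p x)))) (at x)"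
    by (rule Deriv.has_derivative_inverse[OF nz smooth_has_derivative[OF p]])
next
  fix k and b :: 'a assume b: "b \<in> Basis" and k: "k_smooth k (\<lambda>x. inverse (p x))"
  have "k_smooth k (\<lambda>x. (-1) * (inverse (p x) * partial b p x * inverse (p x)))"
    using smooth_partial[OF p b] k unfolding smooth_iff_k_smooth
    by (intro k_smooth_cmult k_smooth_mult) auto
  then show "k_smooth k (\<lambda>x. - (inverse (p x) * partial b p x * inverse (p x)))" by simp
qed

lemma smooth_sqrt:
  assumes p: "smooth p" and pos: "\<And>x. p x > 0"
  shows "smooth (\<lambda>x. sqrt (p x))"
proof (rule smooth_bootstrap)
  fix x
  have "(sqrt has_derivative (\<lambda>h. h * (inverse (sqrt (p x)) / 2))) (at (p x))"
    using DERIV_real_sqrt[OF pos[of x]] unfolding has_field_derivative_def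
    by (rule has_derivative_eq_rhs) (rule ext, rule mult.commute)
  from has_derivative_compose[OF smooth_has_derivative[OF p] this]
  show "((\<lambda>x. sqrt (p x)) has_derivative
      (\<lambda>h. frechet_derivative p (at x) h * (inverse (sqrt (p x)) / 2))) (at x)" .
next
  fix k and b :: 'a assume b: "b \<in> Basis" and k: "k_smooth k (\<lambda>x. sqrt (p x))"
  \<comment> \<open>Writing 1 / sqrt p as (1 / p) * sqrt p expresses the derivative through sqrt p itself.\<close>
  have eq: "partial b p x * (inverse (sqrt (p x)) / 2) = (1/2) * (partial b p x * (inverse (p x) * sqrt (p x)))"
    for x
  proof -
    have "inverse (p x) * sqrt (p x) = inverse (sqrt (p x))"
      using pos[of x] by (simp add: field_simps)
    then show ?thesis by simp
  qed
  have "k_smooth k (\<lambda>x. inverse (p x))"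
    using smooth_inverse[OF p less_imp_neq[OF pos, symmetric]] by (simp add: smooth_iff_k_smooth)
  then have "k_smooth k (\<lambda>x. (1/2) * (partial b p x * (inverse (p x) * sqrt (p x))))"
    using smooth_partial[OF p b] k unfolding smooth_iff_k_smooth
    by (intro k_smooth_cmult k_smooth_mult) auto
  then show "k_smooth k (\<lambda>x. partial b p x * (inverse (sqrt (p x)) / 2))" unfolding eq .
qed

section \<open>A smooth step function\<close>

text \<open>The derivatives of \<open>exp (- 1 / x)\<close>, extended by \<open>0\<close> to the left, are linear combinations of members of this
  family, so smoothness of all members is proved simultaneously, by induction on the order.\<close>

definition flat_exp :: "nat \<Rightarrow> real \<Rightarrow> real" where
  "flat_exp k x = (if x > 0 then exp (- 1 / x) / x ^ k else 0)"

lemma flat_exp_tendsto_0: "((\<lambda>x. flat_exp k x) \<longlongrightarrow> 0) (at 0)"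
proof -
  have "((\<lambda>y::real. y ^ k / exp y) \<longlongrightarrow> 0) at_top" by (rule tendsto_power_div_exp_0)
  then have "((\<lambda>x::real. inverse x ^ k / exp (inverse x)) \<longlongrightarrow> 0) (at_right 0)"
    by (rule filterlim_compose[OF _ filterlim_inverse_at_top_right])
  moreover have "\<forall>\<^sub>F x in at_right (0::real). inverse x ^ k / exp (inverse x) = flat_exp k x"
    using eventually_at_right_less[of 0]
    by eventually_elim (simp add: flat_exp_def exp_minus field_simps)
  ultimately have r: "(flat_exp k \<longlongrightarrow> 0) (at_right 0)" by (rule Lim_transform_eventually)
  have "\<forall>\<^sub>F x in at_left (0::real). 0 = flat_exp k x"
    by (simp add: flat_exp_def eventually_at_filter)
  then have l: "(flat_exp k \<longlongrightarrow> 0) (at_left 0)" by (rule Lim_transform_eventually[OF tendsto_const])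
  show ?thesis using filterlim_split_at[OF l r] by simp
qed

lemma flat_exp_deriv:
  "(flat_exp k has_real_derivative (flat_exp (k + 2) x - real k * flat_exp (k + 1) x)) (at x)"
proof (cases "x = 0")
  case True
  have "\<forall>\<^sub>F h in at (0::real). flat_exp (Suc k) h = (flat_exp k (0 + h) - flat_exp k 0) / h"
    by (auto simp: eventually_at_filter flat_exp_def)
  from Lim_transform_eventually[OF flat_exp_tendsto_0 this]
  have "(flat_exp k has_real_derivative 0) (at 0)" by (simp add: DERIV_def)
  then show ?thesis using True by (simp add: flat_exp_def)
next
  case False
  show ?thesis
  proof (cases "x > 0")
    case True
    have "((\<lambda>x. exp (- 1 / x) / x ^ k) has_real_derivative
        (flat_exp (k + 2) x - real k * flat_exp (k + 1) x)) (at x)"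
      using True
      apply (auto intro!: derivative_eq_intros simp: flat_exp_def)
      apply (cases k)
      apply (auto simp: field_simps power2_eq_square)
      done
    moreover have "\<forall>\<^sub>F y in nhds x. exp (- 1 / y) / y ^ k = flat_exp k y"
      using eventually_nhds_in_open[of "{0<..}" x] True
      by (auto elim!: eventually_mono simp: flat_exp_def)
    ultimately show ?thesis
      by (subst DERIV_cong_ev[OF refl _ refl, of _ "\<lambda>x. exp (- 1 / x) / x ^ k"]) (auto elim: eventually_mono)
  next
    case neg: False
    have "\<forall>\<^sub>F y in nhds x. flat_exp k y = 0"
      using eventually_nhds_in_open[of "{..<0}" x] neg False
      by (auto elim!: eventually_mono simp: flat_exp_def)
    then have "(flat_exp k has_real_derivative 0) (at x)"
      by (subst DERIV_cong_ev[OF refl _ refl, of _ "\<lambda>x. 0"]) auto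
    then show ?thesis using neg by (simp add: flat_exp_def)
  qed
qed

lemma smooth_flat_exp: assumes p: "smooth p" shows "smooth (\<lambda>x. flat_exp j (p x))"
proof -
  have der: "((\<lambda>x. flat_exp j (p x)) has_derivative
      (\<lambda>h. (flat_exp (j + 2) (p x) - real j * flat_exp (j + 1) (p x)) * frechet_derivative p (at x) h)) (at x)"
    for j x
    using has_derivative_compose[OF smooth_has_derivative[OF p] flat_exp_deriv[unfolded has_field_derivative_def]] .
  have "k_smooth k (\<lambda>x. flat_exp j (p x))" for k
  proof (induction k arbitrary: j)
    case 0 show ?case using der by (auto simp: k_smooth_0 differentiable_def)
  next
    case (Suc k)
    show ?case
    proof (rule k_smooth_SucI[OF der])
      fix b :: 'a assume b: "b \<in> Basis"
      have "k_smooth k (\<lambda>x. (flat_exp (j + 2) (p x) + (- real j) * flat_exp (j + 1) (p x)) * partial b p x)"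
        using smooth_partial[OF p b] unfolding smooth_iff_k_smooth
        by (intro k_smooth_mult k_smooth_add k_smooth_cmult Suc.IH) auto
      then show "k_smooth k (\<lambda>x. (flat_exp (j + 2) (p x) - real j * flat_exp (j + 1) (p x)) * partial b p x)"
        by simp
    qed
  qed
  then show ?thesis by (simp add: smooth_iff_k_smooth)
qed

text \<open>The denominator is positive because \<open>x\<close> and \<open>1 - x\<close> are not both negative or zero.\<close>

definition smooth_step :: "real \<Rightarrow> real" where
  "smooth_step x = flat_exp 0 x * inverse (flat_exp 0 x + flat_exp 0 (1 - x))"

lemma flat_exp_nonneg: "0 \<le> flat_exp k x" by (simp add: flat_exp_def)

lemma flat_exp_sum_pos: "0 < flat_exp 0 x + flat_exp 0 (1 - x)"
  by (auto simp: flat_exp_def add_pos_pos)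

lemma smooth_step_compose: assumes p: "smooth p" shows "smooth (\<lambda>x. smooth_step (p x))"
  unfolding smooth_step_def
  by (intro smooth_mult smooth_inverse smooth_add smooth_flat_exp smooth_diff smooth_const p
      less_imp_neq[OF flat_exp_sum_pos, symmetric])

lemma smooth_step_le0: "x \<le> 0 \<Longrightarrow> smooth_step x = 0"
  by (simp add: smooth_step_def flat_exp_def)

lemma smooth_step_ge1: "x \<ge> 1 \<Longrightarrow> smooth_step x = 1"
  by (simp add: smooth_step_def flat_exp_def)

lemma smooth_step_nonneg: "0 \<le> smooth_step x"
  by (simp add: smooth_step_def flat_exp_nonneg)

lemma smooth_step_le1: "smooth_step x \<le> 1"
  using flat_exp_sum_pos[of x] flat_exp_nonneg[of 0 "1 - x"] by (simp add: smooth_step_def field_simps)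

lemma flat_exp_mono: "x \<le> y \<Longrightarrow> flat_exp 0 x \<le> flat_exp 0 y"
  by (auto simp: flat_exp_def field_simps)

lemma smooth_step_mono: assumes "x \<le> y" shows "smooth_step x \<le> smooth_step y"
proof -
  have "flat_exp 0 x * flat_exp 0 (1 - y) \<le> flat_exp 0 y * flat_exp 0 (1 - x)"
    using assms by (intro mult_mono flat_exp_mono flat_exp_nonneg) auto
  then show ?thesis using flat_exp_sum_pos[of x] flat_exp_sum_pos[of y]
    by (simp add: smooth_step_def field_simps)
qed

section \<open>Test functions and integration by parts\<close>

lemma test_functionI:
  assumes "smooth \<phi>" "compact K" "K \<subseteq> \<Omega>" "\<And>x. x \<notin> K \<Longrightarrow> \<phi> x = 0"
  shows "test_function \<Omega> \<phi>"
proof -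
  have "closure {x. \<phi> x \<noteq> 0} \<subseteq> K"
    using assms by (intro closure_minimal compact_imp_closed) auto
  then show ?thesis
    using assms compact_Int_closed[OF assms(2) closed_closure[of "{x. \<phi> x \<noteq> 0}"]]
    by (auto simp: test_function_def Int_absorb1)
qed

lemma test_functionE:
  assumes "test_function \<Omega> \<phi>"
  obtains K where "smooth \<phi>" "compact K" "K \<subseteq> \<Omega>" "\<And>x. x \<notin> K \<Longrightarrow> \<phi> x = 0"
proof
  show "smooth \<phi>" "compact (closure {x. \<phi> x \<noteq> 0})" "closure {x. \<phi> x \<noteq> 0} \<subseteq> \<Omega>"
    using assms by (auto simp: test_function_def)
  show "\<phi> x = 0" if "x \<notin> closure {x. \<phi> x \<noteq> 0}" for x
    using that closure_subset[of "{x. \<phi> x \<noteq> 0}"] by auto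
qed

lemma test_function_smooth: "test_function \<Omega> \<phi> \<Longrightarrow> smooth \<phi>"
  by (simp add: test_function_def)

lemma test_function_outside: "test_function \<Omega> \<phi> \<Longrightarrow> x \<notin> \<Omega> \<Longrightarrow> \<phi> x = 0"
  by (metis test_functionE subsetD)

lemma test_function_partial:
  assumes "test_function \<Omega> \<phi>" "b \<in> Basis"
  shows "test_function \<Omega> (partial b \<phi>)"
  using assms(1)
proof (rule test_functionE)
  fix K assume K: "smooth \<phi>" "compact K" "K \<subseteq> \<Omega>" "\<And>x. x \<notin> K \<Longrightarrow> \<phi> x = 0"
  show ?thesis
  proof (rule test_functionI[OF smooth_partial[OF K(1) assms(2)] K(2,3)])
    fix x assume x: "x \<notin> K"
    have "open (- K)" using K(2) by (simp add: compact_imp_closed open_Compl)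
    then have "(\<phi> has_derivative (\<lambda>h. 0)) (at x)"
      by (rule has_derivative_transform_within_open[OF has_derivative_const[of 0]]) (use x K(4) in auto)
    then show "partial b \<phi> x = 0" by (simp add: partial_unique)
  qed
qed

lemma test_function_mult:
  assumes "test_function \<Omega> \<phi>" "smooth \<psi>"
  shows "test_function \<Omega> (\<lambda>x. \<phi> x * \<psi> x)"
  using assms(1)
proof (rule test_functionE)
  fix K assume K: "smooth \<phi>" "compact K" "K \<subseteq> \<Omega>" "\<And>x. x \<notin> K \<Longrightarrow> \<phi> x = 0"
  show ?thesis by (rule test_functionI[OF smooth_mult[OF K(1) assms(2)] K(2,3)]) (simp add: K(4))
qed

lemma test_function_diff:
  assumes "test_function \<Omega> \<phi>" "test_function \<Omega> \<psi>"
  shows "test_function \<Omega> (\<lambda>x. \<phi> x - \<psi> x)"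
  using assms(1)
proof (rule test_functionE)
  fix K assume K: "smooth \<phi>" "compact K" "K \<subseteq> \<Omega>" "\<And>x. x \<notin> K \<Longrightarrow> \<phi> x = 0"
  from assms(2) show ?thesis
  proof (rule test_functionE)
    fix L assume L: "smooth \<psi>" "compact L" "L \<subseteq> \<Omega>" "\<And>x. x \<notin> L \<Longrightarrow> \<psi> x = 0"
    show ?thesis
      by (rule test_functionI[OF smooth_diff[OF K(1) L(1)] compact_Un[OF K(2) L(2)]]) (use K L in auto)
  qed
qed

lemma test_function_bounded:
  assumes "test_function \<Omega> \<phi>" obtains C where "C \<ge> 0" "\<And>x. \<bar>\<phi> x\<bar> \<le> C"
  using assms
proof (rule test_functionE)
  fix K assume K: "smooth \<phi>" "compact K" "K \<subseteq> \<Omega>" "\<And>x. x \<notin> K \<Longrightarrow> \<phi> x = 0"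
  have "bounded (\<phi> ` K)"
    using K by (intro compact_imp_bounded compact_continuous_image smooth_continuous)
  then obtain C where "\<And>x. x \<in> K \<Longrightarrow> \<bar>\<phi> x\<bar> \<le> C" by (auto simp: bounded_iff)
  then have "\<bar>\<phi> x\<bar> \<le> max C 0" for x using K(4)[of x] by (cases "x \<in> K") (auto simp: le_max_iff_disj)
  then show thesis using that[of "max C 0"] by auto
qed

lemma continuous_measurable_lebesgue_on:
  fixes f :: "'a::euclidean_space \<Rightarrow> real"
  assumes "continuous_on UNIV f" shows "f \<in> borel_measurable (lebesgue_on \<Omega>)"
  using assms by (intro measurable_restrict_space1 measurable_completion)
    (simp add: borel_measurable_continuous_onI)

lemma test_function_sq_integrable:
  assumes "finite_measure (lebesgue_on \<Omega>)" "test_function \<Omega> \<phi>"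
  shows "\<phi> \<in> sq_integrable (lebesgue_on \<Omega>)"
  using assms(2)
proof (rule test_function_bounded)
  fix C assume "C \<ge> 0" "\<And>x. \<bar>\<phi> x\<bar> \<le> C"
  then show ?thesis
    by (intro sq_integrable_bound(1)[OF sq_integrable_const[OF assms(1), of C]]
        continuous_measurable_lebesgue_on smooth_continuous test_function_smooth[OF assms(2)]) auto
qed

lemma smooth_line_derivative:
  assumes "smooth F"
  shows "((\<lambda>t. F (x + t *\<^sub>R b)) has_real_derivative partial b F (x + t *\<^sub>R b)) (at t)"
proof -
  have "((\<lambda>t. x + t *\<^sub>R b) has_derivative (\<lambda>h. h *\<^sub>R b)) (at t)"
    by (auto intro!: derivative_eq_intros)
  from has_derivative_compose[OF this smooth_has_derivative[OF assms]]
  have "((\<lambda>t. F (x + t *\<^sub>R b)) has_derivative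
      (\<lambda>h. frechet_derivative F (at (x + t *\<^sub>R b)) (h *\<^sub>R b))) (at t)" .
  moreover have "(\<lambda>h. frechet_derivative F (at (x + t *\<^sub>R b)) (h *\<^sub>R b)) = (*) (partial b F (x + t *\<^sub>R b))"
    using linear_cmul[OF has_derivative_linear[OF smooth_has_derivative[OF assms]]]
    by (simp add: fun_eq_iff mult.commute)
  ultimately show ?thesis by (simp add: has_field_derivative_def)
qed

text \<open>A translate of \<open>F\<close> has the same integral as \<open>F\<close>, so every difference quotient integrates to \<open>0\<close>; by the mean
  value theorem the quotients are bounded by a constant on a fixed ball, and the limit may be taken
  under the integral.\<close>

lemma integral_partial_eq_0:
  fixes F :: "'a::euclidean_space \<Rightarrow> real"
  assumes F: "test_function UNIV F" and b: "b \<in> Basis"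
  shows "(LINT x|lborel. partial b F x) = 0"
proof -
  from F obtain K where K: "smooth F" "compact K" "\<And>x. x \<notin> K \<Longrightarrow> F x = 0"
    by (rule test_functionE) blast
  obtain R where R: "\<And>x. x \<in> K \<Longrightarrow> norm x \<le> R"
    using compact_imp_bounded[OF K(2)] by (auto simp: bounded_iff)
  have F0: "F x = 0" if "norm x > R" for x using that R[of x] K(3)[of x] by force
  obtain C where C: "C \<ge> 0" "\<And>x. \<bar>partial b F x\<bar> \<le> C"
    using test_function_bounded[OF test_function_partial[OF F b]] by auto
  obtain D where D: "D \<ge> 0" "\<And>x. \<bar>F x\<bar> \<le> D"
    using test_function_bounded[OF F] by auto
  have Fm [measurable]: "F \<in> borel_measurable borel"
    by (intro borel_measurable_continuous_onI smooth_continuous K(1))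
  have pm [measurable]: "partial b F \<in> borel_measurable borel"
    by (intro borel_measurable_continuous_onI smooth_continuous smooth_partial K(1) b)
  have ind: "integrable lborel (\<lambda>x. c * indicator (cball (0::'a) r) x :: real)" for c r
    by (intro integrable_mult_right integrable_real_indicator) (use emeasure_bounded_finite[OF bounded_cball] in auto)
  have Fi: "integrable lborel F"
    by (rule Bochner_Integration.integrable_bound[OF ind[of D R]])
       (use D F0 in \<open>auto simp: indicator_def not_le intro!: AE_I2\<close>)
  have shift: "integrable lborel (\<lambda>x. F (c + x))" "(LINT x|lborel. F (c + x)) = (LINT x|lborel. F x)" for c
  proof -
    have "integrable (distr lborel borel ((+) c)) F" using Fi by (simp add: lborel_distr_plus)
    then show "integrable lborel (\<lambda>x. F (c + x))" by (subst (asm) integrable_distr_eq) auto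
    have "(LINT x|distr lborel borel ((+) c). F x) = (LINT x|lborel. F (c + x))"
      by (rule integral_distr) auto
    then show "(LINT x|lborel. F (c + x)) = (LINT x|lborel. F x)" by (simp add: lborel_distr_plus)
  qed
  define e where "e n = inverse (real (Suc n))" for n
  have e: "e n > 0" "e n \<le> 1" for n by (auto simp: e_def field_simps)
  define q where "q n x = (F (e n *\<^sub>R b + x) - F x) / e n" for n x
  have q0: "(LINT x|lborel. q n x) = 0" for n
    unfolding q_def using shift[of "e n *\<^sub>R b"] Fi by simp
  have "(\<lambda>n. LINT x|lborel. q n x) \<longlonglongrightarrow> (LINT x|lborel. partial b F x)"
  proof (rule integral_dominated_convergence[where w = "\<lambda>x. C * indicator (cball (0::'a) (R + 1)) x"])
    show "AE x in lborel. (\<lambda>n. q n x) \<longlonglongrightarrow> partial b F x"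
    proof (rule AE_I2)
      fix x
      have "((\<lambda>h. (F (x + h *\<^sub>R b) - F x) / h) \<longlongrightarrow> partial b F x) (at 0)"
        using smooth_line_derivative[OF K(1), of x b 0] by (simp add: DERIV_def)
      moreover have "filterlim e (at 0) sequentially"
        unfolding filterlim_at
      proof
        show "e \<longlonglongrightarrow> 0" unfolding e_def[abs_def] by (rule LIMSEQ_inverse_real_of_nat)
        show "\<forall>\<^sub>F n in sequentially. e n \<in> UNIV \<and> e n \<noteq> 0"
          using e(1) by (simp add: less_imp_neq[symmetric])
      qed
      ultimately show "(\<lambda>n. q n x) \<longlonglongrightarrow> partial b F x"
        unfolding q_def by (subst add.commute) (rule filterlim_compose)
    qed
    show "AE x in lborel. norm (q n x) \<le> C * indicator (cball (0::'a) (R + 1)) x" for n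
    proof (rule AE_I2)
      fix x
      show "norm (q n x) \<le> C * indicator (cball (0::'a) (R + 1)) x"
      proof (cases "x \<in> cball 0 (R + 1)")
        case True
        have "\<exists>z>0. z < e n \<and> F (x + e n *\<^sub>R b) - F (x + 0 *\<^sub>R b) = (e n - 0) * partial b F (x + z *\<^sub>R b)"
          by (rule MVT2[OF e(1)]) (rule smooth_line_derivative[OF K(1)])
        then obtain z where "F (x + e n *\<^sub>R b) - F x = e n * partial b F (x + z *\<^sub>R b)" by auto
        then have "q n x = partial b F (x + z *\<^sub>R b)" using e(1)[of n] by (simp add: q_def add.commute)
        then show ?thesis using C True by simp
      next
        case False
        then have x: "norm x > R + 1" by simp
        have "norm x \<le> norm (e n *\<^sub>R b + x) + norm (e n *\<^sub>R b)"
          by (metis add_diff_cancel_left' norm_triangle_sub norm_minus_commute add.commute norm_triangle_ineq4)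
        also have "norm (e n *\<^sub>R b) \<le> 1" using e[of n] b by simp
        finally have "norm (e n *\<^sub>R b + x) > R" using x by simp
        then show ?thesis using False x F0 by (simp add: q_def)
      qed
    qed
    show "integrable lborel (\<lambda>x. C * indicator (cball (0::'a) (R + 1)) x)" by (rule ind)
    show "partial b F \<in> borel_measurable lborel" "q n \<in> borel_measurable lborel" for n
      unfolding q_def[abs_def] by measurable
  qed
  then show ?thesis by (simp add: q0 LIMSEQ_const_iff)
qed

lemma integral_test_function_partial:
  assumes "\<Omega> \<in> sets lebesgue" "test_function \<Omega> F" "b \<in> Basis"
  shows "(LINT x|lebesgue_on \<Omega>. partial b F x) = 0"
proof -
  have t: "test_function \<Omega> (partial b F)" by (rule test_function_partial[OF assms(2,3)])
  have "(LINT x|lebesgue_on \<Omega>. partial b F x) = (LINT x|lebesgue. indicator \<Omega> x *\<^sub>R partial b F x)"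
    using assms(1) by (subst integral_restrict_space) auto
  also have "\<dots> = (LINT x|lebesgue. partial b F x)"
    by (rule Bochner_Integration.integral_cong) (use test_function_outside[OF t] in \<open>auto simp: indicator_def\<close>)
  also have "\<dots> = (LINT x|lborel. partial b F x)"
    by (intro integral_completion) (simp add: borel_measurable_continuous_onI smooth_continuous test_function_smooth[OF t])
  also have "\<dots> = 0"
    using assms(2,3) by (intro integral_partial_eq_0) (auto simp: test_function_def)
  finally show ?thesis .
qed

lemma partial_mult:
  assumes "smooth f" "smooth g"
  shows "partial b (\<lambda>x. f x * g x) x = f x * partial b g x + partial b f x * g x"
  using partial_unique[OF has_derivative_mult[OF smooth_has_derivative[OF assms(1)] smooth_has_derivative[OF assms(2)]]]
  by simp

lemma integration_by_parts_test:
  assumes \<Omega>: "\<Omega> \<in> sets lebesgue" "finite_measure (lebesgue_on \<Omega>)"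
    and \<phi>: "test_function \<Omega> \<phi>" and \<psi>: "test_function \<Omega> \<psi>" and b: "b \<in> Basis"
  shows "(LINT x|lebesgue_on \<Omega>. \<phi> x * partial b \<psi> x) = - (LINT x|lebesgue_on \<Omega>. partial b \<phi> x * \<psi> x)"
proof -
  note sq = test_function_sq_integrable[OF \<Omega>(2)]
  have "0 = (LINT x|lebesgue_on \<Omega>. partial b (\<lambda>x. \<phi> x * \<psi> x) x)"
    using integral_test_function_partial[OF \<Omega>(1) test_function_mult[OF \<phi> test_function_smooth[OF \<psi>]] b] by simp
  also have "\<dots> = (LINT x|lebesgue_on \<Omega>. \<phi> x * partial b \<psi> x + partial b \<phi> x * \<psi> x)"
    by (simp add: partial_mult test_function_smooth[OF \<phi>] test_function_smooth[OF \<psi>])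
  also have "\<dots> = (LINT x|lebesgue_on \<Omega>. \<phi> x * partial b \<psi> x) + (LINT x|lebesgue_on \<Omega>. partial b \<phi> x * \<psi> x)"
    by (intro Bochner_Integration.integral_add sq_integrable_mult sq \<phi> \<psi> test_function_partial b)
  finally show ?thesis by simp
qed

section \<open>The fundamental lemma of the calculus of variations\<close>

definition box_bump :: "nat \<Rightarrow> 'a::euclidean_space \<Rightarrow> 'a \<Rightarrow> 'a \<Rightarrow> real" where
  "box_bump n a c x =
     (\<Prod>b\<in>Basis. smooth_step (real n * (x \<bullet> b - a \<bullet> b)) * smooth_step (real n * (c \<bullet> b - x \<bullet> b)))"

lemma smooth_box_bump: "smooth (box_bump n a c)"
proof -
  have "smooth (\<lambda>x. \<Prod>b\<in>Basis. smooth_step (real n * (x \<bullet> b - a \<bullet> b)) * smooth_step (real n * (c \<bullet> b - x \<bullet> b)))"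
    by (intro smooth_prod smooth_mult smooth_step_compose smooth_cmult smooth_diff smooth_inner smooth_const) auto
  then show ?thesis by (simp add: box_bump_def[abs_def])
qed

lemma box_bump_outside: assumes "x \<notin> box a c" shows "box_bump n a c x = 0"
proof -
  obtain b where b: "b \<in> Basis" "x \<bullet> b \<le> a \<bullet> b \<or> c \<bullet> b \<le> x \<bullet> b"
    using assms by (auto simp: mem_box not_less)
  then have "real n * (x \<bullet> b - a \<bullet> b) \<le> 0 \<or> real n * (c \<bullet> b - x \<bullet> b) \<le> 0"
    by (auto simp: mult_nonneg_nonpos)
  then show ?thesis unfolding box_bump_def using b(1)
    by (intro prod_zero) (auto intro!: bexI[of _ b] simp: smooth_step_le0)
qed

lemma box_bump_nonneg: "0 \<le> box_bump n a c x"
  unfolding box_bump_def by (intro prod_nonneg mult_nonneg_nonneg ballI smooth_step_nonneg)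

lemma box_bump_le1: "box_bump n a c x \<le> 1"
  unfolding box_bump_def by (intro prod_le_1 conjI mult_nonneg_nonneg mult_le_one smooth_step_nonneg smooth_step_le1)

text \<open>Inside the open box every factor is eventually \<open>1\<close>, and outside the bump vanishes.\<close>

lemma box_bump_tendsto: "(\<lambda>n. box_bump n a c x) \<longlonglongrightarrow> indicator (box a c) x"
proof (cases "x \<in> box a c")
  case True
  have "\<forall>\<^sub>F n in sequentially. real n * d \<ge> 1" if "d > 0" for d :: real
  proof -
    obtain N where N: "1 / d \<le> real N" using real_arch_simple by blast
    show ?thesis
    proof (rule eventually_sequentiallyI[of N])
      fix n assume "N \<le> n"
      then have "1 / d \<le> real n" using N by linarith
      then show "1 \<le> real n * d" using that by (simp add: field_simps)
    qed
  qed
  then have "\<forall>\<^sub>F n in sequentially. 1 \<le> real n * (x \<bullet> b - a \<bullet> b) \<and> 1 \<le> real n * (c \<bullet> b - x \<bullet> b)"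
    if "b \<in> Basis" for b
    using True that by (intro eventually_conj) (simp_all add: mem_box)
  then have "\<forall>\<^sub>F n in sequentially. \<forall>b\<in>Basis. 1 \<le> real n * (x \<bullet> b - a \<bullet> b) \<and> 1 \<le> real n * (c \<bullet> b - x \<bullet> b)"
    by (intro eventually_ball_finite) auto
  then have "\<forall>\<^sub>F n in sequentially. 1 = box_bump n a c x"
    by (rule eventually_mono) (simp add: box_bump_def smooth_step_ge1)
  then have "(\<lambda>n. box_bump n a c x) \<longlonglongrightarrow> 1" by (rule Lim_transform_eventually[OF tendsto_const])
  then show ?thesis using True by simp
next
  case False then show ?thesis by (simp add: box_bump_outside)
qed

lemma box_bump_test:
  assumes "cbox a c \<subseteq> \<Omega>" shows "test_function \<Omega> (box_bump n a c)"
  by (rule test_functionI[OF smooth_box_bump compact_cbox assms])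
     (meson box_bump_outside box_subset_cbox subsetD)

text \<open>Open boxes form an intersection-stable generator of the Borel sets, so the integral over every Borel
  set vanishes.\<close>

lemma AE_eq_0_of_box_integrals:
  fixes F :: "'a::euclidean_space \<Rightarrow> real"
  assumes F: "integrable lborel F" and UNIV0: "(LINT x|lborel. F x) = 0"
    and box0: "\<And>a c. (LINT x:box a c|lborel. F x) = 0"
  shows "AE x in lborel. F x = 0"
proof -
  let ?G = "range (\<lambda>(a, b). box a b :: 'a set)"
  have Fm [measurable]: "F \<in> borel_measurable borel" using F by auto
  have sets_G: "sets borel = sigma_sets UNIV ?G" by (subst borel_eq_box) auto
  have si: "set_integrable lborel A F" if "A \<in> sets borel" for A
    unfolding set_integrable_def using that F by (intro integrable_mult_indicator) auto
  have "(LINT x:A|lborel. F x) = 0" if "A \<in> sets borel" for A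
  proof -
    have "Int_stable ?G"
    proof -
      have "box a b \<inter> box c d \<in> ?G" for a b c d :: 'a
      proof -
        obtain p q where "box a b \<inter> box c d = box p q" by (rule that[OF box_Int_box])
        then show ?thesis by (intro range_eqI[of _ _ "(p, q)"]) simp
      qed
      then show ?thesis by (auto simp: Int_stable_def)
    qed
    moreover have "?G \<subseteq> Pow UNIV" by simp
    moreover have "A \<in> sigma_sets UNIV ?G" using that by (simp only: sets_G)
    ultimately show ?thesis
    proof (induction A rule: sigma_sets_induct_disjoint)
      case (basic A) then show ?case using box0 by auto
    next
      case empty then show ?case by (simp add: set_lebesgue_integral_def)
    next
      case (compl A)
      then have A: "A \<in> sets borel" by (simp add: sets_G)
      then have "(LINT x:UNIV|lborel. F x) = (LINT x:A|lborel. F x) + (LINT x:UNIV - A|lborel. F x)"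
        by (subst set_integral_Un[symmetric]) (auto intro: si)
      then show ?case using compl UNIV0 by (simp add: set_lebesgue_integral_def)
    next
      case (union A)
      then have A: "A i \<in> sets borel" for i by (auto simp: sets_G)
      have "(LINT x:(\<Union>i. A i)|lborel. F x) = (\<Sum>i. (LINT x:(A i)|lborel. F x))"
        using A union(1) by (intro lebesgue_integral_countable_add si) (auto simp: disjoint_family_on_def)
      then show ?case using union by simp
    qed
  qed
  then show ?thesis using density_unique_real[OF F, of "\<lambda>x. 0"] by (auto simp: set_lebesgue_integral_def)
qed

text \<open>Bumps converge to the indicators of boxes whose closure lies in \<open>\<Omega>\<close>, so the integral of \<open>f\<close> over such
  a box vanishes. Inside one of them, \<open>AE_eq_0_of_box_integrals\<close> applies to the restriction of \<open>f\<close>, and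
  countably many boxes cover \<open>\<Omega>\<close>.\<close>

lemma fundamental_lemma_variations:
  fixes f :: "'a::euclidean_space \<Rightarrow> real"
  assumes \<Omega>: "open \<Omega>" and f: "integrable (lebesgue_on \<Omega>) f"
    and zero: "\<And>\<phi>. test_function \<Omega> \<phi> \<Longrightarrow> (LINT x|lebesgue_on \<Omega>. f x * \<phi> x) = 0"
  shows "AE x in lebesgue_on \<Omega>. f x = 0"
proof -
  have \<Omega>s: "\<Omega> \<in> sets lebesgue" using \<Omega> by auto
  define g where "g x = indicator \<Omega> x * f x" for x
  have g: "integrable lebesgue g"
    using f \<Omega>s by (subst (asm) integrable_restrict_space) (auto simp: g_def[abs_def])
  obtain h where h [measurable]: "h \<in> borel_measurable lborel" and gh: "AE x in lborel. g x = h x"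
    using completion_ex_borel_measurable_real[OF borel_measurable_integrable[OF g]] by blast
  have gh': "AE x in lebesgue. g x = h x" using gh by (rule AE_completion)
  have hi: "integrable lborel h"
  proof -
    have "integrable lebesgue h"
      using g gh' by (rule_tac integrable_cong_AE_imp[OF g]) (auto intro: measurable_completion)
    then show ?thesis by (simp add: integrable_completion)
  qed
  \<comment> \<open>Bumps converge to the indicator of an inner box.\<close>
  have inner: "(LINT x:box a c|lborel. h x) = 0" if ac: "cbox a c \<subseteq> \<Omega>" for a c
  proof -
    have "(\<lambda>n. LINT x|lborel. h x * box_bump n a c x) \<longlonglongrightarrow> (LINT x|lborel. h x * indicator (box a c) x)"
    proof (rule integral_dominated_convergence[where w = "\<lambda>x. \<bar>h x\<bar>"])
      show "AE x in lborel. (\<lambda>n. h x * box_bump n a c x) \<longlonglongrightarrow> h x * indicator (box a c) x"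
        by (intro AE_I2 tendsto_mult tendsto_const box_bump_tendsto)
      show "AE x in lborel. norm (h x * box_bump n a c x) \<le> \<bar>h x\<bar>" for n
        by (intro AE_I2) (simp add: abs_mult box_bump_nonneg box_bump_le1 mult_left_le)
    qed (use hi in \<open>auto simp: borel_measurable_continuous_onI smooth_continuous smooth_box_bump
        intro!: borel_measurable_times\<close>)
    moreover have "(LINT x|lborel. h x * box_bump n a c x) = 0" for n
    proof -
      have m: "box_bump n a c \<in> borel_measurable borel"
        by (simp add: borel_measurable_continuous_onI smooth_continuous smooth_box_bump)
      have "0 = (LINT x|lebesgue_on \<Omega>. f x * box_bump n a c x)"
        using zero[OF box_bump_test[OF ac]] by simp
      also have "\<dots> = (LINT x|lebesgue. g x * box_bump n a c x)"
        using \<Omega>s by (subst integral_restrict_space) (auto simp: g_def mult.assoc)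
      also have "\<dots> = (LINT x|lebesgue. h x * box_bump n a c x)"
        using gh' g m h by (intro integral_cong_AE borel_measurable_times) (auto intro: measurable_completion)
      also have "\<dots> = (LINT x|lborel. h x * box_bump n a c x)"
        using m by (intro integral_completion) auto
      finally show ?thesis by simp
    qed
    ultimately show ?thesis
      by (simp add: set_lebesgue_integral_def mult.commute LIMSEQ_const_iff)
  qed
  have local: "AE x in lborel. x \<in> box p q \<longrightarrow> h x = 0" if pq: "cbox p q \<subseteq> \<Omega>" for p q
  proof -
    have "AE x in lborel. h x * indicator (box p q) x = 0"
    proof (rule AE_eq_0_of_box_integrals)
      show "integrable lborel (\<lambda>x. h x * indicator (box p q) x)"
        using hi by (intro integrable_real_mult_indicator) auto
      show "(LINT x|lborel. h x * indicator (box p q) x) = 0"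
        using inner[OF pq] by (simp add: set_lebesgue_integral_def mult.commute)
      fix a c :: 'a
      obtain a' c' where box: "box a c \<inter> box p q = box a' c'" by (rule that[OF box_Int_box])
      have "(LINT x:box a c|lborel. h x * indicator (box p q) x) = (LINT x:box a' c'|lborel. h x)"
        unfolding set_lebesgue_integral_def box[symmetric]
        by (intro Bochner_Integration.integral_cong) (auto simp: indicator_def)
      also have "\<dots> = 0"
      proof (cases "box a' c' = {}")
        case True then show ?thesis by (simp add: set_lebesgue_integral_def)
      next
        case False
        have "cbox a' c' = closure (box a' c')" using False by (simp add: closure_box)
        also have "\<dots> \<subseteq> cbox p q" using box box_subset_cbox[of p q] by (intro closure_minimal) auto
        finally show ?thesis using pq by (intro inner) auto
      qed
      finally show "(LINT x:box a c|lborel. h x * indicator (box p q) x) = 0" .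
    qed
    then show ?thesis by eventually_elim (auto simp: indicator_def)
  qed
  obtain \<D> where \<D>: "countable \<D>" "\<D> \<subseteq> Pow \<Omega>" "\<And>X. X \<in> \<D> \<Longrightarrow> \<exists>a b. X = cbox a b" "\<Union>\<D> = \<Omega>"
    by (rule open_countable_Union_open_cbox[OF \<Omega>]) blast
  have "AE x in lebesgue. x \<in> X \<longrightarrow> h x = 0" if X: "X \<in> \<D>" for X
  proof -
    obtain p q where pq: "X = cbox p q" "cbox p q \<subseteq> \<Omega>" using \<D>(2) \<D>(3)[OF X] X by (metis PowD subsetD)
    have "AE x in lebesgue. x \<notin> cbox p q - box p q"
      by (rule AE_not_in) (use negligible_frontier_interval[of p q] in \<open>simp add: negligible_iff_null_sets\<close>)
    with AE_completion[OF local[OF pq(2)]] show ?thesis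
      by eventually_elim (auto simp: pq)
  qed
  then have "AE x in lebesgue. \<forall>X\<in>\<D>. x \<in> X \<longrightarrow> h x = 0"
    using \<D>(1) by (subst AE_ball_countable) auto
  with gh' have "AE x in lebesgue. x \<in> \<Omega> \<longrightarrow> f x = 0"
  proof eventually_elim
    case (elim x)
    show ?case
    proof
      assume x: "x \<in> \<Omega>"
      then obtain X where "X \<in> \<D>" "x \<in> X" using \<D>(4) by blast
      then have "h x = 0" using elim(2) by blast
      then show "f x = 0" using elim(1) x by (simp add: g_def)
    qed
  qed
  then show ?thesis using \<Omega>s by (simp add: AE_restrict_space_iff)
qed

section \<open>Weak derivatives and approximation by test functions\<close>

lemma test_function_iterated_partial:
  "test_function \<Omega> \<phi> \<Longrightarrow> set bs \<subseteq> Basis \<Longrightarrow> test_function \<Omega> (iterated_partial bs \<phi>)"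
  by (induction bs) (auto intro: test_function_partial)

lemma is_weak_deriv_test_function:
  assumes "\<Omega> \<in> sets lebesgue" "finite_measure (lebesgue_on \<Omega>)" "test_function \<Omega> \<phi>" "b \<in> Basis"
  shows "is_weak_deriv \<Omega> [b] \<phi> (partial b \<phi>)"
  using integration_by_parts_test[OF assms(1-3) _ assms(4)] by (simp add: is_weak_deriv_def)

lemma is_weak_deriv_diff:
  assumes fin: "finite_measure (lebesgue_on \<Omega>)" and bs: "set bs \<subseteq> Basis"
    and sq: "f \<in> sq_integrable (lebesgue_on \<Omega>)" "f' \<in> sq_integrable (lebesgue_on \<Omega>)"
      "g \<in> sq_integrable (lebesgue_on \<Omega>)" "g' \<in> sq_integrable (lebesgue_on \<Omega>)"
    and d: "is_weak_deriv \<Omega> bs f f'" "is_weak_deriv \<Omega> bs g g'"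
  shows "is_weak_deriv \<Omega> bs (\<lambda>x. f x - g x) (\<lambda>x. f' x - g' x)"
  unfolding is_weak_deriv_def
proof (intro allI impI)
  fix \<phi> assume \<phi>: "test_function \<Omega> \<phi>"
  let ?M = "lebesgue_on \<Omega>"
  note t = test_function_sq_integrable[OF fin test_function_iterated_partial[OF \<phi> bs]]
    test_function_sq_integrable[OF fin \<phi>]
  have "(LINT x|?M. (f x - g x) * iterated_partial bs \<phi> x)
      = (LINT x|?M. f x * iterated_partial bs \<phi> x) - (LINT x|?M. g x * iterated_partial bs \<phi> x)"
    unfolding left_diff_distrib
    by (intro Bochner_Integration.integral_diff sq_integrable_mult[OF sq(1) t(1)] sq_integrable_mult[OF sq(3) t(1)])
  also have "\<dots> = (- 1) ^ length bs * (LINT x|?M. f' x * \<phi> x) - (- 1) ^ length bs * (LINT x|?M. g' x * \<phi> x)"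
    using d \<phi> by (simp add: is_weak_deriv_def)
  also have "\<dots> = (- 1) ^ length bs * (LINT x|?M. (f' x - g' x) * \<phi> x)"
    unfolding left_diff_distrib
    by (subst Bochner_Integration.integral_diff[OF sq_integrable_mult[OF sq(2) t(2)] sq_integrable_mult[OF sq(4) t(2)]])
       (simp add: right_diff_distrib)
  finally show "(LINT x|?M. (f x - g x) * iterated_partial bs \<phi> x)
      = (- 1) ^ length bs * (LINT x|?M. (f' x - g' x) * \<phi> x)" .
qed

lemma weak_deriv_in_Hk:
  assumes "f \<in> elts (Hk k \<Omega>)" "bs \<in> multi_indices k"
  shows "weak_deriv \<Omega> bs f \<in> sq_integrable (lebesgue_on \<Omega>)" "is_weak_deriv \<Omega> bs f (weak_deriv \<Omega> bs f)"
proof -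
  have "\<exists>g. g \<in> elts (Lp 2 \<Omega>) \<and> is_weak_deriv \<Omega> bs f g"
    using assms by (auto simp: Hk_def)
  from someI_ex[OF this]
  show "weak_deriv \<Omega> bs f \<in> sq_integrable (lebesgue_on \<Omega>)" "is_weak_deriv \<Omega> bs f (weak_deriv \<Omega> bs f)"
    by (simp_all add: weak_deriv_def elts_Lp2)
qed

lemma Hk_sq_integrable: "f \<in> elts (Hk k \<Omega>) \<Longrightarrow> f \<in> sq_integrable (lebesgue_on \<Omega>)"
  by (simp add: Hk_def elts_Lp2)

lemma finite_multi_indices: "finite (multi_indices k :: 'a::euclidean_space list set)"
  unfolding multi_indices_def by (rule finite_lists_length_le) simp

lemma l2_norm_weak_deriv_le:
  assumes "bs \<in> multi_indices k"
  shows "l2_norm (lebesgue_on \<Omega>) (weak_deriv \<Omega> bs f) \<le> nrm (Hk k \<Omega>) f"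
proof -
  have "(l2_norm (lebesgue_on \<Omega>) (weak_deriv \<Omega> bs f))\<^sup>2
      \<le> (\<Sum>bs\<in>multi_indices k. (l2_norm (lebesgue_on \<Omega>) (weak_deriv \<Omega> bs f))\<^sup>2)"
    by (rule member_le_sum[OF assms]) (auto simp: finite_multi_indices)
  then show ?thesis by (simp add: Hk_def nrm_Lp2 real_le_rsqrt)
qed

lemma test_function_in_H1:
  assumes "\<Omega> \<in> sets lebesgue" "finite_measure (lebesgue_on \<Omega>)" "test_function \<Omega> \<phi>"
  shows "\<phi> \<in> elts (Hk 1 \<Omega>)"
proof -
  have "\<exists>g\<in>sq_integrable (lebesgue_on \<Omega>). is_weak_deriv \<Omega> bs \<phi> g" if bs: "bs \<in> multi_indices 1" for bs
  proof (cases bs)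
    case Nil
    then show ?thesis using test_function_sq_integrable[OF assms(2,3)]
      by (auto simp: is_weak_deriv_def)
  next
    case (Cons b cs)
    then have b: "bs = [b]" "b \<in> Basis" using bs by (auto simp: multi_indices_def)
    show ?thesis unfolding b(1)
      by (rule bexI[where x = "partial b \<phi>"])
         (intro is_weak_deriv_test_function assms b(2) test_function_sq_integrable test_function_partial)+
  qed
  then show ?thesis using test_function_sq_integrable[OF assms(2,3)] by (simp add: Hk_def elts_Lp2)
qed

lemma Hk_diff:
  assumes fin: "finite_measure (lebesgue_on \<Omega>)" and f: "f \<in> elts (Hk k \<Omega>)" and g: "g \<in> elts (Hk k \<Omega>)"
  shows "(\<lambda>x. f x - g x) \<in> elts (Hk k \<Omega>)"
proof -
  have "\<exists>h\<in>sq_integrable (lebesgue_on \<Omega>). is_weak_deriv \<Omega> bs (\<lambda>x. f x - g x) h"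
    if bs: "bs \<in> multi_indices k" for bs
  proof (rule bexI)
    note d = weak_deriv_in_Hk[OF f bs] weak_deriv_in_Hk[OF g bs]
    show "is_weak_deriv \<Omega> bs (\<lambda>x. f x - g x) (\<lambda>x. weak_deriv \<Omega> bs f x - weak_deriv \<Omega> bs g x)"
      using bs by (intro is_weak_deriv_diff fin d Hk_sq_integrable[OF f] Hk_sq_integrable[OF g])
        (simp add: multi_indices_def)
    show "(\<lambda>x. weak_deriv \<Omega> bs f x - weak_deriv \<Omega> bs g x) \<in> sq_integrable (lebesgue_on \<Omega>)"
      by (intro sq_integrable_diff d)
  qed
  then show ?thesis
    using sq_integrable_diff[OF Hk_sq_integrable[OF f] Hk_sq_integrable[OF g]] by (simp add: Hk_def elts_Lp2)
qed

text \<open>Besides \<open>\<phi> n \<longlonglongrightarrow> f\<close> in \<open>L\<^sup>2\<close>, weak gradients \<open>e n\<close> of the differences \<open>\<phi> n - f\<close> that tend to \<open>0\<close> are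
  provided; in \<open>laplacian_soft_pos_le\<close> they take up a derivative of the test function.\<close>

lemma H10_approximation:
  fixes \<Omega> :: "'a::euclidean_space set"
  assumes \<Omega>: "open \<Omega>" "bounded \<Omega>" and f: "f \<in> elts (H10 \<Omega>)"
  obtains \<phi> e where
    "\<And>n::nat. test_function \<Omega> (\<phi> n)"
    "(\<lambda>n. l2_norm (lebesgue_on \<Omega>) (\<lambda>x. \<phi> n x - f x)) \<longlonglongrightarrow> 0"
    "\<And>n b. b \<in> Basis \<Longrightarrow> e n b \<in> sq_integrable (lebesgue_on \<Omega>)"
    "\<And>n b. b \<in> Basis \<Longrightarrow> is_weak_deriv \<Omega> [b] (\<lambda>x. \<phi> n x - f x) (e n b)"
    "\<And>b. b \<in> Basis \<Longrightarrow> (\<lambda>n. l2_norm (lebesgue_on \<Omega>) (e n b)) \<longlonglongrightarrow> 0"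
proof -
  let ?M = "lebesgue_on \<Omega>"
  have \<Omega>s: "\<Omega> \<in> sets lebesgue" using \<Omega>(1) by auto
  have fin: "finite_measure ?M" using \<Omega> by (rule finite_measure_lebesgue_on)
  from f obtain \<phi> where f1: "f \<in> elts (Hk 1 \<Omega>)" and \<phi>: "\<And>n::nat. test_function \<Omega> (\<phi> n)"
    and lim: "(\<lambda>n. nrm (Hk 1 \<Omega>) (\<lambda>x. \<phi> n x - f x)) \<longlonglongrightarrow> 0"
    by (auto simp: H10_def)
  define r where "r n x = \<phi> n x - f x" for n x
  have r: "r n \<in> elts (Hk 1 \<Omega>)" for n
    unfolding r_def[abs_def] by (rule Hk_diff[OF fin test_function_in_H1[OF \<Omega>s fin \<phi>] f1])
  have d0: "(\<lambda>n. l2_norm ?M (weak_deriv \<Omega> bs (r n))) \<longlonglongrightarrow> 0" if "bs \<in> multi_indices 1" for bs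
    unfolding r_def[abs_def]
    by (rule tendsto_sandwich[OF _ _ tendsto_const lim]) (simp_all only: l2_norm_nonneg l2_norm_weak_deriv_le[OF that] eventually_True)
  have nil: "[] \<in> multi_indices 1" and b1: "b \<in> Basis \<Longrightarrow> [b] \<in> multi_indices 1" for b :: 'a
    by (auto simp: multi_indices_def)
  \<comment> \<open>The chosen weak derivative of order zero agrees with the function almost everywhere.\<close>
  have "l2_norm ?M (weak_deriv \<Omega> [] (r n)) = l2_norm ?M (r n)" for n
  proof (rule l2_norm_cong_AE)
    note d = weak_deriv_in_Hk[OF r nil, of n]
    note rs = Hk_sq_integrable[OF r, of n]
    show "weak_deriv \<Omega> [] (r n) \<in> borel_measurable ?M" "r n \<in> borel_measurable ?M"
      using d rs by (auto intro: sq_integrable_measurable)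
    have "AE x in ?M. weak_deriv \<Omega> [] (r n) x - r n x = 0"
    proof (rule fundamental_lemma_variations[OF \<Omega>(1)])
      show "integrable ?M (\<lambda>x. weak_deriv \<Omega> [] (r n) x - r n x)"
        by (intro sq_integrable_imp_integrable fin sq_integrable_diff d rs)
      fix \<psi> assume \<psi>: "test_function \<Omega> \<psi>"
      note ps = test_function_sq_integrable[OF fin \<psi>]
      have "(LINT x|?M. (weak_deriv \<Omega> [] (r n) x - r n x) * \<psi> x)
         = (LINT x|?M. weak_deriv \<Omega> [] (r n) x * \<psi> x) - (LINT x|?M. r n x * \<psi> x)"
        unfolding left_diff_distrib
        by (intro Bochner_Integration.integral_diff sq_integrable_mult[OF d(1) ps] sq_integrable_mult[OF rs ps])
      then show "(LINT x|?M. (weak_deriv \<Omega> [] (r n) x - r n x) * \<psi> x) = 0"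
        using d(2) \<psi> by (simp add: is_weak_deriv_def)
    qed
    then show "AE x in ?M. weak_deriv \<Omega> [] (r n) x = r n x" by eventually_elim simp
  qed
  then have "(\<lambda>n. l2_norm ?M (r n)) \<longlonglongrightarrow> 0" using d0[OF nil] by simp
  then show thesis
    using that[of \<phi> "\<lambda>n b. weak_deriv \<Omega> [b] (r n)"] \<phi> weak_deriv_in_Hk[OF r b1] d0[OF b1]
    by (auto simp: r_def[abs_def])
qed

section \<open>The Laplacian tested with a positive part\<close>

text \<open>A smooth approximation of the positive part, uniform within \<open>\<epsilon>\<close>. It vanishes at \<open>0\<close>, so that composition
  with a test function gives a test function, and its slope lies between \<open>0\<close> and \<open>1\<close>.\<close>

definition soft_pos :: "real \<Rightarrow> real \<Rightarrow> real" where
  "soft_pos \<epsilon> s = (1/2) * (s + sqrt (s\<^sup>2 + \<epsilon>\<^sup>2) - \<epsilon>)"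

lemma soft_pos_0: "\<epsilon> > 0 \<Longrightarrow> soft_pos \<epsilon> 0 = 0"
  by (simp add: soft_pos_def)

lemma soft_pos_near_pos_part:
  assumes "\<epsilon> > 0" shows "\<bar>soft_pos \<epsilon> s - max r 0\<bar> \<le> \<epsilon> + \<bar>s - r\<bar>"
proof -
  define r' where "r' = sqrt (s\<^sup>2 + \<epsilon>\<^sup>2)"
  have lo: "\<bar>s\<bar> \<le> r'" unfolding r'_def by (rule real_le_rsqrt) simp
  have hi: "r' \<le> \<bar>s\<bar> + \<epsilon>"
    unfolding r'_def using assms by (intro real_le_lsqrt) (auto simp: power2_sum)
  have "\<bar>(1/2) * (s + r' - \<epsilon>) - max s 0\<bar> \<le> \<epsilon>"
  proof (cases "s \<ge> 0")
    case True
    then show ?thesis using lo hi assms by (auto simp: abs_le_iff field_simps)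
  next
    case False
    then show ?thesis using lo hi assms by (simp add: abs_le_iff)
  qed
  then have "\<bar>soft_pos \<epsilon> s - max s 0\<bar> \<le> \<epsilon>" by (simp only: soft_pos_def r'_def)
  then show ?thesis by linarith
qed

lemma smooth_soft_pos: "smooth p \<Longrightarrow> \<epsilon> > 0 \<Longrightarrow> smooth (\<lambda>x. soft_pos \<epsilon> (p x))"
  unfolding soft_pos_def power2_eq_square
  by (intro smooth_cmult smooth_diff smooth_add smooth_sqrt smooth_mult smooth_const)
     (auto simp: add_nonneg_pos)

lemma soft_pos_deriv:
  assumes "\<epsilon> > 0"
  obtains \<gamma> where "(soft_pos \<epsilon> has_real_derivative \<gamma>) (at s)" "0 \<le> \<gamma>" "\<gamma> \<le> 1"
proof
  have pos: "s\<^sup>2 + \<epsilon>\<^sup>2 > 0" using assms by (simp add: add_nonneg_pos)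
  have "\<bar>s\<bar> \<le> sqrt (s\<^sup>2 + \<epsilon>\<^sup>2)" by (rule real_le_rsqrt) simp
  then have "\<bar>s / sqrt (s\<^sup>2 + \<epsilon>\<^sup>2)\<bar> \<le> 1" using pos by (simp add: abs_divide)
  then have "- 1 \<le> s / sqrt (s\<^sup>2 + \<epsilon>\<^sup>2)" "s / sqrt (s\<^sup>2 + \<epsilon>\<^sup>2) \<le> 1"
    unfolding abs_le_iff by linarith+
  then show "0 \<le> (1/2) * (1 + s / sqrt (s\<^sup>2 + \<epsilon>\<^sup>2))" "(1/2) * (1 + s / sqrt (s\<^sup>2 + \<epsilon>\<^sup>2)) \<le> 1"
    by simp_all
  show "(soft_pos \<epsilon> has_real_derivative (1/2) * (1 + s / sqrt (s\<^sup>2 + \<epsilon>\<^sup>2))) (at s)"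
    unfolding soft_pos_def[abs_def] using pos
    by (auto intro!: derivative_eq_intros simp: field_simps)
qed

lemma test_function_soft_pos:
  assumes "test_function \<Omega> \<zeta>" "\<epsilon> > 0" shows "test_function \<Omega> (\<lambda>x. soft_pos \<epsilon> (\<zeta> x))"
  using assms(1)
proof (rule test_functionE)
  fix K assume K: "smooth \<zeta>" "compact K" "K \<subseteq> \<Omega>" "\<And>x. x \<notin> K \<Longrightarrow> \<zeta> x = 0"
  show ?thesis by (rule test_functionI[OF smooth_soft_pos[OF K(1) assms(2)] K(2,3)]) (simp add: K(4) soft_pos_0 assms)
qed

text \<open>With \<open>\<Psi> = soft_pos \<epsilon> \<circ> \<zeta>\<close> and \<open>w = \<zeta> - (\<zeta> - w)\<close>, one integration by parts is classical and the other one
  is the definition of \<open>e\<close>. What remains is \<open>\<integral> (e - \<partial>\<zeta>) \<partial>\<Psi>\<close> with \<open>\<partial>\<Psi> = \<gamma> \<partial>\<zeta>\<close>, \<open>0 \<le> \<gamma> \<le> 1\<close>, and completing the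
  square bounds the integrand by \<open>e\<^sup>2 / 4\<close>.\<close>

lemma laplacian_soft_pos_le:
  fixes \<Omega> :: "'a::euclidean_space set"
  assumes \<Omega>: "open \<Omega>" "bounded \<Omega>"
    and w: "w \<in> sq_integrable (lebesgue_on \<Omega>)"
    and \<zeta>: "test_function \<Omega> \<zeta>"
    and e: "e \<in> sq_integrable (lebesgue_on \<Omega>)" "is_weak_deriv \<Omega> [b] (\<lambda>x. \<zeta> x - w x) e"
    and L: "L \<in> sq_integrable (lebesgue_on \<Omega>)" "is_weak_deriv \<Omega> [b, b] w L"
    and b: "b \<in> Basis" and \<epsilon>: "\<epsilon> > 0"
  shows "(LINT x|lebesgue_on \<Omega>. L x * soft_pos \<epsilon> (\<zeta> x)) \<le> (l2_norm (lebesgue_on \<Omega>) e)\<^sup>2 / 4"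
proof -
  let ?M = "lebesgue_on \<Omega>"
  have \<Omega>s: "\<Omega> \<in> sets lebesgue" using \<Omega>(1) by auto
  have fin: "finite_measure ?M" using \<Omega> by (rule finite_measure_lebesgue_on)
  define \<Psi> where "\<Psi> x = soft_pos \<epsilon> (\<zeta> x)" for x
  have \<Psi>: "test_function \<Omega> \<Psi>" unfolding \<Psi>_def[abs_def] by (rule test_function_soft_pos[OF \<zeta> \<epsilon>])
  have t1: "test_function \<Omega> (partial b \<Psi>)" by (rule test_function_partial[OF \<Psi> b])
  have t2: "test_function \<Omega> (partial b (partial b \<Psi>))" by (rule test_function_partial[OF t1 b])
  have t3: "test_function \<Omega> (partial b \<zeta>)" by (rule test_function_partial[OF \<zeta> b])
  note sq = test_function_sq_integrable[OF fin]
  have pw: "e x * partial b \<Psi> x - partial b \<zeta> x * partial b \<Psi> x \<le> (e x)\<^sup>2 / 4" for x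
  proof -
    obtain \<gamma> where \<gamma>: "(soft_pos \<epsilon> has_real_derivative \<gamma>) (at (\<zeta> x))" "0 \<le> \<gamma>" "\<gamma> \<le> 1"
      by (rule soft_pos_deriv[OF \<epsilon>])
    have "(\<Psi> has_derivative (\<lambda>h. \<gamma> * frechet_derivative \<zeta> (at x) h)) (at x)"
      unfolding \<Psi>_def[abs_def]
      using has_derivative_compose[OF smooth_has_derivative[OF test_function_smooth[OF \<zeta>]]
          \<gamma>(1)[unfolded has_field_derivative_def]] .
    then have p: "partial b \<Psi> x = \<gamma> * partial b \<zeta> x" by (rule partial_unique)
    have "e x * partial b \<Psi> x - partial b \<zeta> x * partial b \<Psi> x
        = \<gamma> * ((e x)\<^sup>2 / 4 - (e x / 2 - partial b \<zeta> x)\<^sup>2)"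
      unfolding p by (simp add: power2_eq_square algebra_simps)
    also have "\<dots> \<le> \<gamma> * ((e x)\<^sup>2 / 4)" using \<gamma> by (intro mult_left_mono) auto
    also have "\<dots> \<le> (e x)\<^sup>2 / 4" using \<gamma> by (intro mult_left_le_one_le) auto
    finally show ?thesis .
  qed
  have i: "integrable ?M (\<lambda>x. \<zeta> x * partial b (partial b \<Psi>) x)"
     "integrable ?M (\<lambda>x. (\<zeta> x - w x) * partial b (partial b \<Psi>) x)"
     "integrable ?M (\<lambda>x. e x * partial b \<Psi> x)" "integrable ?M (\<lambda>x. partial b \<zeta> x * partial b \<Psi> x)"
    by (intro sq_integrable_mult sq_integrable_diff sq \<zeta> t1 t2 t3 w e)+
  have "(LINT x|?M. L x * \<Psi> x) = (LINT x|?M. w x * partial b (partial b \<Psi>) x)"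
    using L(2) \<Psi> by (simp add: is_weak_deriv_def)
  also have "\<dots> = (LINT x|?M. \<zeta> x * partial b (partial b \<Psi>) x - (\<zeta> x - w x) * partial b (partial b \<Psi>) x)"
    by (simp add: algebra_simps)
  also have "\<dots> = (LINT x|?M. \<zeta> x * partial b (partial b \<Psi>) x)
                 - (LINT x|?M. (\<zeta> x - w x) * partial b (partial b \<Psi>) x)"
    by (rule Bochner_Integration.integral_diff[OF i(1,2)])
  also have "(LINT x|?M. \<zeta> x * partial b (partial b \<Psi>) x) = - (LINT x|?M. partial b \<zeta> x * partial b \<Psi> x)"
    by (rule integration_by_parts_test[OF \<Omega>s fin \<zeta> t1 b])
  also have "(LINT x|?M. (\<zeta> x - w x) * partial b (partial b \<Psi>) x) = - (LINT x|?M. e x * partial b \<Psi> x)"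
    using e(2) t1 by (simp add: is_weak_deriv_def)
  also have "- (LINT x|?M. partial b \<zeta> x * partial b \<Psi> x) - - (LINT x|?M. e x * partial b \<Psi> x)
      = (LINT x|?M. e x * partial b \<Psi> x - partial b \<zeta> x * partial b \<Psi> x)"
    using Bochner_Integration.integral_diff[OF i(3,4)] by simp
  also have "\<dots> \<le> (LINT x|?M. (e x)\<^sup>2 / 4)"
    using pw i(3,4) sq_integrable_square[OF e(1)] by (intro integral_mono) auto
  also have "\<dots> = (l2_norm ?M e)\<^sup>2 / 4" by (simp add: l2_norm_sq)
  finally show ?thesis by (simp add: \<Psi>_def)
qed

text \<open>This is \<open>\<integral> \<Delta>w w\<^sup>+ = - \<integral> \<bar>\<nabla>w\<^sup>+\<bar>\<^sup>2 \<le> 0\<close> for \<open>w = f - g\<close>, as a limit of \<open>laplacian_soft_pos_le\<close>. The function \<open>L\<close> is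
  a measurable representative of the Laplacian of \<open>w\<close>.\<close>

lemma laplacian_diff_pos_part:
  fixes \<Omega> :: "'a::euclidean_space set"
  assumes \<Omega>: "open \<Omega>" "bounded \<Omega>"
    and f: "f \<in> elts (H10 \<Omega>)" "is_laplacian \<Omega> f lf"
    and g: "g \<in> elts (H10 \<Omega>)" "is_laplacian \<Omega> g lg"
  obtains L where "L \<in> sq_integrable (lebesgue_on \<Omega>)" "AE x in lebesgue_on \<Omega>. L x = lf x - lg x"
    "(LINT x|lebesgue_on \<Omega>. L x * max (f x - g x) 0) \<le> 0"
proof -
  let ?M = "lebesgue_on \<Omega>"
  have \<Omega>s: "\<Omega> \<in> sets lebesgue" using \<Omega>(1) by auto
  have fin: "finite_measure ?M" using \<Omega> by (rule finite_measure_lebesgue_on)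
  have fs: "f \<in> sq_integrable ?M" and gs: "g \<in> sq_integrable ?M"
    using f(1) g(1) by (auto simp: H10_def intro: Hk_sq_integrable)
  define w where "w x = f x - g x" for x
  have w: "w \<in> sq_integrable ?M" unfolding w_def[abs_def] by (rule sq_integrable_diff[OF fs gs])
  define l where "l b x = weak_deriv \<Omega> [b, b] f x - weak_deriv \<Omega> [b, b] g x" for b x
  have f2: "f \<in> elts (Hk 2 \<Omega>)" and g2: "g \<in> elts (Hk 2 \<Omega>)"
    using f(2) g(2) by (auto simp: is_laplacian_def)
  have l: "l b \<in> sq_integrable ?M" "is_weak_deriv \<Omega> [b, b] w (l b)" if b: "b \<in> Basis" for b
  proof -
    have bb: "[b, b] \<in> multi_indices 2" using b by (simp add: multi_indices_def)
    show "l b \<in> sq_integrable ?M" unfolding l_def[abs_def]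
      by (intro sq_integrable_diff weak_deriv_in_Hk[OF f2 bb] weak_deriv_in_Hk[OF g2 bb])
    show "is_weak_deriv \<Omega> [b, b] w (l b)" unfolding l_def[abs_def] w_def[abs_def]
      using b by (intro is_weak_deriv_diff fin fs gs weak_deriv_in_Hk[OF f2 bb] weak_deriv_in_Hk[OF g2 bb]) auto
  qed
  define L where "L x = (\<Sum>b\<in>Basis. l b x)" for x
  have sum_sq: "(\<lambda>x. \<Sum>b\<in>B. l b x) \<in> sq_integrable ?M" if "finite B" "B \<subseteq> Basis" for B
    using that
  proof (induction B)
    case empty then show ?case using sq_integrable_const[OF fin, of 0] by simp
  next
    case (insert b B) then show ?case using sq_integrable_add[OF l(1)[of b]] by simp
  qed
  have L: "L \<in> sq_integrable ?M" unfolding L_def[abs_def] by (rule sum_sq) auto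
  obtain \<phi> ef where \<phi>: "\<And>n::nat. test_function \<Omega> (\<phi> n)" "(\<lambda>n. l2_norm ?M (\<lambda>x. \<phi> n x - f x)) \<longlonglongrightarrow> 0"
    "\<And>n b. b \<in> Basis \<Longrightarrow> ef n b \<in> sq_integrable ?M"
    "\<And>n b. b \<in> Basis \<Longrightarrow> is_weak_deriv \<Omega> [b] (\<lambda>x. \<phi> n x - f x) (ef n b)"
    "\<And>b. b \<in> Basis \<Longrightarrow> (\<lambda>n. l2_norm ?M (ef n b)) \<longlonglongrightarrow> 0"
    by (rule H10_approximation[OF \<Omega> f(1)]) blast
  obtain \<psi> eg where \<psi>: "\<And>n::nat. test_function \<Omega> (\<psi> n)" "(\<lambda>n. l2_norm ?M (\<lambda>x. \<psi> n x - g x)) \<longlonglongrightarrow> 0"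
    "\<And>n b. b \<in> Basis \<Longrightarrow> eg n b \<in> sq_integrable ?M"
    "\<And>n b. b \<in> Basis \<Longrightarrow> is_weak_deriv \<Omega> [b] (\<lambda>x. \<psi> n x - g x) (eg n b)"
    "\<And>b. b \<in> Basis \<Longrightarrow> (\<lambda>n. l2_norm ?M (eg n b)) \<longlonglongrightarrow> 0"
    by (rule H10_approximation[OF \<Omega> g(1)]) blast
  note sq = test_function_sq_integrable[OF fin]
  note fr = sq_integrable_diff[OF sq[OF \<phi>(1)] fs] and gr = sq_integrable_diff[OF sq[OF \<psi>(1)] gs]
  define \<zeta> where "\<zeta> n x = \<phi> n x - \<psi> n x" for n x
  define e where "e n b x = ef n b x - eg n b x" for n b x
  define \<epsilon> where "\<epsilon> n = inverse (real (Suc n))" for n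
  have \<epsilon>: "\<epsilon> n > 0" for n by (simp add: \<epsilon>_def)
  have \<epsilon>0: "\<epsilon> \<longlonglongrightarrow> 0" unfolding \<epsilon>_def[abs_def] by (rule LIMSEQ_inverse_real_of_nat)
  have \<zeta>: "test_function \<Omega> (\<zeta> n)" for n
    unfolding \<zeta>_def[abs_def] by (rule test_function_diff[OF \<phi>(1) \<psi>(1)])
  have \<zeta>w: "(\<lambda>x. \<zeta> n x - w x) = (\<lambda>x. (\<phi> n x - f x) - (\<psi> n x - g x))" for n
    by (simp add: \<zeta>_def w_def fun_eq_iff)
  have \<zeta>0: "(\<lambda>n. l2_norm ?M (\<lambda>x. \<zeta> n x - w x)) \<longlonglongrightarrow> 0"
  proof (rule tendsto_sandwich[OF _ _ tendsto_const])
    show "(\<lambda>n. l2_norm ?M (\<lambda>x. \<phi> n x - f x) + l2_norm ?M (\<lambda>x. \<psi> n x - g x)) \<longlonglongrightarrow> 0"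
      using tendsto_add[OF \<phi>(2) \<psi>(2)] by simp
  qed (auto simp: \<zeta>w intro!: always_eventually l2_norm_triangle_diff fr gr)
  have e: "e n b \<in> sq_integrable ?M" "is_weak_deriv \<Omega> [b] (\<lambda>x. \<zeta> n x - w x) (e n b)"
    if b: "b \<in> Basis" for n b
    unfolding e_def[abs_def] \<zeta>w using b
    by (intro sq_integrable_diff \<phi>(3) \<psi>(3) is_weak_deriv_diff fin fr gr \<phi>(4) \<psi>(4); simp)+
  have e0: "(\<lambda>n. l2_norm ?M (e n b)) \<longlonglongrightarrow> 0" if b: "b \<in> Basis" for b
  proof (rule tendsto_sandwich[OF _ _ tendsto_const])
    show "(\<lambda>n. l2_norm ?M (ef n b) + l2_norm ?M (eg n b)) \<longlonglongrightarrow> 0"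
      using tendsto_add[OF \<phi>(5) \<psi>(5), OF b b] by simp
  qed (auto simp: e_def[abs_def] intro!: always_eventually l2_norm_triangle_diff \<phi>(3)[OF b] \<psi>(3)[OF b])
  define P where "P n x = soft_pos (\<epsilon> n) (\<zeta> n x)" for n x
  have P: "P n \<in> sq_integrable ?M" for n
    unfolding P_def[abs_def] by (intro sq test_function_soft_pos \<zeta> \<epsilon>)
  have wp: "(\<lambda>x. max (w x) 0) \<in> sq_integrable ?M" by (rule sq_integrable_pos_part[OF w])
  have upper: "(LINT x|?M. L x * P n x) \<le> (\<Sum>b\<in>Basis. (l2_norm ?M (e n b))\<^sup>2 / 4)" for n
  proof -
    have "(LINT x|?M. L x * P n x) = (\<Sum>b\<in>Basis. LINT x|?M. l b x * P n x)"
      unfolding L_def sum_distrib_right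
      by (rule Bochner_Integration.integral_sum) (rule sq_integrable_mult[OF l(1) P])
    also have "\<dots> \<le> (\<Sum>b\<in>Basis. (l2_norm ?M (e n b))\<^sup>2 / 4)"
    proof (rule sum_mono)
      fix b :: 'a assume b: "b \<in> Basis"
      show "(LINT x|?M. l b x * P n x) \<le> (l2_norm ?M (e n b))\<^sup>2 / 4"
        unfolding P_def
        by (rule laplacian_soft_pos_le[OF \<Omega> w \<zeta> e(1)[OF b] e(2)[OF b] l(1)[OF b] l(2)[OF b] b \<epsilon>])
    qed
    finally show ?thesis .
  qed
  have up0: "(\<lambda>n. \<Sum>b\<in>(Basis::'a set). (l2_norm ?M (e n b))\<^sup>2 / 4) \<longlonglongrightarrow> 0"
    using tendsto_sum[of Basis "\<lambda>b n. (l2_norm ?M (e n b))\<^sup>2 / 4" "\<lambda>b. 0\<^sup>2 / 4" sequentially]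
      tendsto_divide[OF tendsto_power[OF e0] tendsto_const, of _ 4 2] by simp
  have "(\<lambda>n. (LINT x|?M. L x * P n x) - (LINT x|?M. L x * max (w x) 0)) \<longlonglongrightarrow> 0"
  proof (rule Lim_null_comparison)
    let ?B = "\<lambda>n. l2_norm ?M L * (\<epsilon> n * l2_norm ?M (\<lambda>x. 1) + l2_norm ?M (\<lambda>x. \<zeta> n x - w x))"
    show "?B \<longlonglongrightarrow> 0"
      using tendsto_mult[OF tendsto_const tendsto_add[OF tendsto_mult[OF \<epsilon>0 tendsto_const] \<zeta>0]] by simp
    show "\<forall>\<^sub>F n in sequentially. norm ((LINT x|?M. L x * P n x) - (LINT x|?M. L x * max (w x) 0)) \<le> ?B n"
    proof (rule always_eventually, rule allI)
      fix n
      have "(LINT x|?M. L x * P n x) - (LINT x|?M. L x * max (w x) 0) = (LINT x|?M. L x * (P n x - max (w x) 0))"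
        unfolding right_diff_distrib
        by (rule Bochner_Integration.integral_diff[symmetric]) (intro sq_integrable_mult L P wp)+
      also have "\<bar>\<dots>\<bar> \<le> l2_norm ?M L * l2_norm ?M (\<lambda>x. P n x - max (w x) 0)"
        by (intro l2_Cauchy_Schwarz L sq_integrable_diff P wp)
      also have "\<dots> \<le> ?B n"
      proof (rule mult_left_mono)
        have s1: "(\<lambda>x. \<epsilon> n * 1) \<in> sq_integrable ?M" by (rule sq_integrable_const[OF fin])
        have s2: "(\<lambda>x. \<bar>\<zeta> n x - w x\<bar>) \<in> sq_integrable ?M"
          by (intro sq_integrable_abs sq_integrable_diff sq \<zeta> w)
        have "l2_norm ?M (\<lambda>x. P n x - max (w x) 0) \<le> l2_norm ?M (\<lambda>x. \<epsilon> n * 1 + \<bar>\<zeta> n x - w x\<bar>)"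
        proof (rule sq_integrable_bound(2)[OF sq_integrable_add[OF s1 s2]])
          show "(\<lambda>x. P n x - max (w x) 0) \<in> borel_measurable ?M"
            by (intro sq_integrable_measurable sq_integrable_diff P wp)
          show "AE x in ?M. \<bar>P n x - max (w x) 0\<bar> \<le> \<bar>\<epsilon> n * 1 + \<bar>\<zeta> n x - w x\<bar>\<bar>"
            unfolding P_def using soft_pos_near_pos_part[OF \<epsilon>] \<epsilon>[of n]
            by (intro AE_I2) (simp add: abs_of_nonneg less_imp_le)
        qed
        also have "\<dots> \<le> l2_norm ?M (\<lambda>x. \<epsilon> n * 1) + l2_norm ?M (\<lambda>x. \<bar>\<zeta> n x - w x\<bar>)"
          by (rule l2_norm_triangle[OF s1 s2])
        also have "\<dots> = \<epsilon> n * l2_norm ?M (\<lambda>x. 1) + l2_norm ?M (\<lambda>x. \<zeta> n x - w x)"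
          unfolding l2_norm_scale l2_norm_abs using \<epsilon>[of n] by simp
        finally show "l2_norm ?M (\<lambda>x. P n x - max (w x) 0)
            \<le> \<epsilon> n * l2_norm ?M (\<lambda>x. 1) + l2_norm ?M (\<lambda>x. \<zeta> n x - w x)" .
      qed simp
      finally show "norm ((LINT x|?M. L x * P n x) - (LINT x|?M. L x * max (w x) 0)) \<le> ?B n" by simp
    qed
  qed
  then have "(\<lambda>n. LINT x|?M. L x * P n x) \<longlonglongrightarrow> (LINT x|?M. L x * max (w x) 0)"
    by (simp add: LIM_zero_iff)
  from LIMSEQ_le[OF this up0] have "(LINT x|?M. L x * max (w x) 0) \<le> 0" using upper by blast
  moreover have "AE x in ?M. L x = lf x - lg x"
    using f(2) g(2) unfolding is_laplacian_def
    by (auto elim!: AE_mp simp: L_def l_def sum_subtractf)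
  ultimately show thesis using that[OF L] by (simp add: w_def)
qed

section \<open>Weak derivatives on an interval\<close>

text \<open>A smooth transition from \<open>0\<close> to \<open>1\<close> on \<open>[a, a + 1/n]\<close>, for positive \<open>n\<close>. Its derivative is an approximate identity at \<open>a\<close> from
  the right, and differences of two ramps are test functions approximating indicators of intervals.\<close>

definition ramp :: "nat \<Rightarrow> real \<Rightarrow> real \<Rightarrow> real" where
  "ramp n a t = smooth_step (real n * (t - a))"

lemma smooth_ramp: "smooth (ramp n a)"
proof -
  have "smooth (\<lambda>t::real. smooth_step (real n * (t \<bullet> 1 - a)))"
    by (intro smooth_step_compose smooth_cmult smooth_diff smooth_inner smooth_const)
  then show ?thesis by (simp add: ramp_def[abs_def])
qed

lemma ramp_0: "t \<le> a \<Longrightarrow> ramp n a t = 0"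
  by (simp add: ramp_def smooth_step_le0 mult_nonneg_nonpos)

lemma ramp_1: assumes "n > 0" "t \<ge> a + 1 / real n" shows "ramp n a t = 1"
  unfolding ramp_def by (rule smooth_step_ge1) (use assms in \<open>simp add: field_simps\<close>)

lemma ramp_bounds: "0 \<le> ramp n a t" "ramp n a t \<le> 1"
  by (simp_all add: ramp_def smooth_step_nonneg smooth_step_le1)

lemma ramp_mono: "s \<le> t \<Longrightarrow> ramp n a s \<le> ramp n a t"
  unfolding ramp_def by (intro smooth_step_mono mult_left_mono) auto

lemma smooth_has_real_derivative:
  fixes F :: "real \<Rightarrow> real"
  assumes "smooth F" shows "(F has_real_derivative partial 1 F t) (at t)"
  using smooth_line_derivative[OF assms, of 0 1 t] by simp

lemma deriv_eq_partial: "smooth F \<Longrightarrow> deriv F t = partial 1 F t" for F :: "real \<Rightarrow> real"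
  by (rule DERIV_imp_deriv[OF smooth_has_real_derivative])

lemma ramp_deriv_nonneg: "0 \<le> deriv (ramp n a) t"
  unfolding deriv_eq_partial[OF smooth_ramp]
  by (rule mono_on_imp_deriv_nonneg[OF _ smooth_has_real_derivative[OF smooth_ramp], of UNIV])
     (auto intro!: mono_onI ramp_mono)

lemma ramp_deriv_0:
  assumes "n > 0" "t \<notin> {a..a + 1 / real n}" shows "deriv (ramp n a) t = 0"
proof -
  have "((\<lambda>t. if t < a then 0 else 1) has_real_derivative 0) (at t) \<and>
    (\<forall>\<^sub>F s in nhds t. ramp n a s = (if s < a then 0 else 1))" 
  proof (cases "t < a")
    case True
    have ev: "\<forall>\<^sub>F s in nhds t. s < a" using eventually_nhds_in_open[of "{..<a}" t] True by simp
    have "((\<lambda>t. if t < a then 0 else 1) has_real_derivative 0) (at t)"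
      by (subst DERIV_cong_ev[OF refl _ refl, of _ "\<lambda>_. 0"]) (use ev in \<open>auto elim: eventually_mono\<close>)
    then show ?thesis using ev by (auto elim!: eventually_mono simp: ramp_0)
  next
    case False
    then have t: "t > a + 1 / real n" using assms by auto
    have ev: "\<forall>\<^sub>F s in nhds t. s > a + 1 / real n" using eventually_nhds_in_open[of "{a + 1 / real n<..}" t] t by simp
    have pos: "1 / real n > 0" using assms(1) by simp
    have ev': "\<forall>\<^sub>F s in nhds t. \<not> s < a" using ev by eventually_elim (use pos in linarith)
    have "((\<lambda>t. if t < a then 0 else 1) has_real_derivative 0) (at t)"
      by (subst DERIV_cong_ev[OF refl _ refl, of _ "\<lambda>_. 1"]) (use ev' in \<open>auto elim: eventually_mono\<close>)
    moreover have "\<forall>\<^sub>F s in nhds t. ramp n a s = (if s < a then 0 else 1)"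
      using ev ev' by eventually_elim (simp add: ramp_1[OF assms(1)])
    ultimately show ?thesis by blast
  qed
  then have "(ramp n a has_real_derivative 0) (at t)"
    by (subst DERIV_cong_ev[OF refl _ refl, of _ "\<lambda>t. if t < a then 0 else 1"]) auto
  then show ?thesis by (rule DERIV_imp_deriv)
qed

lemma continuous_ramp_deriv: "continuous_on S (deriv (ramp n a))"
proof -
  have "deriv (ramp n a) = partial 1 (ramp n a)" using deriv_eq_partial[OF smooth_ramp] by auto
  then show ?thesis by (simp add: smooth_continuous smooth_partial smooth_ramp)
qed

lemma integrable_lebesgue_on_continuous_support:
  fixes h :: "real \<Rightarrow> real"
  assumes I: "I \<in> sets lebesgue" and ab: "{a..b} \<subseteq> I" and h: "continuous_on {a..b} h"
    and 0: "\<And>t. t \<in> I \<Longrightarrow> t \<notin> {a..b} \<Longrightarrow> h t = 0"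
  shows "integrable (lebesgue_on I) h" "(LINT t|lebesgue_on I. h t) = integral {a..b} h"
proof -
  have eq: "indicator I t * h t = indicator {a..b} t * h t" for t
    using 0 ab by (auto simp: indicator_def)
  have i: "integrable (lebesgue_on {a..b}) h"
    by (rule absolutely_integrable_imp_integrable[OF absolutely_integrable_continuous_real[OF h]]) auto
  have *: "{a..b} \<in> sets lebesgue" by auto
  show "integrable (lebesgue_on I) h"
    using i I * by (simp add: integrable_restrict_space eq)
  show "(LINT t|lebesgue_on I. h t) = integral {a..b} h"
    using i I * by (simp add: integral_restrict_space eq lebesgue_integral_eq_integral[symmetric])
qed

text \<open>The derivative of the ramp is nonnegative, supported in \<open>[a, a + 1/n]\<close>, and has integral \<open>1\<close>.\<close>

lemma ramp_deriv_integral_tendsto: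
  fixes f :: "real \<Rightarrow> real"
  assumes I: "I \<in> sets lebesgue" and ab: "a < b" "{a..b} \<subseteq> I" and f: "continuous_on {a..b} f"
  shows "\<forall>\<^sub>F n in sequentially. integrable (lebesgue_on I) (\<lambda>t. deriv (ramp n a) t * f t)"
    and "(\<lambda>n. LINT t|lebesgue_on I. deriv (ramp n a) t * f t) \<longlonglongrightarrow> f a"
proof -
  have big: "\<forall>\<^sub>F n in sequentially. n > 0 \<and> 1 / real n < d" if "d > 0" for d :: real
    using order_tendstoD(2)[OF lim_1_over_n that] eventually_gt_at_top[of 0] by eventually_elim simp
  have rep: "integrable (lebesgue_on I) (\<lambda>t. deriv (ramp n a) t * f t)"
      "(LINT t|lebesgue_on I. deriv (ramp n a) t * f t) = integral {a..a + 1 / real n} (\<lambda>t. deriv (ramp n a) t * f t)"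
    if n: "n > 0" "1 / real n < b - a" for n
  proof -
    have sub: "{a..a + 1 / real n} \<subseteq> {a..b}" using n by auto
    have c: "continuous_on {a..a + 1 / real n} (\<lambda>t. deriv (ramp n a) t * f t)"
      by (intro continuous_on_mult continuous_ramp_deriv continuous_on_subset[OF f sub])
    have z: "deriv (ramp n a) t * f t = 0" if "t \<notin> {a..a + 1 / real n}" for t
      using ramp_deriv_0[OF n(1) that] by simp
    show "integrable (lebesgue_on I) (\<lambda>t. deriv (ramp n a) t * f t)"
      "(LINT t|lebesgue_on I. deriv (ramp n a) t * f t) = integral {a..a + 1 / real n} (\<lambda>t. deriv (ramp n a) t * f t)"
      using integrable_lebesgue_on_continuous_support[OF I subset_trans[OF sub ab(2)] c z] by simp_all
  qed
  show "\<forall>\<^sub>F n in sequentially. integrable (lebesgue_on I) (\<lambda>t. deriv (ramp n a) t * f t)"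
    using big[of "b - a"] ab(1) by (auto elim!: eventually_mono intro: rep(1))
  show "(\<lambda>n. LINT t|lebesgue_on I. deriv (ramp n a) t * f t) \<longlonglongrightarrow> f a"
  proof (rule tendstoI)
    fix e :: real assume e: "e > 0"
    have "\<exists>d>0. \<forall>t\<in>{a..b}. dist t a < d \<longrightarrow> dist (f t) (f a) < e / 2"
      using f[unfolded continuous_on_iff, rule_format, of a "e / 2"] ab(1) e by auto
    then obtain d where d: "d > 0" "\<And>t. t \<in> {a..b} \<Longrightarrow> dist t a < d \<Longrightarrow> dist (f t) (f a) < e / 2" by blast
    show "\<forall>\<^sub>F n in sequentially. dist (LINT t|lebesgue_on I. deriv (ramp n a) t * f t) (f a) < e"
      using big[of "b - a", unfolded diff_gt_0_iff_gt, OF ab(1)] big[OF d(1)]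
    proof eventually_elim
      case (elim n)
      let ?S = "{a..a + 1 / real n}" and ?k = "deriv (ramp n a)"
      have le: "a \<le> a + 1 / real n" by simp
      have sub: "?S \<subseteq> {a..b}" using elim by auto
      have "(?k has_integral ramp n a (a + 1 / real n) - ramp n a a) ?S"
      proof (rule fundamental_theorem_of_calculus[OF le])
        fix t
        show "(ramp n a has_vector_derivative ?k t) (at t within ?S)"
          using smooth_has_real_derivative[OF smooth_ramp, of n a t]
          unfolding deriv_eq_partial[OF smooth_ramp]
          by (simp add: has_real_derivative_iff_has_vector_derivative has_vector_derivative_at_within)
      qed
      then have k1: "(?k has_integral 1) ?S" using elim by (simp add: ramp_0 ramp_1)
      have ki: "(\<lambda>t. ?k t * f t) integrable_on ?S"
        by (intro integrable_continuous_real continuous_on_mult continuous_ramp_deriv continuous_on_subset[OF f sub])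
      have kfa: "((\<lambda>t. ?k t * f a) has_integral f a) ?S"
        using has_integral_mult_left[OF k1, of "f a"] by simp
      have "integral ?S (\<lambda>t. ?k t * f t) - f a = integral ?S (\<lambda>t. ?k t * f t - ?k t * f a)"
        unfolding Henstock_Kurzweil_Integration.integral_diff[OF ki has_integral_integrable[OF kfa]]
          integral_unique[OF kfa] ..
      also have "norm \<dots> \<le> integral ?S (\<lambda>t. ?k t * (e / 2))"
      proof (rule integral_norm_bound_integral)
        show "(\<lambda>t. ?k t * f t - ?k t * f a) integrable_on ?S"
          using ki kfa by (intro integrable_diff) auto
        show "(\<lambda>t. ?k t * (e / 2)) integrable_on ?S"
          using has_integral_mult_left[OF k1, of "e / 2"] by blast
        fix t assume t: "t \<in> ?S"
        then have "dist (f t) (f a) < e / 2" using d(2)[of t] sub elim by (auto simp: dist_real_def)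
        then have "?k t * \<bar>f t - f a\<bar> \<le> ?k t * (e / 2)"
          by (intro mult_left_mono ramp_deriv_nonneg) (auto simp: dist_real_def)
        then show "norm (?k t * f t - ?k t * f a) \<le> ?k t * (e / 2)"
          by (simp add: right_diff_distrib[symmetric] abs_mult ramp_deriv_nonneg)
      qed
      also have "\<dots> = e / 2" using integral_unique[OF has_integral_mult_left[OF k1, of "e / 2"]] by (simp only: mult_1)
      finally show ?case using e elim by (simp add: rep(2) dist_real_def)
    qed
  qed
qed

lemma test_function_ramp_diff:
  assumes n: "n > 0" and ab: "a \<le> b" and sub: "{a..b + 1 / real n} \<subseteq> I"
  shows "test_function I (\<lambda>t. ramp n a t - ramp n b t)"
proof (rule test_functionI[OF smooth_diff[OF smooth_ramp smooth_ramp] _ sub])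
  fix t assume t: "t \<notin> {a..b + 1 / real n}"
  show "ramp n a t - ramp n b t = 0"
  proof (cases "t < a")
    case True then show ?thesis using ab by (simp add: ramp_0)
  next
    case False
    then have t': "t \<ge> b + 1 / real n" using t by auto
    then have "t \<ge> a + 1 / real n" using ab by simp
    with t' show ?thesis by (simp add: ramp_1[OF n])
  qed
qed simp

lemma open_contains_enlarged_interval:
  fixes I :: "real set"
  assumes I: "open I" and st: "s \<le> t" "{s..t} \<subseteq> I"
  obtains d where "d > 0" "{s - d..t + d} \<subseteq> I"
proof -
  have "s \<in> I" "t \<in> I" using st by auto
  then obtain d1 d2 where d: "d1 > 0" "ball s d1 \<subseteq> I" "d2 > 0" "ball t d2 \<subseteq> I"
    using I by (metis open_contains_ball)
  have "{s - min d1 d2 / 2..t + min d1 d2 / 2} \<subseteq> I"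
  proof
    fix x assume x: "x \<in> {s - min d1 d2 / 2..t + min d1 d2 / 2}"
    then consider "x \<in> ball s d1" | "x \<in> {s..t}" | "x \<in> ball t d2"
      using d by (auto simp: dist_real_def min_def split: if_splits) linarith+
    then show "x \<in> I" using d st by cases auto
  qed
  then show thesis using that[of "min d1 d2 / 2"] d by auto
qed

lemma eventually_inverse_nat_less:
  assumes "d > (0::real)" obtains N where "\<And>n. n \<ge> N \<Longrightarrow> n > 0 \<and> 1 / real n < d"
proof -
  have "\<forall>\<^sub>F n in sequentially. n > 0 \<and> 1 / real n < d"
    using order_tendstoD(2)[OF lim_1_over_n assms] eventually_gt_at_top[of 0] by eventually_elim simp
  then show thesis using that by (auto simp: eventually_sequentially)
qed

lemma test_function_plateau:
  fixes I :: "real set"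
  assumes I: "open I" and st: "s \<le> t" "{s..t} \<subseteq> I"
  obtains \<phi> where "test_function I \<phi>" "\<And>\<tau>. \<tau> \<in> {s..t} \<Longrightarrow> \<phi> \<tau> = 1"
proof -
  obtain d where d: "d > 0" "{s - d..t + d} \<subseteq> I" by (rule open_contains_enlarged_interval[OF assms])
  obtain N where N: "\<And>n. n \<ge> N \<Longrightarrow> n > 0 \<and> 1 / real n < d" by (rule eventually_inverse_nat_less[OF d(1)]) blast
  show thesis
  proof (rule that)
    show "test_function I (\<lambda>\<tau>. ramp N (s - d) \<tau> - ramp N t \<tau>)"
      using N[of N] st(1) d by (intro test_function_ramp_diff) auto
    show "ramp N (s - d) \<tau> - ramp N t \<tau> = 1" if "\<tau> \<in> {s..t}" for \<tau>
      using that N[of N] by (subst ramp_1) (auto simp: ramp_0)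
  qed
qed

text \<open>Testing with \<open>ramp n s - ramp n t\<close>, which tends to the indicator of \<open>(s, t]\<close>: the left-hand side tends to
  \<open>f s - f t\<close> by continuity of \<open>f\<close>, the right-hand side to \<open>- \<integral> p\<close> by dominated convergence.\<close>

lemma weak_derivative_fundamental_theorem:
  fixes f p :: "real \<Rightarrow> real"
  assumes I: "open I" and st: "s \<le> t" "{s..t} \<subseteq> I" and f: "continuous_on I f"
    and int: "\<And>\<phi>. test_function I \<phi> \<Longrightarrow> integrable (lebesgue_on I) (\<lambda>\<tau>. \<phi> \<tau> * p \<tau>)"
    and weak: "\<And>\<phi>. test_function I \<phi> \<Longrightarrow>
       (LINT \<tau>|lebesgue_on I. deriv \<phi> \<tau> * f \<tau>) = - (LINT \<tau>|lebesgue_on I. \<phi> \<tau> * p \<tau>)"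
  shows "integrable (lebesgue_on {s..t}) p" "(LINT \<tau>|lebesgue_on {s..t}. p \<tau>) = f t - f s"
proof -
  have Is: "I \<in> sets lebesgue" using I by auto
  obtain d where dpos: "d > 0" and sub: "{s - d..t + d} \<subseteq> I"
    by (rule open_contains_enlarged_interval[OF I st])
  obtain N where N: "\<And>n. n \<ge> N \<Longrightarrow> n > 0 \<and> 1 / real n < d / 2"
    by (rule eventually_inverse_nat_less[OF half_gt_zero[OF dpos]]) blast
  let ?J = "lebesgue_on I"
  let ?w = "\<lambda>\<tau>. indicator {s..t + d/2} \<tau> * p \<tau>"
  \<comment> \<open>A test function equal to 1 on a neighbourhood to the right shows local integrability of p.\<close>
  have wi: "integrable ?J ?w"
  proof -
    have "s \<le> t + d/2" "{s..t + d/2} \<subseteq> I" using sub st(1) dpos by auto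
    then obtain \<phi> where \<phi>: "test_function I \<phi>" "\<And>\<tau>. \<tau> \<in> {s..t + d/2} \<Longrightarrow> \<phi> \<tau> = 1"
      by (rule test_function_plateau[OF I]) blast
    from int[OF \<phi>(1)] have "integrable ?J (\<lambda>\<tau>. (\<phi> \<tau> * p \<tau>) * indicator {s..t + d/2} \<tau>)"
      using Is sub dpos by (intro integrable_real_mult_indicator) (auto simp: sets_restrict_space_iff)
    moreover have "(\<lambda>\<tau>. (\<phi> \<tau> * p \<tau>) * indicator {s..t + d/2} \<tau>) = ?w"
      using \<phi>(2) by (auto simp: indicator_def)
    ultimately show ?thesis by simp
  qed
  have pst: "integrable ?J (\<lambda>\<tau>. indicator {s..t} \<tau> * p \<tau>)"
  proof -
    have "integrable ?J (\<lambda>\<tau>. ?w \<tau> * indicator {s..t} \<tau>)"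
      using Is st by (intro integrable_real_mult_indicator wi) (auto simp: sets_restrict_space_iff)
    moreover have "(\<lambda>\<tau>. ?w \<tau> * indicator {s..t} \<tau>) = (\<lambda>\<tau>. indicator {s..t} \<tau> * p \<tau>)"
      using dpos by (auto simp: indicator_def fun_eq_iff)
    ultimately show ?thesis by simp
  qed
  have eqI: "indicator I \<tau> * (indicator {s..t} \<tau> * p \<tau>) = indicator {s..t} \<tau> * p \<tau>" for \<tau>
    using st(2) by (auto simp: indicator_def)
  show "integrable (lebesgue_on {s..t}) p"
    using pst Is by (simp add: integrable_restrict_space eqI)
  have LINT: "(LINT \<tau>|lebesgue_on {s..t}. p \<tau>) = (LINT \<tau>|?J. indicator {s..t} \<tau> * p \<tau>)"
    using Is by (simp add: integral_restrict_space eqI)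
  define \<phi> where "\<phi> n \<tau> = ramp n s \<tau> - ramp n t \<tau>" for n \<tau>
  have \<phi>t: "test_function I (\<phi> n)" if "n \<ge> N" for n
    unfolding \<phi>_def[abs_def] using N[OF that] st(1) sub dpos by (intro test_function_ramp_diff) auto
  have "(\<lambda>n. LINT \<tau>|?J. \<phi> (n + N) \<tau> * p \<tau>) \<longlonglongrightarrow> (LINT \<tau>|?J. indicator {s..t} \<tau> * p \<tau>)"
  proof (rule integral_dominated_convergence[where w = "\<lambda>\<tau>. norm (?w \<tau>)"])
    show "(\<lambda>\<tau>. \<phi> (n + N) \<tau> * p \<tau>) \<in> borel_measurable ?J" for n
      using int[OF \<phi>t[of "n + N"]] by auto
    show "AE \<tau> in ?J. norm (\<phi> (n + N) \<tau> * p \<tau>) \<le> norm (?w \<tau>)" for n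
    proof (rule AE_I2)
      fix \<tau>
      have n: "n + N > 0" "1 / real (n + N) < d / 2" using N[of "n + N"] by auto
      show "norm (\<phi> (n + N) \<tau> * p \<tau>) \<le> norm (?w \<tau>)"
      proof (cases "\<tau> \<in> {s..t + d/2}")
        case True
        have "\<bar>\<phi> (n + N) \<tau>\<bar> \<le> 1"
          using ramp_bounds[of "n + N" s \<tau>] ramp_bounds[of "n + N" t \<tau>] by (simp add: \<phi>_def abs_le_iff)
        then show ?thesis using True by (simp add: abs_mult mult_left_le_one_le)
      next
        case False
        have "\<phi> (n + N) \<tau> = 0"
        proof (cases "\<tau> < s")
          case True then show ?thesis using st by (simp add: \<phi>_def ramp_0)
        next
          case F: False
          then have "\<tau> \<ge> t + 1 / real (n + N)" "\<tau> \<ge> s + 1 / real (n + N)" using False n(2) st(1) by auto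
          then show ?thesis by (simp add: \<phi>_def ramp_1[OF n(1)])
        qed
        then show ?thesis by simp
      qed
    qed
    show "AE \<tau> in ?J. (\<lambda>n. \<phi> (n + N) \<tau> * p \<tau>) \<longlonglongrightarrow> indicator {s..t} \<tau> * p \<tau>"
    proof -
      have r: "(\<lambda>n. ramp (n + N) a \<tau>) \<longlonglongrightarrow> (if \<tau> \<le> a then 0 else 1)" for a \<tau>
      proof (cases "\<tau> \<le> a")
        case True then show ?thesis by (simp add: ramp_0)
      next
        case False
        have "\<forall>\<^sub>F n in sequentially. 1 / real n < \<tau> - a"
          using order_tendstoD(2)[OF lim_1_over_n, of "\<tau> - a"] False by simp
        then have "\<forall>\<^sub>F n in sequentially. 1 / real (n + N) < \<tau> - a" by (rule sequentially_offset)
        then have "\<forall>\<^sub>F n in sequentially. 1 = ramp (n + N) a \<tau>"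
        proof eventually_elim
          case (elim n)
          have "n + N > 0" using N[of "n + N"] by simp
          then show ?case using elim by (simp add: ramp_1)
        qed
        then show ?thesis using False by (auto intro: Lim_transform_eventually[OF tendsto_const])
      qed
      have "AE \<tau> in lebesgue. \<tau> \<noteq> s"
        using AE_not_in[of "{s}" lebesgue] by simp
      then have "AE \<tau> in ?J. \<tau> \<noteq> s" using Is by (simp add: AE_restrict_space_iff) (auto elim: eventually_mono)
      then show ?thesis
      proof eventually_elim
        case (elim \<tau>)
        have "(\<lambda>n. \<phi> (n + N) \<tau> * p \<tau>) \<longlonglongrightarrow> ((if \<tau> \<le> s then 0 else 1) - (if \<tau> \<le> t then 0 else 1)) * p \<tau>"
          unfolding \<phi>_def by (intro tendsto_mult tendsto_diff r tendsto_const)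
        moreover have "((if \<tau> \<le> s then 0 else 1) - (if \<tau> \<le> t then 0 else 1)) = (indicator {s..t} \<tau> :: real)"
          using elim st(1) by (auto simp: indicator_def)
        ultimately show ?case by simp
      qed
    qed
  qed (use wi pst in auto)
  then have lim1: "(\<lambda>n. - (LINT \<tau>|?J. deriv (\<phi> (n + N)) \<tau> * f \<tau>)) \<longlonglongrightarrow> (LINT \<tau>|?J. indicator {s..t} \<tau> * p \<tau>)"
    using weak[OF \<phi>t] by simp
  have fs: "continuous_on {s..s + d} f" "{s..s + d} \<subseteq> I" "continuous_on {t..t + d} f" "{t..t + d} \<subseteq> I"
    using sub st(1) dpos by (auto intro!: continuous_on_subset[OF f])
  note k1 = ramp_deriv_integral_tendsto[OF Is _ fs(2,1)]
  note k2 = ramp_deriv_integral_tendsto[OF Is _ fs(4,3)]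
  have "(\<lambda>n. LINT \<tau>|?J. deriv (\<phi> n) \<tau> * f \<tau>) \<longlonglongrightarrow> f s - f t"
  proof (rule Lim_transform_eventually)
    show "(\<lambda>n. (LINT \<tau>|?J. deriv (ramp n s) \<tau> * f \<tau>) - (LINT \<tau>|?J. deriv (ramp n t) \<tau> * f \<tau>)) \<longlonglongrightarrow> f s - f t"
      using dpos by (intro tendsto_diff k1 k2) auto
    have der: "deriv (\<phi> n) \<tau> = deriv (ramp n s) \<tau> - deriv (ramp n t) \<tau>" for n \<tau>
      unfolding \<phi>_def[abs_def] deriv_eq_partial[OF smooth_ramp]
      by (intro DERIV_imp_deriv DERIV_diff smooth_has_real_derivative smooth_ramp)
    have "\<forall>\<^sub>F n in sequentially. integrable ?J (\<lambda>\<tau>. deriv (ramp n s) \<tau> * f \<tau>)"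
       "\<forall>\<^sub>F n in sequentially. integrable ?J (\<lambda>\<tau>. deriv (ramp n t) \<tau> * f \<tau>)"
      using dpos by (auto intro!: k1(1) k2(1))
    then show "\<forall>\<^sub>F n in sequentially. (LINT \<tau>|?J. deriv (ramp n s) \<tau> * f \<tau>) - (LINT \<tau>|?J. deriv (ramp n t) \<tau> * f \<tau>)
        = (LINT \<tau>|?J. deriv (\<phi> n) \<tau> * f \<tau>)"
      by eventually_elim (simp add: der left_diff_distrib)
  qed
  then have "(\<lambda>n. - (LINT \<tau>|?J. deriv (\<phi> (n + N)) \<tau> * f \<tau>)) \<longlonglongrightarrow> - (f s - f t)"
    by (intro tendsto_minus LIMSEQ_ignore_initial_segment)
  from LIMSEQ_unique[OF lim1 this] show "(LINT \<tau>|lebesgue_on {s..t}. p \<tau>) = f t - f s"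
    by (simp add: LINT)
qed

section \<open>Pairing Bochner integrals with a fixed function\<close>

lemma borel_measurable_lebesgue_on_AE:
  fixes f :: "'a::euclidean_space \<Rightarrow> real"
  assumes S: "S \<in> sets lebesgue" and f: "f \<in> borel_measurable (lebesgue_on S)"
    and ae: "AE x in lebesgue_on S. f x = g x"
  shows "g \<in> borel_measurable (lebesgue_on S)"
proof -
  have "(\<lambda>x. indicator S x *\<^sub>R f x) \<in> borel_measurable lebesgue"
    using f S by (subst (asm) borel_measurable_restrict_space_iff) auto
  moreover have "AE x in lebesgue. indicator S x *\<^sub>R f x = indicator S x *\<^sub>R g x"
    using ae S by (subst (asm) AE_restrict_space_iff) (auto elim!: eventually_mono simp: indicator_def)
  ultimately have "(\<lambda>x. indicator S x *\<^sub>R g x) \<in> borel_measurable lebesgue"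
    by (rule borel_measurable_AE)
  then show ?thesis using S by (subst borel_measurable_restrict_space_iff) auto
qed

text \<open>Lebesgue measure is complete, so an almost everywhere limit is as good as a pointwise one.\<close>

lemma borel_measurable_lebesgue_on_AE_limit:
  fixes f :: "nat \<Rightarrow> 'a::euclidean_space \<Rightarrow> real"
  assumes S: "S \<in> sets lebesgue" and f: "\<And>n. f n \<in> borel_measurable (lebesgue_on S)"
    and ae: "AE x in lebesgue_on S. (\<lambda>n. f n x) \<longlonglongrightarrow> g x"
  shows "g \<in> borel_measurable (lebesgue_on S)"
proof (rule borel_measurable_lebesgue_on_AE[OF S borel_measurable_lim_metric[OF f]])
  show "AE x in lebesgue_on S. lim (\<lambda>n. f n x) = g x"
    using ae by eventually_elim (rule limI)
qed

lemma simple_value_simps [simp]: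
  "simple_value [] t = (\<lambda>x. 0)"
  "simple_value ((A, f) # cs) t = (\<lambda>x. indicator A t * f x + simple_value cs t x)"
  by (simp_all add: simple_value_def fun_eq_iff)

lemma simple_integral_simps [simp]:
  "simple_integral [] = (\<lambda>x. 0)"
  "simple_integral ((A, f) # cs) = (\<lambda>x. measure lebesgue A * f x + simple_integral cs x)"
  by (simp_all add: simple_integral_def fun_eq_iff)

lemma simple_in_simps [simp]:
  "simple_in I X []"
  "simple_in I X ((A, f) # cs) \<longleftrightarrow> A \<in> lmeasurable \<and> A \<subseteq> I \<and> f \<in> elts X \<and> simple_in I X cs"
  by (auto simp: simple_in_def)

lemma integrable_indicator_lebesgue_on:
  assumes "I \<in> sets lebesgue" "A \<in> lmeasurable" "A \<subseteq> I"
  shows "integrable (lebesgue_on I) (indicator A :: real \<Rightarrow> real)"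
    "(LINT t|lebesgue_on I. indicator A t) = measure lebesgue A"
proof -
  have eq: "indicator I t * indicator A t = (indicator A t :: real)" for t :: real
    using assms(3) by (auto simp: indicator_def)
  have A: "A \<in> sets lebesgue" "emeasure lebesgue A < \<infinity>" using assms(2) by (auto simp: fmeasurable_def)
  show "integrable (lebesgue_on I) (indicator A :: real \<Rightarrow> real)"
    using assms(1) integrable_real_indicator[OF A] by (subst integrable_restrict_space) (auto simp: eq)
  show "(LINT t|lebesgue_on I. indicator A t) = measure lebesgue A"
    using assms(1) A by (subst integral_restrict_space) (auto simp: eq)
qed

lemma simple_value_sq_integrable:
  assumes "simple_in I (Lp 2 \<Omega>) cs" "finite_measure (lebesgue_on \<Omega>)"
  shows "simple_value cs t \<in> sq_integrable (lebesgue_on \<Omega>)"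
    "simple_integral cs \<in> sq_integrable (lebesgue_on \<Omega>)"
proof -
  have "simple_value cs t \<in> sq_integrable (lebesgue_on \<Omega>) \<and> simple_integral cs \<in> sq_integrable (lebesgue_on \<Omega>)"
    using assms(1)
  proof (induction cs)
    case Nil then show ?case using sq_integrable_const[OF assms(2), of 0] by simp
  next
    case (Cons c cs) then show ?case
      by (cases c) (auto simp: elts_Lp2 intro!: sq_integrable_add sq_integrable_scale)
  qed
  then show "simple_value cs t \<in> sq_integrable (lebesgue_on \<Omega>)"
    "simple_integral cs \<in> sq_integrable (lebesgue_on \<Omega>)" by auto
qed

lemma simple_pairing:
  assumes I: "I \<in> sets lebesgue" and fin: "finite_measure (lebesgue_on \<Omega>)"
    and cs: "simple_in I (Lp 2 \<Omega>) cs" and z: "z \<in> sq_integrable (lebesgue_on \<Omega>)"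
  shows "integrable (lebesgue_on I) (\<lambda>t. LINT x|lebesgue_on \<Omega>. simple_value cs t x * z x)"
    "(LINT t|lebesgue_on I. LINT x|lebesgue_on \<Omega>. simple_value cs t x * z x)
       = (LINT x|lebesgue_on \<Omega>. simple_integral cs x * z x)"
proof -
  let ?M = "lebesgue_on \<Omega>"
  have "integrable (lebesgue_on I) (\<lambda>t. LINT x|?M. simple_value cs t x * z x) \<and>
    (LINT t|lebesgue_on I. LINT x|?M. simple_value cs t x * z x) = (LINT x|?M. simple_integral cs x * z x)"
    using cs
  proof (induction cs)
    case Nil then show ?case by simp
  next
    case (Cons c cs)
    obtain A f where c: "c = (A, f)" by (cases c)
    have A: "A \<in> lmeasurable" "A \<subseteq> I" and f: "f \<in> sq_integrable ?M" and cs: "simple_in I (Lp 2 \<Omega>) cs"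
      using Cons.prems by (auto simp: c elts_Lp2)
    note IH = Cons.IH[OF cs] and sv = simple_value_sq_integrable[OF cs fin]
    note fz = sq_integrable_mult[OF f z]
    have 1: "(LINT x|?M. simple_value (c # cs) t x * z x)
        = indicator A t * (LINT x|?M. f x * z x) + (LINT x|?M. simple_value cs t x * z x)" for t
      using fz sq_integrable_mult[OF sv(1) z, of t]
      by (simp add: c distrib_right mult.assoc)
    have 2: "(LINT x|?M. simple_integral (c # cs) x * z x)
        = measure lebesgue A * (LINT x|?M. f x * z x) + (LINT x|?M. simple_integral cs x * z x)"
      using fz sq_integrable_mult[OF sv(2) z]
      by (simp add: c distrib_right mult.assoc)
    show ?case unfolding 1 2 using IH integrable_indicator_lebesgue_on[OF I A] by simp
  qed
  then show "integrable (lebesgue_on I) (\<lambda>t. LINT x|?M. simple_value cs t x * z x)"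
    "(LINT t|lebesgue_on I. LINT x|?M. simple_value cs t x * z x) = (LINT x|?M. simple_integral cs x * z x)"
    by auto
qed

text \<open>Measurability comes from expanding the square into pairings of the values with each other; the triangle
  inequality supplies an integrable bound.\<close>

lemma simple_l2_norm_integrable:
  assumes I: "I \<in> sets lebesgue" and fin: "finite_measure (lebesgue_on \<Omega>)"
    and cs: "simple_in I (Lp 2 \<Omega>) cs"
  shows "integrable (lebesgue_on I) (\<lambda>t. l2_norm (lebesgue_on \<Omega>) (simple_value cs t))"
proof -
  let ?M = "lebesgue_on \<Omega>"
  note sv = simple_value_sq_integrable[OF _ fin]
  have meas: "(\<lambda>t. LINT x|?M. simple_value cs t x * simple_value ds t x) \<in> borel_measurable (lebesgue_on I)"
    if "simple_in I (Lp 2 \<Omega>) ds" for ds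
    using that
  proof (induction ds)
    case Nil then show ?case by simp
  next
    case (Cons d ds)
    obtain A f where d: "d = (A, f)" by (cases d)
    have A: "A \<in> lmeasurable" "A \<subseteq> I" and f: "f \<in> sq_integrable ?M" and ds: "simple_in I (Lp 2 \<Omega>) ds"
      using Cons.prems by (auto simp: d elts_Lp2)
    have 1: "(LINT x|?M. simple_value cs t x * simple_value (d # ds) t x)
        = indicator A t * (LINT x|?M. simple_value cs t x * f x)
          + (LINT x|?M. simple_value cs t x * simple_value ds t x)" for t
    proof -
      have "(LINT x|?M. simple_value cs t x * simple_value (d # ds) t x)
        = (LINT x|?M. indicator A t * (simple_value cs t x * f x) + simple_value cs t x * simple_value ds t x)"
        by (intro Bochner_Integration.integral_cong) (simp_all add: d algebra_simps)
      also have "\<dots> = indicator A t * (LINT x|?M. simple_value cs t x * f x)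
          + (LINT x|?M. simple_value cs t x * simple_value ds t x)"
        using sq_integrable_mult[OF sv(1)[OF cs] f] sq_integrable_mult[OF sv(1)[OF cs] sv(1)[OF ds]]
        by simp
      finally show ?thesis .
    qed
    show ?case unfolding 1
      using Cons.IH[OF ds] simple_pairing(1)[OF I fin cs f] integrable_indicator_lebesgue_on(1)[OF I A]
      by (intro borel_measurable_add borel_measurable_times) auto
  qed
  have "integrable (lebesgue_on I) (\<lambda>t. \<Sum>(A, f)\<leftarrow>cs. indicator A t * l2_norm ?M f) \<and>
     (\<forall>t. l2_norm ?M (simple_value cs t) \<le> (\<Sum>(A, f)\<leftarrow>cs. indicator A t * l2_norm ?M f))"
    using cs
  proof (induction cs)
    case Nil then show ?case by (simp add: l2_norm_def)
  next
    case (Cons c cs)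
    obtain A f where c: "c = (A, f)" by (cases c)
    have A: "A \<in> lmeasurable" "A \<subseteq> I" and f: "f \<in> sq_integrable ?M" and cs: "simple_in I (Lp 2 \<Omega>) cs"
      using Cons.prems by (auto simp: c elts_Lp2)
    have "l2_norm ?M (simple_value (c # cs) t) \<le> indicator A t * l2_norm ?M f + l2_norm ?M (simple_value cs t)" for t
      using l2_norm_triangle[OF sq_integrable_scale[OF f, of "indicator A t"] sv(1)[OF cs, of t]]
      by (simp add: c l2_norm_scale)
    moreover have "indicator A t * l2_norm ?M f + l2_norm ?M (simple_value cs t)
        \<le> indicator A t * l2_norm ?M f + (\<Sum>(A, f)\<leftarrow>cs. indicator A t * l2_norm ?M f)" for t
      using Cons.IH[OF cs] by simp
    ultimately have "l2_norm ?M (simple_value (c # cs) t) \<le> (\<Sum>(A, f)\<leftarrow>c # cs. indicator A t * l2_norm ?M f)" for t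
      unfolding c list.map sum_list.Cons prod.case by (rule order_trans)
    then show ?case
      using Cons.IH[OF cs] integrable_indicator_lebesgue_on(1)[OF I A] by (simp add: c)
  qed
  then show ?thesis
  proof (elim conjE, rule_tac Bochner_Integration.integrable_bound)
    show "(\<lambda>t. l2_norm ?M (simple_value cs t)) \<in> borel_measurable (lebesgue_on I)"
      unfolding l2_norm_def power2_eq_square using meas[OF cs] by simp
  qed (auto intro!: AE_I2 intro: order_trans abs_ge_self)
qed

lemma strongly_measurable_AE_sq_integrable:
  assumes "strongly_measurable I (Lp 2 \<Omega>) F"
  shows "AE t in lebesgue_on I. F t \<in> sq_integrable (lebesgue_on \<Omega>)"
  using assms by (simp add: strongly_measurable_def elts_Lp2)

lemma l2_pairing_diff_le:
  assumes f: "f \<in> sq_integrable M" and g: "g \<in> sq_integrable M" and z: "z \<in> sq_integrable M"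
  shows "\<bar>(LINT x|M. f x * z x) - (LINT x|M. g x * z x)\<bar> \<le> l2_norm M (\<lambda>x. f x - g x) * l2_norm M z"
  using l2_Cauchy_Schwarz[OF sq_integrable_diff[OF f g] z] sq_integrable_mult[OF f z] sq_integrable_mult[OF g z]
  by (simp add: left_diff_distrib)

lemma l2_pairing_tendsto:
  assumes f: "\<And>n. f n \<in> sq_integrable M" and g: "g \<in> sq_integrable M" and z: "z \<in> sq_integrable M"
    and lim: "((\<lambda>n. l2_norm M (\<lambda>x. f n x - g x)) \<longlongrightarrow> 0) N"
  shows "((\<lambda>n. LINT x|M. f n x * z x) \<longlongrightarrow> (LINT x|M. g x * z x)) N"
proof -
  have "((\<lambda>n. (LINT x|M. f n x * z x) - (LINT x|M. g x * z x)) \<longlongrightarrow> 0) N"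
  proof (rule Lim_null_comparison)
    show "((\<lambda>n. l2_norm M (\<lambda>x. f n x - g x) * l2_norm M z) \<longlongrightarrow> 0) N"
      using tendsto_mult[OF lim tendsto_const] by simp
  qed (simp add: l2_pairing_diff_le[OF f g z])
  then show ?thesis by (simp add: LIM_zero_iff)
qed

lemma strongly_measurable_norm_pairing:
  assumes I: "I \<in> sets lebesgue" and fin: "finite_measure (lebesgue_on \<Omega>)"
    and F: "strongly_measurable I (Lp 2 \<Omega>) F"
  shows "(\<lambda>t. l2_norm (lebesgue_on \<Omega>) (F t)) \<in> borel_measurable (lebesgue_on I)"
    and "z \<in> sq_integrable (lebesgue_on \<Omega>) \<Longrightarrow>
      (\<lambda>t. LINT x|lebesgue_on \<Omega>. F t x * z x) \<in> borel_measurable (lebesgue_on I)"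
proof -
  let ?M = "lebesgue_on \<Omega>"
  from F obtain s where s: "\<And>n::nat. simple_in I (Lp 2 \<Omega>) (s n)"
    and lim: "AE t in lebesgue_on I. (\<lambda>n. l2_norm ?M (\<lambda>x. F t x - simple_value (s n) t x)) \<longlonglongrightarrow> 0"
    by (auto simp: strongly_measurable_def nrm_Lp2)
  note sv = simple_value_sq_integrable(1)[OF s fin]
  note ae = strongly_measurable_AE_sq_integrable[OF F]
  show "(\<lambda>t. l2_norm ?M (F t)) \<in> borel_measurable (lebesgue_on I)"
  proof (rule borel_measurable_lebesgue_on_AE_limit[OF I])
    show "(\<lambda>t. l2_norm ?M (simple_value (s n) t)) \<in> borel_measurable (lebesgue_on I)" for n
      using simple_l2_norm_integrable[OF I fin s] by auto
    show "AE t in lebesgue_on I. (\<lambda>n. l2_norm ?M (simple_value (s n) t)) \<longlonglongrightarrow> l2_norm ?M (F t)"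
      using lim ae
    proof eventually_elim
      case (elim t)
      have "(\<lambda>n. l2_norm ?M (simple_value (s n) t) - l2_norm ?M (F t)) \<longlonglongrightarrow> 0"
        by (rule Lim_null_comparison[OF _ elim(1)])
           (use l2_norm_diff_abs_le[OF sv elim(2)] in \<open>simp add: l2_norm_minus_commute[of _ "F t"]\<close>)
      then show ?case by (simp add: LIM_zero_iff)
    qed
  qed
  assume z: "z \<in> sq_integrable ?M"
  show "(\<lambda>t. LINT x|?M. F t x * z x) \<in> borel_measurable (lebesgue_on I)"
  proof (rule borel_measurable_lebesgue_on_AE_limit[OF I])
    show "(\<lambda>t. LINT x|?M. simple_value (s n) t x * z x) \<in> borel_measurable (lebesgue_on I)" for n
      using simple_pairing(1)[OF I fin s z] by auto
    show "AE t in lebesgue_on I. (\<lambda>n. LINT x|?M. simple_value (s n) t x * z x) \<longlonglongrightarrow> (LINT x|?M. F t x * z x)"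
      using lim ae
    proof eventually_elim
      case (elim t)
      show ?case
        by (rule l2_pairing_tendsto[OF sv elim(2) z]) (use elim(1) in \<open>simp add: l2_norm_minus_commute[of _ "F t"]\<close>)
    qed
  qed
qed

text \<open>Integration of simple functions commutes with the pairing by linearity, and the Cauchy-Schwarz
  inequality carries this over to the limits that define the Bochner integral.\<close>

lemma bochner_pairing:
  assumes I: "I \<in> sets lebesgue" and fin: "finite_measure (lebesgue_on \<Omega>)"
    and F: "is_bochner_integral I (Lp 2 \<Omega>) F g"
  shows "AE t in lebesgue_on I. F t \<in> sq_integrable (lebesgue_on \<Omega>)"
    and "integrable (lebesgue_on I) (\<lambda>t. l2_norm (lebesgue_on \<Omega>) (F t))"
    and "z \<in> sq_integrable (lebesgue_on \<Omega>) \<Longrightarrow>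
      integrable (lebesgue_on I) (\<lambda>t. LINT x|lebesgue_on \<Omega>. F t x * z x)"
    and "z \<in> sq_integrable (lebesgue_on \<Omega>) \<Longrightarrow>
      (LINT t|lebesgue_on I. LINT x|lebesgue_on \<Omega>. F t x * z x) = (LINT x|lebesgue_on \<Omega>. g x * z x)"
proof -
  let ?M = "lebesgue_on \<Omega>" and ?J = "lebesgue_on I"
  have sm: "strongly_measurable I (Lp 2 \<Omega>) F" and g: "g \<in> sq_integrable ?M"
    using F by (auto simp: is_bochner_integral_def elts_Lp2)
  from F obtain s where s: "\<And>n::nat. simple_in I (Lp 2 \<Omega>) (s n)"
    and int: "\<And>n. integrable ?J (\<lambda>t. l2_norm ?M (\<lambda>x. F t x - simple_value (s n) t x))"
    and lim: "(\<lambda>n. LINT t|?J. l2_norm ?M (\<lambda>x. F t x - simple_value (s n) t x)) \<longlonglongrightarrow> 0"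
    and glim: "(\<lambda>n. l2_norm ?M (\<lambda>x. simple_integral (s n) x - g x)) \<longlonglongrightarrow> 0"
    by (auto simp: is_bochner_integral_def nrm_Lp2)
  note sv = simple_value_sq_integrable[OF s fin]
  note ae = strongly_measurable_AE_sq_integrable[OF sm]
  show "AE t in ?J. F t \<in> sq_integrable ?M" by (rule ae)
  show ni: "integrable ?J (\<lambda>t. l2_norm ?M (F t))"
  proof (rule Bochner_Integration.integrable_bound)
    show "integrable ?J (\<lambda>t. l2_norm ?M (\<lambda>x. F t x - simple_value (s 0) t x) + l2_norm ?M (simple_value (s 0) t))"
      by (intro Bochner_Integration.integrable_add int simple_l2_norm_integrable[OF I fin s])
    show "(\<lambda>t. l2_norm ?M (F t)) \<in> borel_measurable ?J" by (rule strongly_measurable_norm_pairing(1)[OF I fin sm])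
    show "AE t in ?J. norm (l2_norm ?M (F t))
        \<le> norm (l2_norm ?M (\<lambda>x. F t x - simple_value (s 0) t x) + l2_norm ?M (simple_value (s 0) t))"
      using ae
    proof eventually_elim
      case (elim t)
      show ?case using l2_norm_triangle[OF sq_integrable_diff[OF elim sv(1)[of 0 t]] sv(1)[of 0 t]] by simp
    qed
  qed
  assume z: "z \<in> sq_integrable ?M"
  show pi: "integrable ?J (\<lambda>t. LINT x|?M. F t x * z x)"
  proof (rule Bochner_Integration.integrable_bound)
    show "integrable ?J (\<lambda>t. l2_norm ?M (F t) * l2_norm ?M z)" using ni by simp
    show "(\<lambda>t. LINT x|?M. F t x * z x) \<in> borel_measurable ?J" by (rule strongly_measurable_norm_pairing(2)[OF I fin sm z])
    show "AE t in ?J. norm (LINT x|?M. F t x * z x) \<le> norm (l2_norm ?M (F t) * l2_norm ?M z)"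
      using ae by eventually_elim (simp add: l2_Cauchy_Schwarz[OF _ z])
  qed
  have "(\<lambda>n. (LINT x|?M. simple_integral (s n) x * z x) - (LINT t|?J. LINT x|?M. F t x * z x)) \<longlonglongrightarrow> 0"
  proof (rule Lim_null_comparison)
    show "(\<lambda>n. (LINT t|?J. l2_norm ?M (\<lambda>x. F t x - simple_value (s n) t x)) * l2_norm ?M z) \<longlonglongrightarrow> 0"
      using tendsto_mult[OF lim tendsto_const] by simp
    have "norm ((LINT x|?M. simple_integral (s n) x * z x) - (LINT t|?J. LINT x|?M. F t x * z x))
       \<le> (LINT t|?J. l2_norm ?M (\<lambda>x. F t x - simple_value (s n) t x)) * l2_norm ?M z" for n
    proof -
      have "(LINT x|?M. simple_integral (s n) x * z x) - (LINT t|?J. LINT x|?M. F t x * z x)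
        = (LINT t|?J. (LINT x|?M. simple_value (s n) t x * z x) - (LINT x|?M. F t x * z x))"
        using simple_pairing[OF I fin s z, of n] pi by simp
      also have "norm \<dots> \<le> (LINT t|?J. l2_norm ?M (\<lambda>x. F t x - simple_value (s n) t x) * l2_norm ?M z)"
      proof (rule order_trans[OF integral_norm_bound integral_mono_AE])
        show "AE t in ?J. norm ((LINT x|?M. simple_value (s n) t x * z x) - (LINT x|?M. F t x * z x))
            \<le> l2_norm ?M (\<lambda>x. F t x - simple_value (s n) t x) * l2_norm ?M z"
          using ae
        proof eventually_elim
          case (elim t)
          show ?case using l2_pairing_diff_le[OF elim sv(1)[of n t] z] by (simp add: abs_minus_commute)
        qed
      qed (use simple_pairing(1)[OF I fin s z, of n] pi int[of n] in auto)
      finally show ?thesis by simp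
    qed
    then show "\<forall>\<^sub>F n in sequentially. norm ((LINT x|?M. simple_integral (s n) x * z x) - (LINT t|?J. LINT x|?M. F t x * z x))
       \<le> (LINT t|?J. l2_norm ?M (\<lambda>x. F t x - simple_value (s n) t x)) * l2_norm ?M z"
      by (intro always_eventually allI)
  qed
  then have "(\<lambda>n. LINT x|?M. simple_integral (s n) x * z x) \<longlonglongrightarrow> (LINT t|?J. LINT x|?M. F t x * z x)"
    by (simp add: LIM_zero_iff)
  moreover have "(\<lambda>n. LINT x|?M. simple_integral (s n) x * z x) \<longlonglongrightarrow> (LINT x|?M. g x * z x)"
    by (rule l2_pairing_tendsto[OF sv(2) g z glim])
  ultimately show "(LINT t|?J. LINT x|?M. F t x * z x) = (LINT x|?M. g x * z x)"
    by (rule LIMSEQ_unique)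
qed

lemma integrable_lebesgue_on_subset:
  fixes g :: "'a::euclidean_space \<Rightarrow> real"
  assumes "integrable (lebesgue_on I) g" "S \<subseteq> I" "S \<in> sets lebesgue" "I \<in> sets lebesgue"
  shows "integrable (lebesgue_on S) g"
proof -
  have "integrable lebesgue (\<lambda>x. (indicator I x * g x) * indicator S x)"
    using assms by (intro integrable_real_mult_indicator) (auto simp: integrable_restrict_space)
  moreover have "(\<lambda>x. (indicator I x * g x) * indicator S x) = (\<lambda>x. indicator S x * g x)"
    using assms(2) by (auto simp: indicator_def fun_eq_iff)
  ultimately show ?thesis using assms(3) by (simp add: integrable_restrict_space)
qed

lemma AE_lebesgue_on_subset:
  assumes "AE x in lebesgue_on I. P x" "S \<subseteq> I" "S \<in> sets lebesgue" "I \<in> sets lebesgue"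
  shows "AE x in lebesgue_on S. P x"
  using assms by (simp add: AE_restrict_space_iff) (auto elim: eventually_mono)

text \<open>Pairing the vector-valued definition of \<open>u\<^sub>t\<close> with \<open>z\<close> makes \<open>\<langle>u\<^sub>t, z\<rangle>\<close> the weak derivative of the
  continuous scalar function \<open>\<langle>u, z\<rangle>\<close>. A test function equal to \<open>1\<close> on \<open>[s, t]\<close> gives integrability of \<open>\<parallel>u\<^sub>t\<parallel>\<close>
  there.\<close>

lemma time_deriv_pairing:
  assumes \<Omega>: "open \<Omega>" "bounded \<Omega>" and I: "open I"
    and der: "is_time_deriv I (Lp 2 \<Omega>) u ut"
    and u: "\<forall>t\<in>I. u t \<in> sq_integrable (lebesgue_on \<Omega>)"
    and cont: "\<forall>t\<in>I. ((\<lambda>s. l2_norm (lebesgue_on \<Omega>) (\<lambda>x. u s x - u t x)) \<longlongrightarrow> 0) (at t within I)"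
    and st: "s \<le> t" "{s..t} \<subseteq> I"
  shows "AE \<tau> in lebesgue_on {s..t}. ut \<tau> \<in> sq_integrable (lebesgue_on \<Omega>)"
    and "integrable (lebesgue_on {s..t}) (\<lambda>\<tau>. l2_norm (lebesgue_on \<Omega>) (ut \<tau>))"
    and "z \<in> sq_integrable (lebesgue_on \<Omega>) \<Longrightarrow>
      integrable (lebesgue_on {s..t}) (\<lambda>\<tau>. LINT x|lebesgue_on \<Omega>. ut \<tau> x * z x)"
    and "z \<in> sq_integrable (lebesgue_on \<Omega>) \<Longrightarrow>
      (LINT \<tau>|lebesgue_on {s..t}. LINT x|lebesgue_on \<Omega>. ut \<tau> x * z x)
        = (LINT x|lebesgue_on \<Omega>. u t x * z x) - (LINT x|lebesgue_on \<Omega>. u s x * z x)"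
proof -
  let ?M = "lebesgue_on \<Omega>"
  have fin: "finite_measure ?M" using \<Omega> by (rule finite_measure_lebesgue_on)
  have Is: "I \<in> sets lebesgue" using I by auto
  obtain \<phi> where \<phi>: "test_function I \<phi>" "\<And>\<tau>. \<tau> \<in> {s..t} \<Longrightarrow> \<phi> \<tau> = 1"
    by (rule test_function_plateau[OF I st]) blast
  obtain g where g: "is_bochner_integral I (Lp 2 \<Omega>) (\<lambda>t x. \<phi> t * ut t x) g"
    using der \<phi>(1) unfolding is_time_deriv_def by blast
  have on: "AE \<tau> in lebesgue_on {s..t}. \<tau> \<in> {s..t}" by (rule AE_I2) simp
  show ae: "AE \<tau> in lebesgue_on {s..t}. ut \<tau> \<in> sq_integrable ?M"
    using AE_lebesgue_on_subset[OF bochner_pairing(1)[OF Is fin g] st(2) _ Is] on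
    by (auto elim!: eventually_elim2 simp: \<phi>(2))
  have "integrable (lebesgue_on {s..t}) (\<lambda>\<tau>. l2_norm ?M (\<lambda>x. \<phi> \<tau> * ut \<tau> x))"
    by (rule integrable_lebesgue_on_subset[OF bochner_pairing(2)[OF Is fin g] st(2) _ Is]) simp
  then show "integrable (lebesgue_on {s..t}) (\<lambda>\<tau>. l2_norm ?M (ut \<tau>))"
    by (rule Bochner_Integration.integrable_cong[THEN iffD1, rotated 2]) (simp_all add: \<phi>(2))
  assume z: "z \<in> sq_integrable ?M"
  let ?f = "\<lambda>\<tau>. LINT x|?M. u \<tau> x * z x" and ?p = "\<lambda>\<tau>. LINT x|?M. ut \<tau> x * z x"
  have f: "continuous_on I ?f"
    unfolding continuous_on_def
  proof
    fix t assume t: "t \<in> I"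
    have ev: "\<forall>\<^sub>F s in at t within I. s \<in> I" by (simp add: eventually_at_filter)
    have "((\<lambda>s. ?f s - ?f t) \<longlongrightarrow> 0) (at t within I)"
    proof (rule Lim_null_comparison)
      show "((\<lambda>s. l2_norm ?M (\<lambda>x. u s x - u t x) * l2_norm ?M z) \<longlongrightarrow> 0) (at t within I)"
        using tendsto_mult[OF bspec[OF cont t] tendsto_const] by simp
      show "\<forall>\<^sub>F s in at t within I. norm (?f s - ?f t) \<le> l2_norm ?M (\<lambda>x. u s x - u t x) * l2_norm ?M z"
        using ev by eventually_elim (simp add: l2_pairing_diff_le bspec[OF u] t z)
    qed
    then show "(?f \<longlongrightarrow> ?f t) (at t within I)" by (simp add: LIM_zero_iff)
  qed
  have int: "integrable (lebesgue_on I) (\<lambda>\<tau>. \<psi> \<tau> * ?p \<tau>)"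
    and weak: "(LINT \<tau>|lebesgue_on I. deriv \<psi> \<tau> * ?f \<tau>) = - (LINT \<tau>|lebesgue_on I. \<psi> \<tau> * ?p \<tau>)"
    if \<psi>: "test_function I \<psi>" for \<psi>
  proof -
    obtain h where h: "is_bochner_integral I (Lp 2 \<Omega>) (\<lambda>t x. deriv \<psi> t * u t x) h"
      "is_bochner_integral I (Lp 2 \<Omega>) (\<lambda>t x. \<psi> t * ut t x) (\<lambda>x. - h x)"
      using der \<psi> unfolding is_time_deriv_def by blast
    show "integrable (lebesgue_on I) (\<lambda>\<tau>. \<psi> \<tau> * ?p \<tau>)"
      using bochner_pairing(3)[OF Is fin h(2) z] by (simp add: mult.assoc)
    show "(LINT \<tau>|lebesgue_on I. deriv \<psi> \<tau> * ?f \<tau>) = - (LINT \<tau>|lebesgue_on I. \<psi> \<tau> * ?p \<tau>)"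
      using bochner_pairing(4)[OF Is fin h(1) z] bochner_pairing(4)[OF Is fin h(2) z]
      by (simp add: mult.assoc)
  qed
  show "integrable (lebesgue_on {s..t}) ?p" "(LINT \<tau>|lebesgue_on {s..t}. ?p \<tau>) = ?f t - ?f s"
    using weak_derivative_fundamental_theorem[OF I st f int weak] by blast+
qed

section \<open>The energy inequality and a Gronwall argument\<close>

lemma l2_pos_part_diff_le:
  assumes "f \<in> sq_integrable M" "g \<in> sq_integrable M"
  shows "l2_norm M (\<lambda>x. max (f x) 0 - max (g x) 0) \<le> l2_norm M (\<lambda>x. f x - g x)"
  using assms
  by (intro sq_integrable_bound(2) sq_integrable_diff sq_integrable_measurable sq_integrable_pos_part) auto

lemma l2_pos_part_continuous:
  assumes w: "\<And>t. t \<in> S \<Longrightarrow> w t \<in> sq_integrable M"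
    and cont: "\<And>t. t \<in> S \<Longrightarrow> ((\<lambda>s. l2_norm M (\<lambda>x. w s x - w t x)) \<longlongrightarrow> 0) (at t within S)"
  shows "continuous_on S (\<lambda>t. l2_norm M (\<lambda>x. max (w t x) 0))"
  unfolding continuous_on_def
proof
  fix t assume t: "t \<in> S"
  let ?N = "\<lambda>t. l2_norm M (\<lambda>x. max (w t x) 0)"
  have lip: "\<bar>?N s - ?N t\<bar> \<le> l2_norm M (\<lambda>x. w s x - w t x)" if "s \<in> S" for s
    using l2_norm_diff_abs_le[OF sq_integrable_pos_part[OF w[OF that]] sq_integrable_pos_part[OF w[OF t]]]
      l2_pos_part_diff_le[OF w[OF that] w[OF t]] by (rule order_trans)
  have "\<forall>\<^sub>F s in at t within S. s \<in> S" by (simp add: eventually_at_filter)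
  then have "\<forall>\<^sub>F s in at t within S. norm (?N s - ?N t) \<le> l2_norm M (\<lambda>x. w s x - w t x)"
    by eventually_elim (simp add: lip)
  then have "((\<lambda>s. ?N s - ?N t) \<longlongrightarrow> 0) (at t within S)"
    by (rule Lim_null_comparison[OF _ cont[OF t]])
  then show "(?N \<longlongrightarrow> ?N t) (at t within S)" by (simp add: LIM_zero_iff)
qed

text \<open>Here \<open>q z \<tau>\<close> stands for \<open>\<langle>w\<^sub>t(\<tau>), z\<rangle>\<close> and \<open>m\<close> for a bound of \<open>\<parallel>w\<^sub>t\<parallel>\<close>. The integrated error \<open>\<epsilon> m\<close>
  of the inequality on short intervals is additive in the interval, hence it survives bisection and disappears with \<open>\<epsilon> \<rightarrow> 0\<close>.\<close>

lemma energy_inequality: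
  fixes w :: "real \<Rightarrow> 'b \<Rightarrow> real" and q :: "('b \<Rightarrow> real) \<Rightarrow> real \<Rightarrow> real"
  assumes ab: "a \<le> b"
    and w: "\<And>\<tau>. \<tau> \<in> {a..b} \<Longrightarrow> w \<tau> \<in> sq_integrable M"
    and cont: "\<And>t. t \<in> {a..b} \<Longrightarrow> ((\<lambda>s. l2_norm M (\<lambda>x. w s x - w t x)) \<longlongrightarrow> 0) (at t within {a..b})"
    and q_int: "\<And>c d z. a \<le> c \<Longrightarrow> c \<le> d \<Longrightarrow> d \<le> b \<Longrightarrow> z \<in> sq_integrable M \<Longrightarrow> integrable (lebesgue_on {c..d}) (q z)"
    and q_eq: "\<And>c d z. a \<le> c \<Longrightarrow> c \<le> d \<Longrightarrow> d \<le> b \<Longrightarrow> z \<in> sq_integrable M \<Longrightarrow>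
       (LINT \<tau>|lebesgue_on {c..d}. q z \<tau>) = (LINT x|M. w d x * z x) - (LINT x|M. w c x * z x)"
    and m: "integrable (lebesgue_on {a..b}) m" "\<And>\<tau>. 0 \<le> m \<tau>"
    and q_lip: "AE \<tau> in lebesgue_on {a..b}. \<forall>y\<in>sq_integrable M. \<forall>z\<in>sq_integrable M.
       q y \<tau> - q z \<tau> \<le> m \<tau> * l2_norm M (\<lambda>x. y x - z x)"
    and diss: "AE \<tau> in lebesgue_on {a..b}. q (\<lambda>x. max (w \<tau> x) 0) \<tau> \<le> \<kappa> * (l2_norm M (\<lambda>x. max (w \<tau> x) 0))\<^sup>2"
  shows "(l2_norm M (\<lambda>x. max (w b x) 0))\<^sup>2 - (l2_norm M (\<lambda>x. max (w a x) 0))\<^sup>2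
      \<le> integral {a..b} (\<lambda>\<tau>. 2 * \<kappa> * (l2_norm M (\<lambda>x. max (w \<tau> x) 0))\<^sup>2)"
proof -
  define N where "N \<tau> = l2_norm M (\<lambda>x. max (w \<tau> x) 0)" for \<tau>
  have wp: "(\<lambda>x. max (w \<tau> x) 0) \<in> sq_integrable M" if "\<tau> \<in> {a..b}" for \<tau>
    by (rule sq_integrable_pos_part[OF w[OF that]])
  have N: "continuous_on {a..b} N"
    unfolding N_def[abs_def] by (rule l2_pos_part_continuous[OF w cont])
  then have E: "continuous_on {a..b} (\<lambda>\<tau>. (N \<tau>)\<^sup>2)" by (intro continuous_on_power)
  have Ei: "integrable (lebesgue_on {a..b}) (\<lambda>\<tau>. (N \<tau>)\<^sup>2)"
    by (rule absolutely_integrable_imp_integrable[OF absolutely_integrable_continuous_real[OF E]]) auto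
  have step: "(N d)\<^sup>2 - (N c)\<^sup>2 \<le> integral {c..d} (\<lambda>\<tau>. 2 * (\<kappa> * (N \<tau>)\<^sup>2 + \<epsilon> * m \<tau>))"
    if cd: "a \<le> c" "c \<le> d" "d \<le> b" and small: "\<And>\<tau>. \<tau> \<in> {c..d} \<Longrightarrow> l2_norm M (\<lambda>x. w d x - w \<tau> x) \<le> \<epsilon>" for c d \<epsilon>
  proof -
    have c: "c \<in> {a..b}" and d: "d \<in> {a..b}" and sub: "{c..d} \<subseteq> {a..b}" using cd by auto
    let ?z = "\<lambda>x. max (w d x) 0"
    have i: "integrable M (\<lambda>x. (max (w d x) 0)\<^sup>2)" "integrable M (\<lambda>x. (max (w c x) 0)\<^sup>2)"
      "integrable M (\<lambda>x. w d x * ?z x)" "integrable M (\<lambda>x. w c x * ?z x)"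
      by (intro sq_integrable_square sq_integrable_mult wp w c d)+
    have "(N d)\<^sup>2 - (N c)\<^sup>2 = (LINT x|M. (max (w d x) 0)\<^sup>2 - (max (w c x) 0)\<^sup>2)"
      unfolding N_def l2_norm_sq using i by simp
    also have "\<dots> \<le> (LINT x|M. 2 * (w d x * ?z x - w c x * ?z x))"
    proof (rule integral_mono)
      fix x
      \<comment> \<open>Convexity of the squared positive part, written as a sum of nonnegative terms.\<close>
      have "0 \<le> (max (w d x) 0 - max (w c x) 0)\<^sup>2 + 2 * (max (w c x) 0 - w c x) * max (w d x) 0"
        by (intro add_nonneg_nonneg mult_nonneg_nonneg) auto
      moreover have "w d x * max (w d x) 0 = (max (w d x) 0)\<^sup>2" by (auto simp: max_def power2_eq_square)
      ultimately show "(max (w d x) 0)\<^sup>2 - (max (w c x) 0)\<^sup>2 \<le> 2 * (w d x * ?z x - w c x * ?z x)"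
        by (simp add: power2_diff algebra_simps)
    qed (use i in auto)
    also have "\<dots> = 2 * (LINT \<tau>|lebesgue_on {c..d}. q ?z \<tau>)"
      using i(3,4) q_eq[OF cd wp[OF d]] by simp
    also have "(LINT \<tau>|lebesgue_on {c..d}. q ?z \<tau>) \<le> (LINT \<tau>|lebesgue_on {c..d}. \<kappa> * (N \<tau>)\<^sup>2 + \<epsilon> * m \<tau>)"
    proof (rule integral_mono_AE[OF q_int[OF cd wp[OF d]]])
      show "integrable (lebesgue_on {c..d}) (\<lambda>\<tau>. \<kappa> * (N \<tau>)\<^sup>2 + \<epsilon> * m \<tau>)"
        by (rule integrable_lebesgue_on_subset[OF _ sub]) (use Ei m in auto)
      have on: "AE \<tau> in lebesgue_on {c..d}. \<tau> \<in> {c..d}" by (rule AE_I2) simp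
      have Icc_sets: "{r..s} \<in> sets lebesgue" for r s :: real by simp
      show "AE \<tau> in lebesgue_on {c..d}. q ?z \<tau> \<le> \<kappa> * (N \<tau>)\<^sup>2 + \<epsilon> * m \<tau>"
        using AE_lebesgue_on_subset[OF q_lip sub Icc_sets Icc_sets]
          AE_lebesgue_on_subset[OF diss sub Icc_sets Icc_sets] on
      proof eventually_elim
        case (elim \<tau>)
        then have t: "\<tau> \<in> {c..d}" "\<tau> \<in> {a..b}" using sub by auto
        have "q ?z \<tau> - q (\<lambda>x. max (w \<tau> x) 0) \<tau> \<le> m \<tau> * l2_norm M (\<lambda>x. max (w d x) 0 - max (w \<tau> x) 0)"
          using elim(1) wp[OF d] wp[OF t(2)] by blast
        also have "\<dots> \<le> m \<tau> * \<epsilon>"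
          by (intro mult_left_mono m order_trans[OF l2_pos_part_diff_le[OF w[OF d] w[OF t(2)]] small[OF t(1)]])
        finally show ?case using elim(2) by (simp add: N_def mult.commute)
      qed
    qed
    also have "2 * (LINT \<tau>|lebesgue_on {c..d}. \<kappa> * (N \<tau>)\<^sup>2 + \<epsilon> * m \<tau>)
        = integral {c..d} (\<lambda>\<tau>. 2 * (\<kappa> * (N \<tau>)\<^sup>2 + \<epsilon> * m \<tau>))"
    proof -
      have "integrable (lebesgue_on {c..d}) (\<lambda>\<tau>. \<kappa> * (N \<tau>)\<^sup>2 + \<epsilon> * m \<tau>)"
        by (rule integrable_lebesgue_on_subset[OF _ sub]) (use Ei m in auto)
      then have "integrable (lebesgue_on {c..d}) (\<lambda>\<tau>. 2 * (\<kappa> * (N \<tau>)\<^sup>2 + \<epsilon> * m \<tau>))"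
        by (rule integrable_mult_right)
      from lebesgue_integral_eq_integral[OF this] show ?thesis
        by (simp only: integral_mult_right_zero lmeasurable_cbox fmeasurableD cbox_interval[symmetric])
    qed
    finally show ?thesis by simp
  qed
  have eps: "(N b)\<^sup>2 - (N a)\<^sup>2 \<le> integral {a..b} (\<lambda>\<tau>. 2 * (\<kappa> * (N \<tau>)\<^sup>2 + \<epsilon> * m \<tau>))" if \<epsilon>: "\<epsilon> > 0" for \<epsilon>
  proof -
    let ?f = "\<lambda>\<tau>. 2 * (\<kappa> * (N \<tau>)\<^sup>2 + \<epsilon> * m \<tau>)"
    have fi: "?f integrable_on {a..b}"
      using Ei m by (intro integrable_on_lebesgue_on) auto
    \<comment> \<open>The bisection lemma also asks about intervals that leave [a, b]; the guards make the claim trivial there.\<close>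
    define P where "P c d \<longleftrightarrow> (a \<le> c \<longrightarrow> c \<le> d \<longrightarrow> d \<le> b \<longrightarrow> (N d)\<^sup>2 - (N c)\<^sup>2 \<le> integral {c..d} ?f)" for c d
    have "P a b"
    proof (rule Bolzano[OF ab])
      fix c d e assume P: "P c d" "P d e" "c \<le> d" "d \<le> e"
      show "P c e"
        unfolding P_def
      proof (intro impI)
        assume "a \<le> c" "c \<le> e" "e \<le> b"
        moreover have "?f integrable_on {c..e}"
          by (rule integrable_on_subinterval[OF fi]) (use calculation in auto)
        ultimately show "(N e)\<^sup>2 - (N c)\<^sup>2 \<le> integral {c..e} ?f"
          using P Henstock_Kurzweil_Integration.integral_combine[of c d e ?f] by (simp add: P_def)
      qed
    next
      fix x assume x: "a \<le> x" "x \<le> b"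
      then have "\<forall>\<^sub>F s in at x within {a..b}. l2_norm M (\<lambda>y. w s y - w x y) < \<epsilon> / 2"
        using order_tendstoD(2)[OF cont, of x "\<epsilon> / 2"] \<epsilon> by simp
      then obtain r where r: "r > 0"
        "\<And>s. s \<in> {a..b} \<Longrightarrow> s \<noteq> x \<Longrightarrow> dist s x < r \<Longrightarrow> l2_norm M (\<lambda>y. w s y - w x y) < \<epsilon> / 2"
        by (auto simp: eventually_at)
      have r': "l2_norm M (\<lambda>y. w s y - w x y) \<le> \<epsilon> / 2" if "s \<in> {a..b}" "dist s x < r" for s
        using r(2)[OF that(1) _ that(2)] \<epsilon> by (cases "s = x") (auto simp: l2_norm_def)
      have "P c d" if cd: "c \<le> x" "x \<le> d" "d - c < r" for c d
        unfolding P_def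
      proof (intro impI)
        assume l: "a \<le> c" "c \<le> d" "d \<le> b"
        show "(N d)\<^sup>2 - (N c)\<^sup>2 \<le> integral {c..d} ?f"
        proof (rule step[OF l])
          fix \<tau> assume t: "\<tau> \<in> {c..d}"
          have "l2_norm M (\<lambda>y. (w d y - w x y) - (w \<tau> y - w x y))
              \<le> l2_norm M (\<lambda>y. w d y - w x y) + l2_norm M (\<lambda>y. w \<tau> y - w x y)"
            using l t x by (intro l2_norm_triangle_diff sq_integrable_diff w) auto
          also have "\<dots> \<le> \<epsilon> / 2 + \<epsilon> / 2"
            using l t x cd by (intro add_mono r') (auto simp: dist_real_def)
          finally show "l2_norm M (\<lambda>x. w d x - w \<tau> x) \<le> \<epsilon>" by simp
        qed
      qed
      then show "\<exists>d>0. \<forall>c e. c \<le> x \<and> x \<le> e \<and> e - c < d \<longrightarrow> P c e" using r(1) by blast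
    qed
    then show ?thesis using ab by (simp add: P_def)
  qed
  have Eon: "(\<lambda>\<tau>. 2 * \<kappa> * (N \<tau>)\<^sup>2) integrable_on {a..b}" and mon: "m integrable_on {a..b}"
    using Ei m by (auto intro!: integrable_on_lebesgue_on)
  have "(N b)\<^sup>2 - (N a)\<^sup>2 \<le> integral {a..b} (\<lambda>\<tau>. 2 * \<kappa> * (N \<tau>)\<^sup>2) + e" if e: "e > 0" for e
  proof -
    define B where "B = integral {a..b} m"
    have B: "B \<ge> 0" unfolding B_def using m(2) by (intro Henstock_Kurzweil_Integration.integral_nonneg mon) auto
    \<comment> \<open>Adding 1 keeps the denominator positive when m integrates to 0.\<close>
    define \<epsilon> where "\<epsilon> = e / (2 * (B + 1))"
    have \<epsilon>: "\<epsilon> > 0" using B e by (simp add: \<epsilon>_def)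
    have "integral {a..b} (\<lambda>\<tau>. 2 * (\<kappa> * (N \<tau>)\<^sup>2 + \<epsilon> * m \<tau>))
        = integral {a..b} (\<lambda>\<tau>. 2 * \<kappa> * (N \<tau>)\<^sup>2 + (2 * \<epsilon>) * m \<tau>)"
      by (simp add: algebra_simps)
    also have "\<dots> = integral {a..b} (\<lambda>\<tau>. 2 * \<kappa> * (N \<tau>)\<^sup>2) + (2 * \<epsilon>) * B"
      unfolding B_def
      by (subst Henstock_Kurzweil_Integration.integral_add[OF Eon]) (use integrable_on_mult_right[OF mon] in auto)
    also have "(2 * \<epsilon>) * B \<le> e"
    proof -
      have "(2 * \<epsilon>) * B \<le> (2 * \<epsilon>) * (B + 1)" using \<epsilon> by simp
      also have "\<dots> = e"
      proof -
        have "2 * (B + 1) \<noteq> 0" using B by (intro less_imp_neq[symmetric]) simp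
        then have "\<epsilon> * (2 * (B + 1)) = e" unfolding \<epsilon>_def by (rule nonzero_eq_divide_eq[THEN iffD1, OF _ refl])
        then show ?thesis by (simp only: mult.assoc mult.left_commute)
      qed
      finally show ?thesis .
    qed
    finally show ?thesis using eps[OF \<epsilon>] by simp
  qed
  then have "(N b)\<^sup>2 - (N a)\<^sup>2 \<le> integral {a..b} (\<lambda>\<tau>. 2 * \<kappa> * (N \<tau>)\<^sup>2)"
    by (rule field_le_epsilon)
  then show "(l2_norm M (\<lambda>x. max (w b x) 0))\<^sup>2 - (l2_norm M (\<lambda>x. max (w a x) 0))\<^sup>2
      \<le> integral {a..b} (\<lambda>\<tau>. 2 * \<kappa> * (l2_norm M (\<lambda>x. max (w \<tau> x) 0))\<^sup>2)"
    by (simp add: N_def)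
qed

text \<open>The increments are controlled away from \<open>0\<close> only; continuity at \<open>0\<close> gives \<open>E t \<le> 2 \<kappa> y t\<close> for the primitive
  \<open>y\<close> of \<open>E\<close>, so that \<open>exp (- 2 \<kappa> t) y t\<close> is nonincreasing and starts at \<open>0\<close>.\<close>

lemma gronwall_zero:
  fixes E :: "real \<Rightarrow> real"
  assumes T: "0 < T" and \<kappa>: "0 \<le> \<kappa>" and E: "continuous_on {0..T} E" "E 0 = 0" "\<And>t. t \<in> {0..T} \<Longrightarrow> 0 \<le> E t"
    and incr: "\<And>a b. 0 < a \<Longrightarrow> a \<le> b \<Longrightarrow> b \<le> T \<Longrightarrow> E b - E a \<le> integral {a..b} (\<lambda>\<tau>. 2 * \<kappa> * E \<tau>)"
  shows "E T = 0"
proof -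
  let ?y = "\<lambda>t. integral {0..t} E"
  have Ei: "E integrable_on {0..b}" if "b \<le> T" for b
    using that by (intro integrable_continuous_real continuous_on_subset[OF E(1)]) auto
  \<comment> \<open>Let the left end point of the increment tend to 0.\<close>
  have bound: "E b \<le> 2 * \<kappa> * ?y b" if b: "0 < b" "b \<le> T" for b
  proof (rule tendsto_lowerbound)
    have "(E \<longlongrightarrow> E 0) (at 0 within {0..T})"
      using E(1) T by (simp add: continuous_on_def)
    then have "(E \<longlongrightarrow> 0) (at_right 0)"
      using T E(2) at_within_Icc_at_right[of 0 T] by simp
    then show "((\<lambda>a. 2 * \<kappa> * ?y b + E a) \<longlongrightarrow> 2 * \<kappa> * ?y b) (at_right 0)"
      using tendsto_add[OF tendsto_const] by fastforce
    show "\<forall>\<^sub>F a in at_right 0. E b \<le> 2 * \<kappa> * ?y b + E a"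
      using eventually_at_right_less[of "0::real"] eventually_at_rightI[OF _ b(1), of "\<lambda>a. a < b", simplified]
    proof eventually_elim
      case (elim a)
      have "E b - E a \<le> integral {a..b} (\<lambda>\<tau>. 2 * \<kappa> * E \<tau>)"
        by (rule incr) (use elim b in auto)
      also have "\<dots> = 2 * \<kappa> * integral {a..b} E" by simp
      also have "\<dots> \<le> 2 * \<kappa> * ?y b"
      proof (rule mult_left_mono)
        have "integral {0..a} E + integral {a..b} E = ?y b"
          by (rule Henstock_Kurzweil_Integration.integral_combine) (use elim Ei b in auto)
        moreover have "0 \<le> integral {0..a} E"
          using elim b by (intro Henstock_Kurzweil_Integration.integral_nonneg Ei E(3)) auto
        ultimately show "integral {a..b} E \<le> ?y b" by simp
      qed (use \<kappa> in simp)
      finally show ?case by simp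
    qed
  qed simp
  define g where "g t = exp (- (2 * \<kappa> * t)) * ?y t" for t
  have "g T \<le> g 0"
  proof (rule DERIV_nonpos_imp_decreasing_open[of 0 T g])
    show "0 \<le> T" using T by simp
    show "continuous_on {0..T} g"
      unfolding g_def[abs_def]
      by (rule continuous_on_mult[OF _ indefinite_integral_continuous_1[OF Ei]]) (auto intro!: continuous_intros)
    fix t assume t: "0 < t" "t < T"
    have "(?y has_real_derivative E t) (at t within {0..T})"
      using t by (intro integral_has_real_derivative E(1)) auto
    then have "(?y has_real_derivative E t) (at t)"
      using t by (simp add: at_within_Icc_at)
    then have "(g has_real_derivative (exp (- (2 * \<kappa> * t)) * (E t - 2 * \<kappa> * ?y t))) (at t)"
      unfolding g_def[abs_def] by (auto intro!: derivative_eq_intros simp: algebra_simps)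
    moreover have "exp (- (2 * \<kappa> * t)) * (E t - 2 * \<kappa> * ?y t) \<le> 0"
      using bound[of t] t by (intro mult_nonneg_nonpos) auto
    ultimately show "\<exists>y. (g has_real_derivative y) (at t) \<and> y \<le> 0" by blast
  qed
  then have "?y T \<le> 0" by (simp add: g_def mult_le_0_iff)
  then have "2 * \<kappa> * ?y T \<le> 0" using \<kappa> by (simp add: mult_nonneg_nonpos)
  then show ?thesis using bound[of T] E(3)[of T] T by force
qed

section \<open>Null sets in space-time\<close>

text \<open>A Lebesgue null set of the product lies in a Borel null set, almost all of whose slices are null by
  Fubini's theorem.\<close>

lemma AE_lebesgue_on_Times:
  fixes \<Omega> :: "'a::euclidean_space set" and I :: "real set"
  assumes \<Omega>: "open \<Omega>" and I: "open I"
    and ae: "AE (x, t) in lebesgue_on (\<Omega> \<times> I). P x t"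
  shows "AE t in lebesgue_on I. AE x in lebesgue_on \<Omega>. P x t"
proof -
  have s: "\<Omega> \<in> sets lebesgue" "I \<in> sets lebesgue" "\<Omega> \<times> I \<in> sets lebesgue"
    using \<Omega> I open_Times[OF \<Omega> I] by auto
  have "AE z in lebesgue. z \<in> \<Omega> \<times> I \<longrightarrow> P (fst z) (snd z)"
    using ae s(3) by (simp add: AE_restrict_space_iff case_prod_unfold)
  then have "AE z in (lborel :: ('a \<times> real) measure). z \<in> \<Omega> \<times> I \<longrightarrow> P (fst z) (snd z)"
    by (simp only: AE_completion_iff)
  then obtain N where N: "{z \<in> space (lborel :: ('a \<times> real) measure). \<not> (z \<in> \<Omega> \<times> I \<longrightarrow> P (fst z) (snd z))} \<subseteq> N"
    "emeasure (lborel :: ('a \<times> real) measure) N = 0" "N \<in> sets (lborel :: ('a \<times> real) measure)"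
    by (rule AE_E)
  have Np: "N \<in> sets (lborel \<Otimes>\<^sub>M lborel)" by (subst lborel_prod) (rule N(3))
  have "(\<integral>\<^sup>+ t. emeasure lborel ((\<lambda>x. (x, t)) -` N) \<partial>lborel) = 0"
    using N(2) lborel_pair.emeasure_pair_measure_alt2[OF Np] by (simp add: lborel_prod)
  then have "AE t in lborel. emeasure lborel ((\<lambda>x. (x, t)) -` N) = 0"
    using lborel_pair.measurable_emeasure_Pair2[OF Np] by (simp add: nn_integral_0_iff_AE)
  then have "AE t in lborel. t \<in> I \<longrightarrow> (AE x in lebesgue_on \<Omega>. P x t)"
  proof eventually_elim
    case (elim t)
    show ?case
    proof
      assume t: "t \<in> I"
      have m: "(\<lambda>x. (x, t)) -` N \<in> sets lborel" using sets_Pair2[OF Np] by simp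
      have "AE x in lborel. x \<notin> (\<lambda>x. (x, t)) -` N"
        by (rule AE_not_in) (use elim m in \<open>auto simp: null_sets_def\<close>)
      then have "AE x in lborel. x \<in> \<Omega> \<longrightarrow> P x t"
        by eventually_elim (use N(1) t in auto)
      then show "AE x in lebesgue_on \<Omega>. P x t"
        using s(1) by (simp add: AE_restrict_space_iff AE_completion)
    qed
  qed
  then show ?thesis using s(2) by (simp add: AE_restrict_space_iff AE_completion)
qed

text \<open>The exceptional set is a Borel set up to a null set, and a Borel set with null slices is null.\<close>

lemma AE_lebesgue_on_TimesI:
  fixes \<Omega> :: "'a::euclidean_space set" and I :: "real set"
  assumes \<Omega>: "open \<Omega>" and I: "open I"
    and meas: "{z \<in> \<Omega> \<times> I. \<not> P (fst z) (snd z)} \<in> sets lebesgue"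
    and ae: "\<And>t. t \<in> I \<Longrightarrow> AE x in lebesgue_on \<Omega>. P x t"
  shows "AE (x, t) in lebesgue_on (\<Omega> \<times> I). P x t"
proof -
  have s: "\<Omega> \<in> sets lebesgue" "\<Omega> \<times> I \<in> sets lebesgue"
    using \<Omega> open_Times[OF \<Omega> I] by auto
  let ?S = "{z \<in> \<Omega> \<times> I. \<not> P (fst z) (snd z)}"
  obtain B N N' where B: "?S = B \<union> N" "N \<subseteq> N'" "N' \<in> null_sets lborel" "B \<in> sets lborel"
    using meas by (rule sets_completionE)
  have BS: "B \<subseteq> ?S" using B(1) by blast
  have Bp: "B \<in> sets (lborel \<Otimes>\<^sub>M lborel)" by (subst lborel_prod) (rule B(4))
  have "emeasure lborel ((\<lambda>x. (x, t)) -` B) = 0" for t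
  proof -
    have m: "(\<lambda>x. (x, t)) -` B \<in> sets lborel" using sets_Pair2[OF Bp] by simp
    have "AE x in lebesgue. x \<notin> (\<lambda>x. (x, t)) -` B"
    proof (cases "t \<in> I")
      case True
      have "AE x in lebesgue. x \<in> \<Omega> \<longrightarrow> P x t"
        using ae[OF True] s(1) by (simp add: AE_restrict_space_iff)
      then show ?thesis by eventually_elim (use subsetD[OF BS] in force)
    next
      case False then show ?thesis using subsetD[OF BS] by force
    qed
    then have "AE x in lborel. x \<notin> (\<lambda>x. (x, t)) -` B" by (simp only: AE_completion_iff)
    then have "(\<lambda>x. (x, t)) -` B \<in> null_sets lborel" using AE_iff_null_sets[OF m] by blast
    then show ?thesis by auto
  qed
  then have "emeasure lborel B = 0"
    using lborel_pair.emeasure_pair_measure_alt2[OF Bp] by (simp add: lborel_prod)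
  then have "B \<in> null_sets lborel" using B(4) by auto
  then have "AE z in lborel. z \<notin> B" "AE z in lborel. z \<notin> N'"
    using B(3) by (auto intro: AE_not_in)
  then have "AE z in lborel. z \<in> \<Omega> \<times> I \<longrightarrow> P (fst z) (snd z)"
    by eventually_elim (use B(1,2) in blast)
  then have "AE z in lebesgue. z \<in> \<Omega> \<times> I \<longrightarrow> P (fst z) (snd z)" by (rule AE_completion)
  then show ?thesis using s(2) by (simp add: AE_restrict_space_iff case_prod_unfold)
qed

section \<open>The obstacle_comparison principle\<close>

lemma subdiff_obstacleD:
  assumes "\<eta> \<in> subdiff_obstacle a s"
  shows "a \<le> s" "\<eta> \<le> 0" "a < s \<Longrightarrow> \<eta> = 0"
  using assms by (auto simp: subdiff_obstacle_def split: if_splits)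

text \<open>If \<open>s > r\<close>, then \<open>s\<close> exceeds its obstacle \<open>a\<close>, since \<open>s > r \<ge> b \<ge> a\<close>; so \<open>\<eta> = 0\<close>, while \<open>\<theta> \<le> 0\<close> and \<open>r\<^sup>3 \<le> s\<^sup>3\<close>
  have favourable signs.\<close>

lemma obstacle_pointwise:
  fixes a b s r :: real
  assumes ab: "a \<le> b" and sub: "\<eta> \<in> subdiff_obstacle a s" "p + \<eta> - l + s ^ 3 - \<kappa> * s \<le> 0"
    and super: "\<theta> \<in> subdiff_obstacle b r" "p' + \<theta> - l' + r ^ 3 - \<kappa> * r \<ge> 0"
  shows "(p - p') * max (s - r) 0 \<le> (l - l') * max (s - r) 0 + \<kappa> * (max (s - r) 0)\<^sup>2"
proof (cases "s > r")
  case True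
  have "a < s" using subdiff_obstacleD(1)[OF super(1)] ab True by simp
  then have "\<eta> = 0" by (rule subdiff_obstacleD(3)[OF sub(1)])
  moreover have "\<theta> \<le> 0" by (rule subdiff_obstacleD(2)[OF super(1)])
  moreover have "r ^ 3 \<le> s ^ 3" using True by (intro power_mono_odd) auto
  ultimately have "p - p' \<le> (l - l') + \<kappa> * (s - r)"
    using sub(2) super(2) by (simp add: right_diff_distrib)
  then have "(p - p') * (s - r) \<le> ((l - l') + \<kappa> * (s - r)) * (s - r)"
    using True by (intro mult_right_mono) auto
  then show ?thesis using True by (simp add: power2_eq_square distrib_right mult.assoc)
next
  case False then show ?thesis by simp
qed

lemma C_into_L2D:
  assumes "u \<in> C_into S (Lp 2 \<Omega>)" "t \<in> S"
  shows "u t \<in> sq_integrable (lebesgue_on \<Omega>)"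
    "((\<lambda>s. l2_norm (lebesgue_on \<Omega>) (\<lambda>x. u s x - u t x)) \<longlongrightarrow> 0) (at t within S)"
  using assms by (auto simp: C_into_def elts_Lp2 nrm_Lp2)

lemma C_into_subset: "u \<in> C_into S X \<Longrightarrow> R \<subseteq> S \<Longrightarrow> u \<in> C_into R X"
  unfolding C_into_def by (auto intro: tendsto_within_subset)

lemma regular_on_H10: "regular_on \<Omega> \<delta> T u \<Longrightarrow> t \<in> {\<delta>..T} \<Longrightarrow> u t \<in> elts (H10 \<Omega>)"
  by (auto simp: regular_on_def C_into_def inter_space_def)

text \<open>One statement for both parts of the theorem: \<open>I = (0, T)\<close> with \<open>\<le>\<close> for \<open>Ru\<close> and \<open>\<ge>\<close> for \<open>Rv\<close> compares a
  subsolution with a supersolution, and \<open>I = (0, \<infinity>)\<close> with equality for both compares two solutions. The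
  functions \<open>a\<close> and \<open>b\<close> are the obstacles.\<close>

lemma obstacle_comparison:
  fixes \<Omega> :: "'a::euclidean_space set" and I :: "real set"
  assumes \<Omega>: "open \<Omega>" "bounded \<Omega>" and \<kappa>: "\<kappa> \<ge> 0"
    and I: "open I" "I \<subseteq> {0<..}" "\<And>t. t \<in> I \<Longrightarrow> {0<..t} \<subseteq> I"
    and u: "u \<in> C_into (insert 0 I) (Lp 2 \<Omega>)" "\<And>t. t \<in> I \<Longrightarrow> u t \<in> elts (H10 \<Omega>)"
    and v: "v \<in> C_into (insert 0 I) (Lp 2 \<Omega>)" "\<And>t. t \<in> I \<Longrightarrow> v t \<in> elts (H10 \<Omega>)"
    and Ru: "obstacle_inclusion Ru \<Omega> \<kappa> I a u" "\<And>x. Ru x 0 \<Longrightarrow> x \<le> 0"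
    and Rv: "obstacle_inclusion Rv \<Omega> \<kappa> I b v" "\<And>x. Rv x 0 \<Longrightarrow> x \<ge> 0"
    and ab: "AE x in lebesgue_on \<Omega>. a x \<le> b x" and init: "AE x in lebesgue_on \<Omega>. u 0 x \<le> v 0 x"
    and T: "T \<in> I"
  shows "AE x in lebesgue_on \<Omega>. u T x \<le> v T x"
proof -
  let ?M = "lebesgue_on \<Omega>"
  have fin: "finite_measure ?M" using \<Omega> by (rule finite_measure_lebesgue_on)
  have Is: "I \<in> sets lebesgue" using I(1) by auto
  have T0: "T > 0" using T I(2) by auto
  have sub0: "{0..T} \<subseteq> insert 0 I" using I(3)[OF T] by (auto simp: less_le)
  obtain \<eta> ut lu where U: "is_time_deriv I (Lp 2 \<Omega>) u ut"
    "AE t in lebesgue_on I. is_laplacian \<Omega> (u t) (lu t)"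
    "AE (x, t) in lebesgue_on (\<Omega> \<times> I). Ru (ut t x + \<eta> t x - lu t x + (u t x) ^ 3 - \<kappa> * u t x) 0 \<and>
           \<eta> t x \<in> subdiff_obstacle (a x) (u t x)"
    using Ru(1) unfolding obstacle_inclusion_def by blast
  obtain \<theta> vt lv where V: "is_time_deriv I (Lp 2 \<Omega>) v vt"
    "AE t in lebesgue_on I. is_laplacian \<Omega> (v t) (lv t)"
    "AE (x, t) in lebesgue_on (\<Omega> \<times> I). Rv (vt t x + \<theta> t x - lv t x + (v t x) ^ 3 - \<kappa> * v t x) 0 \<and>
           \<theta> t x \<in> subdiff_obstacle (b x) (v t x)"
    using Rv(1) unfolding obstacle_inclusion_def by blast
  note U3 = AE_lebesgue_on_Times[OF \<Omega>(1) I(1) U(3)] and V3 = AE_lebesgue_on_Times[OF \<Omega>(1) I(1) V(3)]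
  have uI: "\<forall>t\<in>I. u t \<in> sq_integrable ?M"
      "\<forall>t\<in>I. ((\<lambda>s. l2_norm ?M (\<lambda>x. u s x - u t x)) \<longlongrightarrow> 0) (at t within I)"
    using C_into_L2D[OF C_into_subset[OF u(1) subset_insertI]] by blast+
  have vI: "\<forall>t\<in>I. v t \<in> sq_integrable ?M"
      "\<forall>t\<in>I. ((\<lambda>s. l2_norm ?M (\<lambda>x. v s x - v t x)) \<longlongrightarrow> 0) (at t within I)"
    using C_into_L2D[OF C_into_subset[OF v(1) subset_insertI]] by blast+
  define w where "w t x = u t x - v t x" for t x
  have w: "w t \<in> sq_integrable ?M" if "t \<in> {0..T}" for t
    unfolding w_def[abs_def]
    by (intro sq_integrable_diff C_into_L2D(1)[OF u(1)] C_into_L2D(1)[OF v(1)]) (use that sub0 in auto)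
  have wc: "((\<lambda>s. l2_norm ?M (\<lambda>x. w s x - w t x)) \<longlongrightarrow> 0) (at t within {0..T})" if t: "t \<in> {0..T}" for t
  proof (rule Lim_null_comparison)
    have t': "t \<in> insert 0 I" using t sub0 by auto
    have "((\<lambda>s. l2_norm ?M (\<lambda>x. u s x - u t x) + l2_norm ?M (\<lambda>x. v s x - v t x)) \<longlongrightarrow> 0 + 0) (at t within insert 0 I)"
      by (intro tendsto_add C_into_L2D(2)[OF u(1) t'] C_into_L2D(2)[OF v(1) t'])
    then show "((\<lambda>s. l2_norm ?M (\<lambda>x. u s x - u t x) + l2_norm ?M (\<lambda>x. v s x - v t x)) \<longlongrightarrow> 0) (at t within {0..T})"
      using tendsto_within_subset[OF _ sub0] by simp
    have "\<forall>\<^sub>F s in at t within {0..T}. s \<in> {0..T}" by (simp add: eventually_at_filter)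
    then show "\<forall>\<^sub>F s in at t within {0..T}. norm (l2_norm ?M (\<lambda>x. w s x - w t x))
        \<le> l2_norm ?M (\<lambda>x. u s x - u t x) + l2_norm ?M (\<lambda>x. v s x - v t x)"
    proof eventually_elim
      case (elim s)
      then have s': "s \<in> insert 0 I" using sub0 by auto
      have "(\<lambda>x. w s x - w t x) = (\<lambda>x. (u s x - u t x) - (v s x - v t x))" by (simp add: w_def fun_eq_iff)
      then show ?case
        using l2_norm_triangle_diff[OF sq_integrable_diff sq_integrable_diff,
            OF C_into_L2D(1)[OF u(1) s'] C_into_L2D(1)[OF u(1) t'] C_into_L2D(1)[OF v(1) s'] C_into_L2D(1)[OF v(1) t']]
        by simp
    qed
  qed
  define q where "q z t = (LINT x|?M. ut t x * z x) - (LINT x|?M. vt t x * z x)" for z t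
  define E where "E t = (l2_norm ?M (\<lambda>x. max (w t x) 0))\<^sup>2" for t
  have energy: "E t - E s \<le> integral {s..t} (\<lambda>\<tau>. 2 * \<kappa> * E \<tau>)"
    if st: "0 < s" "s \<le> t" "t \<le> T" for s t
  proof -
    have stI: "{s..t} \<subseteq> I" and st0: "{s..t} \<subseteq> {0..T}" using st I(3)[OF T] by auto
    have sts: "{s..t} \<in> sets lebesgue" by simp
    note P = time_deriv_pairing[OF \<Omega> I(1) U(1) uI]
    note R = time_deriv_pairing[OF \<Omega> I(1) V(1) vI]
    let ?m = "\<lambda>\<tau>. l2_norm ?M (ut \<tau>) + l2_norm ?M (vt \<tau>)"
    have lip: "AE \<tau> in lebesgue_on {s..t}. \<forall>y\<in>sq_integrable ?M. \<forall>z\<in>sq_integrable ?M.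
       q y \<tau> - q z \<tau> \<le> ?m \<tau> * l2_norm ?M (\<lambda>x. y x - z x)"
      using P(1)[OF st(2) stI] R(1)[OF st(2) stI]
    proof eventually_elim
      case (elim \<tau>)
      show ?case
      proof (intro ballI)
        fix y z assume y: "y \<in> sq_integrable ?M" and z: "z \<in> sq_integrable ?M"
        have "(LINT x|?M. ut \<tau> x * y x) - (LINT x|?M. ut \<tau> x * z x) \<le> l2_norm ?M (\<lambda>x. y x - z x) * l2_norm ?M (ut \<tau>)"
          using l2_pairing_diff_le[OF y z elim(1)] by (simp add: mult.commute abs_le_iff)
        moreover have "(LINT x|?M. vt \<tau> x * z x) - (LINT x|?M. vt \<tau> x * y x) \<le> l2_norm ?M (\<lambda>x. y x - z x) * l2_norm ?M (vt \<tau>)"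
          using l2_pairing_diff_le[OF y z elim(2)] by (simp add: mult.commute abs_le_iff)
        ultimately show "q y \<tau> - q z \<tau> \<le> ?m \<tau> * l2_norm ?M (\<lambda>x. y x - z x)"
          by (simp add: q_def algebra_simps)
      qed
    qed
    have on: "AE \<tau> in lebesgue_on {s..t}. \<tau> \<in> {s..t}" by (rule AE_I2) simp
    note sub = AE_lebesgue_on_subset[OF _ stI sts Is]
    have diss: "AE \<tau> in lebesgue_on {s..t}. q (\<lambda>x. max (w \<tau> x) 0) \<tau> \<le> \<kappa> * (l2_norm ?M (\<lambda>x. max (w \<tau> x) 0))\<^sup>2"
      using P(1)[OF st(2) stI] R(1)[OF st(2) stI] sub[OF U(2)] sub[OF V(2)] sub[OF U3] sub[OF V3] on
    proof eventually_elim
      case (elim \<tau>)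
      have \<tau>: "\<tau> \<in> I" "\<tau> \<in> {0..T}" using elim(7) stI st0 by auto
      let ?z = "\<lambda>x. max (w \<tau> x) 0"
      have z: "?z \<in> sq_integrable ?M" by (rule sq_integrable_pos_part[OF w[OF \<tau>(2)]])
      obtain L where L: "L \<in> sq_integrable ?M" "AE x in ?M. L x = lu \<tau> x - lv \<tau> x"
        "(LINT x|?M. L x * max (u \<tau> x - v \<tau> x) 0) \<le> 0"
        by (rule laplacian_diff_pos_part[OF \<Omega> u(2)[OF \<tau>(1)] elim(3) v(2)[OF \<tau>(1)] elim(4)]) blast
      note iu = sq_integrable_mult[OF elim(1) z] and iv = sq_integrable_mult[OF elim(2) z]
        and iL = sq_integrable_mult[OF L(1) z] and iz = sq_integrable_square[OF z]
      have "q ?z \<tau> = (LINT x|?M. ut \<tau> x * ?z x - vt \<tau> x * ?z x)"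
        unfolding q_def using iu iv by simp
      also have "\<dots> \<le> (LINT x|?M. L x * ?z x + \<kappa> * (?z x)\<^sup>2)"
      proof (rule integral_mono_AE)
        show "integrable ?M (\<lambda>x. ut \<tau> x * ?z x - vt \<tau> x * ?z x)" using iu iv by simp
        show "integrable ?M (\<lambda>x. L x * ?z x + \<kappa> * (?z x)\<^sup>2)" using iL iz by simp
        show "AE x in ?M. ut \<tau> x * ?z x - vt \<tau> x * ?z x \<le> L x * ?z x + \<kappa> * (?z x)\<^sup>2"
          using elim(5) elim(6) ab L(2)
        proof eventually_elim
          case (elim x)
          have "(ut \<tau> x - vt \<tau> x) * max (u \<tau> x - v \<tau> x) 0
              \<le> (lu \<tau> x - lv \<tau> x) * max (u \<tau> x - v \<tau> x) 0 + \<kappa> * (max (u \<tau> x - v \<tau> x) 0)\<^sup>2"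
            by (rule obstacle_pointwise[OF elim(3) _ Ru(2) _ Rv(2)]) (use elim(1,2) in auto)
          then show ?case using elim(4) by (simp add: w_def left_diff_distrib)
        qed
      qed
      also have "\<dots> = (LINT x|?M. L x * ?z x) + \<kappa> * (l2_norm ?M ?z)\<^sup>2"
        using iL iz by (simp add: l2_norm_sq)
      also have "\<dots> \<le> \<kappa> * (l2_norm ?M ?z)\<^sup>2" using L(3) by (simp add: w_def)
      finally show ?case .
    qed
    have qi: "integrable (lebesgue_on {c..d}) (q z)"
        "(LINT \<tau>|lebesgue_on {c..d}. q z \<tau>) = (LINT x|?M. w d x * z x) - (LINT x|?M. w c x * z x)"
      if cd: "s \<le> c" "c \<le> d" "d \<le> t" and z: "z \<in> sq_integrable ?M" for c d z
    proof -
      have cdI: "{c..d} \<subseteq> I" using cd stI by auto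
      have cI: "c \<in> I" "d \<in> I" using cd stI by auto
      note p = P(3,4)[OF cd(2) cdI z] R(3,4)[OF cd(2) cdI z]
      show "integrable (lebesgue_on {c..d}) (q z)" unfolding q_def[abs_def] using p by simp
      have wz: "(LINT x|?M. w r x * z x) = (LINT x|?M. u r x * z x) - (LINT x|?M. v r x * z x)" if "r \<in> I" for r
        unfolding w_def left_diff_distrib
        by (intro Bochner_Integration.integral_diff sq_integrable_mult z bspec[OF uI(1)] bspec[OF vI(1)] that)
      show "(LINT \<tau>|lebesgue_on {c..d}. q z \<tau>) = (LINT x|?M. w d x * z x) - (LINT x|?M. w c x * z x)"
        unfolding q_def wz[OF cI(1)] wz[OF cI(2)] using p by simp
    qed
    have mi: "integrable (lebesgue_on {s..t}) ?m"
      by (intro Bochner_Integration.integrable_add P(2)[OF st(2) stI] R(2)[OF st(2) stI])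
    have wcst: "((\<lambda>r. l2_norm ?M (\<lambda>x. w r x - w t' x)) \<longlongrightarrow> 0) (at t' within {s..t})" if "t' \<in> {s..t}" for t'
      using tendsto_within_subset[OF wc st0] that st0 by auto
    have wst: "w \<tau> \<in> sq_integrable ?M" if "\<tau> \<in> {s..t}" for \<tau> using w that st0 by auto
    note en = energy_inequality[OF st(2) wst wcst qi mi _ lip diss]
    show "E t - E s \<le> integral {s..t} (\<lambda>\<tau>. 2 * \<kappa> * E \<tau>)"
      unfolding E_def by (rule en) simp_all
  qed
  have "E T = 0"
  proof (rule gronwall_zero[OF T0 \<kappa>])
    show "continuous_on {0..T} E"
      unfolding E_def[abs_def] by (rule continuous_on_power[OF l2_pos_part_continuous[OF w wc]])
    have "AE x in ?M. max (w 0 x) 0 = 0" using init by eventually_elim (simp add: w_def)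
    moreover have "w 0 \<in> borel_measurable ?M" using w[of 0] T0 by (simp add: sq_integrable_measurable)
    ultimately have "l2_norm ?M (\<lambda>x. max (w 0 x) 0) = l2_norm ?M (\<lambda>x. 0)"
      by (intro l2_norm_cong_AE) auto
    then show "E 0 = 0" by (simp add: E_def l2_norm_def)
    show "0 \<le> E t" for t by (simp add: E_def)
  qed (rule energy)
  then have "(LINT x|?M. (max (w T x) 0)\<^sup>2) = 0" by (simp add: E_def l2_norm_sq)
  moreover have "(\<lambda>x. max (w T x) 0) \<in> sq_integrable ?M"
    using sq_integrable_pos_part[OF w[of T]] T0 by simp
  ultimately have "AE x in ?M. (max (w T x) 0)\<^sup>2 = 0"
    using integral_nonneg_eq_0_iff_AE[OF sq_integrable_square] by force
  then show ?thesis by eventually_elim (simp add: w_def max_def split: if_splits)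
qed

theorem theorem6p2:
  fixes \<Omega> :: "'a::euclidean_space set" and \<kappa> :: real
  assumes "smooth_bounded_domain \<Omega>"
    and "\<kappa> > 0"
  shows "(\<forall>(T::real) (u :: real \<Rightarrow> 'a \<Rightarrow> real) (v :: real \<Rightarrow> 'a \<Rightarrow> real).
            T > 0 \<longrightarrow>
            L2_subsolution \<Omega> \<kappa> T (u 0) u \<longrightarrow>
            L2_supersolution \<Omega> \<kappa> T (v 0) v \<longrightarrow>
            le_on_parabolic_boundary \<Omega> T u v \<longrightarrow>
            (AE (x, t) in lebesgue_on (\<Omega> \<times> {0<..<T}). u t x \<le> v t x)) \<and>
         (\<forall>(u0 :: 'a \<Rightarrow> real) (u :: real \<Rightarrow> 'a \<Rightarrow> real) (v :: real \<Rightarrow> 'a \<Rightarrow> real).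
            obstacle_solution \<Omega> \<kappa> u0 u \<longrightarrow>
            obstacle_solution \<Omega> \<kappa> u0 v \<longrightarrow>
            (\<forall>t\<ge>0. AE x in lebesgue_on \<Omega>. u t x = v t x))"
proof (intro conjI allI impI)
  have \<Omega>: "open \<Omega>" "bounded \<Omega>" using assms(1) by (auto simp: smooth_bounded_domain_def)
  have \<kappa>: "0 \<le> \<kappa>" using assms(2) by simp
  {
    fix T :: real and u v :: "real \<Rightarrow> 'a \<Rightarrow> real"
    assume T: "T > 0" and u: "L2_subsolution \<Omega> \<kappa> T (u 0) u" and v: "L2_supersolution \<Omega> \<kappa> T (v 0) v"
      and le: "le_on_parabolic_boundary \<Omega> T u v"
    let ?I = "{0<..<T}"
    have cu: "u \<in> C_into (insert 0 ?I) (Lp 2 \<Omega>)" and cv: "v \<in> C_into (insert 0 ?I) (Lp 2 \<Omega>)"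
      using u v T by (auto simp: L2_subsolution_def L2_supersolution_def elim!: C_into_subset)
    have h: "u t \<in> elts (H10 \<Omega>)" "v t \<in> elts (H10 \<Omega>)" if t: "t \<in> ?I" for t
    proof -
      have "regular_on \<Omega> t T u" "regular_on \<Omega> t T v"
        using u v t by (auto simp: L2_subsolution_def L2_supersolution_def)
      then show "u t \<in> elts (H10 \<Omega>)" "v t \<in> elts (H10 \<Omega>)"
        using t by (auto intro: regular_on_H10)
    qed
    have init: "AE x in lebesgue_on \<Omega>. u 0 x \<le> v 0 x" using le by (simp add: le_on_parabolic_boundary_def)
    have Ru: "obstacle_inclusion (\<le>) \<Omega> \<kappa> ?I (u 0) u" and Rv: "obstacle_inclusion (\<ge>) \<Omega> \<kappa> ?I (v 0) v"
      using u v by (auto simp: L2_subsolution_def L2_supersolution_def)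
    have slice: "AE x in lebesgue_on \<Omega>. u t x \<le> v t x" if t: "t \<in> ?I" for t
      by (rule obstacle_comparison[OF \<Omega> \<kappa> _ _ _ cu h(1) cv h(2) Ru _ Rv _ init init t]) auto
    have o: "\<Omega> \<times> ?I \<in> sets lebesgue" using open_Times[OF \<Omega>(1), of ?I] by auto
    have "(\<lambda>(x, t). u t x) \<in> borel_measurable (lebesgue_on (\<Omega> \<times> ?I))"
       "(\<lambda>(x, t). v t x) \<in> borel_measurable (lebesgue_on (\<Omega> \<times> ?I))"
      using u v by (auto simp: L2_subsolution_def L2_supersolution_def jointly_measurable_def)
    from borel_measurable_less[OF this(2,1)]
    have "{z \<in> \<Omega> \<times> ?I. v (snd z) (fst z) < u (snd z) (fst z)} \<in> sets (lebesgue_on (\<Omega> \<times> ?I))"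
      by (simp add: case_prod_unfold)
    then have "{z \<in> \<Omega> \<times> ?I. \<not> u (snd z) (fst z) \<le> v (snd z) (fst z)} \<in> sets lebesgue"
      using o by (simp add: sets_restrict_space_iff not_le)
    then show "AE (x, t) in lebesgue_on (\<Omega> \<times> ?I). u t x \<le> v t x"
      by (rule AE_lebesgue_on_TimesI[OF \<Omega>(1) open_greaterThanLessThan, where P = "\<lambda>x t. u t x \<le> v t x"]) (rule slice)
  }
  {
    have le: "AE x in lebesgue_on \<Omega>. u t x \<le> v t x"
      if u: "obstacle_solution \<Omega> \<kappa> u0 u" and v: "obstacle_solution \<Omega> \<kappa> u0 v" and t: "t \<ge> 0"
      for u0 :: "'a \<Rightarrow> real" and u v :: "real \<Rightarrow> 'a \<Rightarrow> real" and t
    proof -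
      have "AE x in lebesgue_on \<Omega>. u 0 x = u0 x" "AE x in lebesgue_on \<Omega>. v 0 x = u0 x"
        using u v by (auto simp: obstacle_solution_def)
      then have init: "AE x in lebesgue_on \<Omega>. u 0 x \<le> v 0 x" by eventually_elim simp
      show ?thesis
      proof (cases "t = 0")
        case True then show ?thesis using init by simp
      next
        case False
        then have tI: "t \<in> {0<..}" using t by simp
        have i0: "insert 0 {0<..} = {0::real..}" by auto
        have cu: "u \<in> C_into (insert 0 {0<..}) (Lp 2 \<Omega>)" and cv: "v \<in> C_into (insert 0 {0<..}) (Lp 2 \<Omega>)"
          using u v unfolding i0 by (auto simp: obstacle_solution_def)
        have h: "u s \<in> elts (H10 \<Omega>)" "v s \<in> elts (H10 \<Omega>)" if s: "s \<in> {0<..}" for s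
        proof -
          have "regular_on \<Omega> s (s + 1) u" "regular_on \<Omega> s (s + 1) v"
            using u v s by (auto simp: obstacle_solution_def)
          then show "u s \<in> elts (H10 \<Omega>)" "v s \<in> elts (H10 \<Omega>)"
            by (auto intro: regular_on_H10)
        qed
        have Ru: "obstacle_inclusion (=) \<Omega> \<kappa> {0<..} u0 u" and Rv: "obstacle_inclusion (=) \<Omega> \<kappa> {0<..} u0 v"
          using u v by (auto simp: obstacle_solution_def)
        show ?thesis
          by (rule obstacle_comparison[OF \<Omega> \<kappa> _ _ _ cu h(1) cv h(2) Ru _ Rv _ _ init tI]) auto
      qed
    qed
    fix u0 :: "'a \<Rightarrow> real" and u v :: "real \<Rightarrow> 'a \<Rightarrow> real" and t :: real
    assume u: "obstacle_solution \<Omega> \<kappa> u0 u" and v: "obstacle_solution \<Omega> \<kappa> u0 v" and t: "0 \<le> t"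
    show "AE x in lebesgue_on \<Omega>. u t x = v t x"
      using le[OF u v t] le[OF v u t] by eventually_elim simp
  }
qed

end
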